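(* The vertex-reinforced jump process on the $3$-ary tree $\mathcal{T}^{(3)}$, started at the root, is transient, and hence drifts to infinity.
   Context: The $b$-ary tree $\mathcal{T}^{(b)}$ is the infinite rooted tree in which each vertex has $b+1$ neighbors, except the root, which has $b$ neighbors. Vertex-reinforced jump process (VRJP) on a locally finite graph: a right-continuous, continuous-time process $X_t$, $t\ge 0$, taking values in the vertices and jumping only to nearest neighbors, such that, given $X_s$ for $0\le s\le t$ and $X_t=x$, the conditional probability that in the interval $(t,t+dt)$ the process jumps to the nearest neighbor $y$ of $x$ is $L(y,t)\,dt$, where $L(y,t):=1+\int_0^t \mathbf{1}_{\{X_s=y\}}\,ds$. Terminology: the process is transient if, with positive probability, it does not return to its starting point (after leaving it, none of its subsequent jumps is to the starting point). It drifts to infinity if, almost surely, it visits each vertex only finitely many times. Known result that may be used (zero–one law of Davis and Volkov): for each $b\ge1$, VRJP on $\mathcal{T}^{(b)}$ either visits every vertex infinitely often a.s., or visits every vertex only finitely often a.s. *)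

theory Defs
  imports "HOL-Probability.Probability"
begin

section \<open>Graphs and the \<open>b\<close>-ary tree\<close>

locale locally_finite_graph =
  fixes V :: "'v set" and adj :: "'v \<Rightarrow> 'v \<Rightarrow> bool"
  assumes adj_in: "adj x y \<Longrightarrow> x \<in> V \<and> y \<in> V"
    and adj_sym: "adj x y \<Longrightarrow> adj y x"
    and adj_irrefl: "\<not> adj x x"
    and finite_neighbours: "x \<in> V \<Longrightarrow> finite {y. adj x y}"

text \<open>
  A vertex is the list of child indices on its path to the root, last step first:
  the root is \<open>[]\<close> and the children of \<open>v\<close> are \<open>i # v\<close> for \<open>i < b\<close>.
\<close>

definition tree_vertices :: "nat \<Rightarrow> nat list set" where
  "tree_vertices b = lists {..<b}"

definition tree_adj :: "nat \<Rightarrow> nat list \<Rightarrow> nat list \<Rightarrow> bool" where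
  "tree_adj b v w \<longleftrightarrow> v \<in> tree_vertices b \<and> w \<in> tree_vertices b \<and>
     (\<exists>i. w = i # v \<or> v = i # w)"

lemma tree_neighbours_root: "{w. tree_adj b [] w} = (\<lambda>i. [i]) ` {..<b}"
  by (auto simp: tree_adj_def tree_vertices_def)

lemma tree_neighbours_Cons:
  "i # v \<in> tree_vertices b \<Longrightarrow>
     {w. tree_adj b (i # v) w} = insert v ((\<lambda>j. j # i # v) ` {..<b})"
  by (auto simp: tree_adj_def tree_vertices_def)

lemma tree_degree:
  assumes "v \<in> tree_vertices b"
  shows "finite {w. tree_adj b v w}"
    and "card {w. tree_adj b v w} = (if v = [] then b else b + 1)"
proof -
  have "finite {w. tree_adj b v w} \<and>
    card {w. tree_adj b v w} = (if v = [] then b else b + 1)"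
  proof (cases v)
    case Nil
    then show ?thesis
      by (simp add: tree_neighbours_root card_image inj_on_def)
  next
    case (Cons i u)
    have "u \<notin> (\<lambda>j. j # i # u) ` {..<b}" by auto
    then show ?thesis
      using assms by (simp add: Cons tree_neighbours_Cons card_image inj_on_def)
  qed
  then show "finite {w. tree_adj b v w}"
    and "card {w. tree_adj b v w} = (if v = [] then b else b + 1)" by auto
qed

lemma locally_finite_graph_tree: "locally_finite_graph (tree_vertices b) (tree_adj b)"
  by unfold_locales (auto simp: tree_degree(1), auto simp: tree_adj_def)

section \<open>The vertex-reinforced jump process\<close>

text \<open>
  Processes \<open>X t \<omega>\<close> are indexed by real times, of which only \<open>t \<ge> 0\<close> matter;
  correspondingly, \<open>jumps_to p s y\<close> is only ever used for \<open>s > 0\<close>.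
\<close>

definition jumps_to :: "(real \<Rightarrow> 'v) \<Rightarrow> real \<Rightarrow> 'v \<Rightarrow> bool" where
  "jumps_to p s y \<longleftrightarrow> p s = y \<and> (\<forall>\<^sub>F u in at_left s. p u \<noteq> y)"

definition local_time :: "(real \<Rightarrow> 'v) \<Rightarrow> 'v \<Rightarrow> real \<Rightarrow> real" where
  "local_time p y t = 1 + (LINT s:{0..t}|lborel. of_bool (p s = y))"

text \<open>The \<open>\<sigma>\<close>-algebra generated by \<open>X s\<close> for \<open>0 \<le> s \<le> t\<close>.\<close>

definition history :: "'a measure \<Rightarrow> (real \<Rightarrow> 'a \<Rightarrow> 'v) \<Rightarrow> real \<Rightarrow> 'a measure" where
  "history M X t = sigma (space M) {X s -` A \<inter> space M | s A. s \<in> {0..t}}"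

text \<open>
  The vertex set carries the discrete topology, so right-continuity means that the
  path is constant for a while after each time \<open>t\<close>. The assumption \<open>jumps_nearest\<close>
  says that the left limit at each time exists and is the present vertex or one of
  its neighbours.

  The assumption \<open>jump_rate\<close> is the statement that, given \<open>X s\<close> for \<open>s \<le> t\<close> and
  \<open>X t = x\<close>, a jump to \<open>y\<close> occurs in \<open>(t, t + h)\<close> with conditional probability
  \<open>L(y, t) h + o(h)\<close>. The error term is uniform for \<open>t\<close> in bounded intervals and
  almost surely in \<open>\<omega>\<close>. With merely pointwise error terms the requirement would be
  too weak: it would not see an additional jump at a deterministic time, say, since
  for each \<open>t\<close> the interval \<open>(t, t + h)\<close> misses that time once \<open>h\<close> is small.
\<close>

locale vrjp = prob_space M + locally_finite_graph V adj
  for M :: "'a measure" and V :: "'v set" and adj :: "'v \<Rightarrow> 'v \<Rightarrow> bool" +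
  fixes X :: "real \<Rightarrow> 'a \<Rightarrow> 'v"
  assumes random_vertex: "0 \<le> t \<Longrightarrow> X t \<in> M \<rightarrow>\<^sub>M count_space V"
    and right_continuous:
      "\<omega> \<in> space M \<Longrightarrow> 0 \<le> t \<Longrightarrow> \<forall>\<^sub>F s in at_right t. X s \<omega> = X t \<omega>"
    and jumps_nearest:
      "\<omega> \<in> space M \<Longrightarrow> 0 < t \<Longrightarrow>
         \<exists>x. (x = X t \<omega> \<or> adj x (X t \<omega>)) \<and> (\<forall>\<^sub>F s in at_left t. X s \<omega> = x)"
    and jump_rate:
      "adj x y \<Longrightarrow> 0 < \<epsilon> \<Longrightarrow>
         \<exists>\<delta>>0. \<forall>t\<in>{0..T}. \<forall>h\<in>{0<..<\<delta>}. AE \<omega> in M. X t \<omega> = x \<longrightarrow>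
           \<bar>real_cond_exp M (history M X t)
               (indicator {\<omega> \<in> space M. \<exists>s\<in>{t<..<t + h}. jumps_to (\<lambda>u. X u \<omega>) s y}) \<omega>
             - local_time (\<lambda>u. X u \<omega>) y t * h\<bar> \<le> \<epsilon> * h"

section \<open>Transience\<close>

text \<open>
  The process leaves its starting point, and no jump is to the starting point
  (a jump to it can only happen after it has been left).
\<close>

definition never_returns :: "(real \<Rightarrow> 'v) \<Rightarrow> bool" where
  "never_returns p \<longleftrightarrow> (\<exists>s>0. p s \<noteq> p 0) \<and> (\<forall>s>0. \<not> jumps_to p s (p 0))"

definition transient :: "'a measure \<Rightarrow> (real \<Rightarrow> 'a \<Rightarrow> 'v) \<Rightarrow> bool" where
  "transient M X \<longleftrightarrow> \<P>(\<omega> in M. never_returns (\<lambda>t. X t \<omega>)) > 0"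

text \<open>
  A visit to \<open>v\<close> is a maximal time interval spent at \<open>v\<close>; apart from a possible
  visit starting at time 0, visits correspond to jumps to \<open>v\<close>.
\<close>

definition drifts_to_infinity ::
    "'a measure \<Rightarrow> 'v set \<Rightarrow> (real \<Rightarrow> 'a \<Rightarrow> 'v) \<Rightarrow> bool" where
  "drifts_to_infinity M V X \<longleftrightarrow>
     (AE \<omega> in M. \<forall>v\<in>V. finite {s. 0 < s \<and> jumps_to (\<lambda>t. X t \<omega>) s v})"

end

theory Submission
  imports Defs "HOL-Library.Sublist"
begin

text \<open>
  Two explicit functions of the present vertex and the local times turn into
  nonnegative supermartingales \<open>F (X t) (L t)\<close>. The first one belongs to an edge from
  \<open>x\<close> to its child \<open>y\<close>: \<open>L x / L y\<close>, plus \<open>1 / (L y)\<^sup>2\<close> while the process is outside the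
  subtree of \<open>y\<close>. The second one is the product, over the vertices \<open>u\<close> on the path from \<open>v\<close>
  to the present vertex, of \<open>1 - k exp (- L u / 2) / (3 L p + 9 / 2)\<close>, where \<open>k\<close> is the
  number of unexplored children of \<open>u\<close> and \<open>p\<close> is the parent of \<open>u\<close>. Each factor bounds
  the probability of ever returning from \<open>u\<close> to \<open>p\<close>; that this is a supersolution rests on
  \<open>(l + 3 / 2) exp (- (l - 1) / 2) \<le> 5 / 2 < 3\<close> for \<open>l \<ge> 1\<close>, where \<open>3\<close> is the number of
  children.

  Transience: the second supermartingale for the root is smaller than 1 during the
  first visit to a child of the root, and it equals 1 at the root, so by the
  maximal inequality the root is avoided from then on with positive probability.

  Drift to infinity: if a vertex is visited infinitely often, then some edge from
  \<open>x\<close> to \<open>y\<close> is crossed infinitely often. Since the first supermartingale converges, the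
  local time at \<open>y\<close> tends to infinity, and then so do those at all descendants of \<open>y\<close>. The
  second supermartingale for \<open>v = y\<close> keeps returning to 1, so it converges to 1. Hence,
  for every \<open>H\<close>, every descendant \<open>z\<close> of \<open>y\<close> that is deep enough is first visited when the
  local time at its parent exceeds \<open>H\<close>. Then the first supermartingale for \<open>z\<close> exceeds \<open>H\<close>,
  which has probability at most \<open>2 / H\<close>, since it starts at 2.
\<close>

section \<open>Paths\<close>

text \<open>The first function is balanced exactly, so all the slack is in the second. Write
  \<open>m\<close> for the local time at the parent, \<open>l\<close> for that at the present
  vertex, and \<open>c * exp (- l / 2) / (m + 3 / 2)\<close> for the gain per unexplored child. Its
  decay during the visit, the loss of a child by exploring it and the return to the parent cost
  \<open>1 / 2\<close>, \<open>1\<close> and \<open>m\<close> times this gain, which explains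
  \<open>m + 3 / 2\<close>. Against this stands the gain from entering a child, whose local time is
  1 and whose own 3 children are unexplored. All these terms are linear in \<open>c\<close>, so they
  compare in the same way for every \<open>c\<close>; the choice \<open>c = 1 / 3\<close> only has
  to make the remaining quadratic term fit into the gap between \<open>5 / 2\<close> and
  \<open>3\<close>.

  The obstacle is that the process is given by conditional probabilities over short intervals after
  fixed times, so that neither a generator nor stopping times are at hand. The supermartingale
  property is therefore obtained by summing over short time steps, and a stopping time is replaced
  by countably many events observed at fixed rational times.\<close>

definition jump_times :: "(real \<Rightarrow> 'v) \<Rightarrow> real set" where
  "jump_times p = {s. 0 < s \<and> jumps_to p s (p s)}"

lemma fmeasurable_lborel_bounded:
  fixes S :: "real set"
  assumes "S \<in> sets borel" "S \<subseteq> {a..b}"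
  shows "S \<in> fmeasurable lborel"
proof (rule fmeasurableI)
  have "emeasure lborel S \<le> emeasure lborel {a..b}"
    by (rule emeasure_mono) (use assms in auto)
  also have "\<dots> < \<infinity>" by (simp add: emeasure_lborel_Icc_eq)
  finally show "emeasure lborel S < \<infinity>" .
qed (use assms in simp)

lemma measure_lborel_subset_singleton:
  fixes S :: "real set"
  shows "S \<subseteq> {a} \<Longrightarrow> measure lborel S = 0"
  by (drule subset_singletonD) auto

text \<open>A single trajectory is isolated here so that all pathwise arguments are deterministic;
  the locale is interpreted at each sample point.\<close>

locale jump_path =
  fixes adj :: "'v \<Rightarrow> 'v \<Rightarrow> bool" and p :: "real \<Rightarrow> 'v"
  assumes path_right: "0 \<le> t \<Longrightarrow> \<forall>\<^sub>F s in at_right t. p s = p t"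
    and path_left: "0 < t \<Longrightarrow>
      \<exists>x. (x = p t \<or> adj x (p t)) \<and> (\<forall>\<^sub>F s in at_left t. p s = x)"
begin

lemma right_nbhd:
  assumes "0 \<le> t"
  obtains d where "d > 0" "\<And>s. t \<le> s \<Longrightarrow> s < t + d \<Longrightarrow> p s = p t"
proof -
  obtain b where b: "b > t" "\<And>s. s > t \<Longrightarrow> s < b \<Longrightarrow> p s = p t"
    using path_right[OF assms] unfolding eventually_at_right_field by blast
  show ?thesis
  proof (rule that[of "b - t"])
    fix s assume "t \<le> s" "s < t + (b - t)"
    then show "p s = p t" using b(2)[of s] by (cases "s = t") auto
  qed (use b in simp)
qed

lemma left_nbhd:
  assumes "0 < t"
  obtains d x where "d > 0" "d \<le> t" "x = p t \<or> adj x (p t)"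
    "\<And>s. t - d < s \<Longrightarrow> s < t \<Longrightarrow> p s = x"
proof -
  obtain x where x: "x = p t \<or> adj x (p t)" "\<forall>\<^sub>F s in at_left t. p s = x"
    using path_left[OF assms] by blast
  obtain b where b: "b < t" "\<And>s. s > b \<Longrightarrow> s < t \<Longrightarrow> p s = x"
    using x(2) unfolding eventually_at_left_field by blast
  show ?thesis by (rule that[of "min t (t - b)" x]) (use b x assms in auto)
qed

text \<open>Just before \<open>t\<close> the path both equals its left limit and avoids
  \<open>y\<close>. So the left limit is not \<open>y\<close>, and it must be a neighbour.\<close>

lemma jumps_toE:
  assumes "0 < t" "jumps_to p t y"
  obtains d x where "d > 0" "d \<le> t" "p t = y" "x \<noteq> y" "adj x y"
    "\<And>s. t - d < s \<Longrightarrow> s < t \<Longrightarrow> p s = x"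
proof -
  obtain d x where d: "d > 0" "d \<le> t" "x = p t \<or> adj x (p t)"
    "\<And>s. t - d < s \<Longrightarrow> s < t \<Longrightarrow> p s = x"
    using left_nbhd[OF assms(1)] by metis
  obtain b where b: "b < t" "\<And>s. s > b \<Longrightarrow> s < t \<Longrightarrow> p s \<noteq> y"
    using assms(2) unfolding eventually_at_left_field jumps_to_def by blast
  obtain r where "max b (t - d) < r" "r < t" using dense[of "max b (t - d)" t] b(1) d(1) by auto
  then have "x \<noteq> y" using b(2)[of r] d(4)[of r] by auto
  moreover have "p t = y" using assms(2) by (simp add: jumps_to_def)
  ultimately show ?thesis using that d by metis
qed

lemma jumps_toI:
  assumes "p t = y" "d > 0" "x \<noteq> y" "\<And>s. t - d < s \<Longrightarrow> s < t \<Longrightarrow> p s = x"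
  shows "jumps_to p t y"
  unfolding jumps_to_def eventually_at_left_field
  using assms by (auto intro!: exI[of _ "t - d"])

lemma no_jump_left:
  assumes "0 < t" "t \<notin> jump_times p"
  obtains d where "d > 0" "d \<le> t" "\<And>s. t - d < s \<Longrightarrow> s \<le> t \<Longrightarrow> p s = p t"
proof -
  obtain d x where d: "d > 0" "d \<le> t" "x = p t \<or> adj x (p t)"
    "\<And>s. t - d < s \<Longrightarrow> s < t \<Longrightarrow> p s = x"
    using left_nbhd[OF assms(1)] by metis
  have "x = p t" using jumps_toI[of t "p t" d x] d assms by (auto simp: jump_times_def)
  then show ?thesis using that[of d] d by (metis order_le_less)
qed

text \<open>Away from jumps the path is locally constant on both sides, and an interval is
  connected.\<close>

lemma path_const:
  assumes "0 \<le> u" "u \<le> v" "{u<..v} \<inter> jump_times p = {}"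
  shows "p v = p u"
proof -
  have "\<forall>\<^sub>F b in at a within {u..v}. p a = p b" if a: "a \<in> {u..v}" for a
  proof -
    obtain d1 where d1: "d1 > 0" "\<And>s. a \<le> s \<Longrightarrow> s < a + d1 \<Longrightarrow> p s = p a"
      using right_nbhd[of a] a assms by auto
    show ?thesis
    proof (cases "a = u")
      case True
      then have "p a = p s" if "s \<in> {u..v}" "dist s a < d1" for s
        using d1(2)[of s] that by (auto simp: dist_real_def)
      then show ?thesis unfolding eventually_at using d1(1) by (intro exI[of _ d1]) blast
    next
      case False
      then have "a > 0" "a \<notin> jump_times p" using a assms by (auto simp: disjoint_iff)
      then obtain d2 where d2: "d2 > 0" "d2 \<le> a" "\<And>s. a - d2 < s \<Longrightarrow> s \<le> a \<Longrightarrow> p s = p a"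
        by (rule no_jump_left) blast
      have "p a = p s" if "dist s a < min d1 d2" for s
        using d1(2)[of s] d2(3)[of s] that by (cases "s \<ge> a") (auto simp: dist_real_def)
      then show ?thesis unfolding eventually_at using d1(1) d2(1)
        by (intro exI[of _ "min d1 d2"]) auto
    qed
  qed
  then show ?thesis
    using connected_local_const[of "{u..v}" u v p] assms by auto
qed

text \<open>Non-explosion comes from the existence of left limits: on each side of an accumulation
  point the path would be constant for a while, yet a jump inside such a stretch has a different
  value just before it.\<close>

lemma finite_jump_times: "finite (jump_times p \<inter> {..T})"
proof (rule ccontr)
  assume inf: "infinite (jump_times p \<inter> {..T})"
  have sub: "jump_times p \<inter> {..T} \<subseteq> {0..T}" by (auto simp: jump_times_def)
  obtain a where a: "a \<in> {0..T}" "a islimpt (jump_times p \<inter> {..T})"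
    using Heine_Borel_imp_Bolzano_Weierstrass[OF compact_Icc inf sub] by blast
  obtain d1 where d1: "d1 > 0" "\<And>s. a \<le> s \<Longrightarrow> s < a + d1 \<Longrightarrow> p s = p a"
    using right_nbhd[of a] a by auto
  obtain d2 x where d2: "d2 > 0" "\<And>s. a - d2 < s \<Longrightarrow> s < a \<Longrightarrow> s > 0 \<Longrightarrow> p s = x"
  proof (cases "a = 0")
    case True
    then show ?thesis using that[of 1] by auto
  next
    case False
    then show ?thesis using left_nbhd[of a] a that by (metis atLeastAtMost_iff less_eq_real_def)
  qed
  obtain s where s: "s \<in> jump_times p" "s \<noteq> a" "dist s a < min d1 d2"
    using a(2) d1(1) d2(1) unfolding islimpt_approachable by (metis IntD1 min_less_iff_conj)
  have s0: "0 < s" using s by (auto simp: jump_times_def)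
  obtain d3 y where d3: "d3 > 0" "d3 \<le> s" "y \<noteq> p s" "\<And>r. s - d3 < r \<Longrightarrow> r < s \<Longrightarrow> p r = y"
    using jumps_toE[of s "p s"] s s0 by (simp add: jump_times_def) metis
  show False
  proof (cases "s > a")
    case True
    obtain r where r: "max a (s - d3) < r" "r < s" using dense[of "max a (s - d3)" s] d3(1) True by auto
    then show False using d1(2)[of r] d1(2)[of s] d3 s by (auto simp: dist_real_def)
  next
    case False
    then have sa: "s < a" using s by auto
    obtain r where r: "max (max 0 (a - d2)) (s - d3) < r" "r < s"
      using dense[of "max (max 0 (a - d2)) (s - d3)" s] d3(1) d2(1) sa s(3) s0 by (auto simp: dist_real_def)
    then show False using d2(2)[of r] d2(2)[of s] d3 s s0 sa by (auto simp: dist_real_def)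
  qed
qed

text \<open>Apart from the finitely many jump times and the two end points, a level set of the path
  is open.\<close>

lemma path_sets: "{s \<in> {0..t}. p s = v} \<in> sets borel"
proof -
  let ?J = "jump_times p \<inter> {..t}"
  have "open ({s \<in> {0<..<t}. p s = v} - ?J)"
    unfolding open_dist
  proof (intro ballI)
    fix a assume a: "a \<in> {s \<in> {0<..<t}. p s = v} - ?J"
    obtain d1 where d1: "d1 > 0" "\<And>s. a \<le> s \<Longrightarrow> s < a + d1 \<Longrightarrow> p s = p a"
      using right_nbhd[of a] a by auto
    obtain d2 where d2: "d2 > 0" "d2 \<le> a" "\<And>s. a - d2 < s \<Longrightarrow> s \<le> a \<Longrightarrow> p s = p a"
      using no_jump_left[of a] a by auto
    have eq: "p s = p a" if "dist s a < min d1 d2" for s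
      using d1(2)[of s] d2(3)[of s] that by (cases "s \<ge> a") (auto simp: dist_real_def)
    obtain d3 where d3: "d3 > 0" "\<And>s. dist s a < d3 \<Longrightarrow> s \<notin> ?J"
      using finite_imp_closed[OF finite_jump_times[of t]] a
      by (metis (no_types, lifting) ComplD ComplI DiffD2 open_Compl open_dist)
    show "\<exists>e>0. \<forall>y. dist y a < e \<longrightarrow> y \<in> {s \<in> {0<..<t}. p s = v} - ?J"
    proof (intro exI[of _ "min (min d1 d2) (min d3 (min a (t - a)))"] conjI allI impI)
      show "0 < min (min d1 d2) (min d3 (min a (t - a)))" using a d1(1) d2(1) d3(1) by auto
    next
      fix y assume y: "dist y a < min (min d1 d2) (min d3 (min a (t - a)))"
      then have "p y = p a" "y \<notin> ?J" using eq[of y] d3(2)[of y] by auto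
      moreover have "y \<in> {0<..<t}" using y by (auto simp: dist_real_def)
      ultimately show "y \<in> {s \<in> {0<..<t}. p s = v} - ?J" using a by simp
    qed
  qed
  then have o: "{s \<in> {0<..<t}. p s = v} - ?J \<in> sets borel" by (rule borel_open)
  have f: "finite ({s \<in> {0..t}. p s = v} \<inter> (?J \<union> {0, t}))"
    using finite_jump_times[of t] by auto
  have eq: "{s \<in> {0..t}. p s = v} =
    ({s \<in> {0<..<t}. p s = v} - ?J) \<union> ({s \<in> {0..t}. p s = v} \<inter> (?J \<union> {0, t}))"
    by (rule set_eqI) force
  show ?thesis
    by (subst eq) (intro sets.Un o borel_closed finite_imp_closed f)
qed

lemma local_time_eq: "local_time p v t = 1 + measure lborel {s \<in> {0..t}. p s = v}"
proof -
  have "(LINT s:{0..t}|lborel. of_bool (p s = v)) = (LINT s|lborel. indicator {s \<in> {0..t}. p s = v} s)"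
    unfolding set_lebesgue_integral_def
    by (rule Bochner_Integration.integral_cong) (simp_all add: indicator_def)
  also have "\<dots> = measure lborel {s \<in> {0..t}. p s = v}"
    using path_sets by simp
  finally show ?thesis by (simp add: local_time_def)
qed

lemma local_time_add:
  assumes "0 \<le> t" "t \<le> t'"
  shows "local_time p v t' = local_time p v t + measure lborel {s \<in> {t<..t'}. p s = v}"
proof -
  have s: "{s \<in> {t<..t'}. p s = v} = {s \<in> {0..t'}. p s = v} - {s \<in> {0..t}. p s = v}"
    using assms by (intro set_eqI) force
  have fin: "{s \<in> {0..u}. p s = v} \<in> fmeasurable lborel" for u
    by (rule fmeasurable_lborel_bounded[of _ 0 u, OF path_sets]) auto
  have "measure lborel {s \<in> {t<..t'}. p s = v} =
    measure lborel {s \<in> {0..t'}. p s = v} - measure lborel {s \<in> {0..t}. p s = v}"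
    unfolding s
  proof (rule measurable_measure_Diff)
    show "{s \<in> {0..t}. p s = v} \<in> sets lborel" using path_sets[of t v] by (simp only: sets_lborel)
    show "{s \<in> {0..t}. p s = v} \<subseteq> {s \<in> {0..t'}. p s = v}" using assms by auto
  qed (rule fin)
  then show ?thesis unfolding local_time_eq by linarith
qed

lemma path_sets': "0 \<le> t \<Longrightarrow> {s \<in> {t<..t'}. p s = v} \<in> sets borel"
proof -
  assume "0 \<le> t"
  then have s: "{s \<in> {t<..t'}. p s = v} = {s \<in> {0..t'}. p s = v} \<inter> {t<..}"
    by (intro set_eqI) force
  have "{t<..} \<in> sets borel" by (rule borel_open) simp
  from sets.Int[OF path_sets[of t' v] this] show ?thesis by (simp only: s)
qed

lemma local_time_mono: "0 \<le> t \<Longrightarrow> t \<le> t' \<Longrightarrow> local_time p v t \<le> local_time p v t'"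
  using local_time_add[of t t' v] measure_nonneg[of lborel "{s \<in> {t<..t'}. p s = v}"] by linarith

lemma local_time_lipschitz:
  assumes "0 \<le> t" "t \<le> t'" shows "local_time p v t' \<le> local_time p v t + (t' - t)"
proof -
  have "measure lborel {s \<in> {t<..t'}. p s = v} \<le> measure lborel {t<..t'}"
  proof (rule measure_mono_fmeasurable)
    show "{s \<in> {t<..t'}. p s = v} \<in> sets lborel"
      using path_sets'[OF assms(1)] by (simp only: sets_lborel)
    show "{t<..t'} \<in> fmeasurable lborel"
      by (rule fmeasurable_lborel_bounded[of _ t t']) auto
  qed auto
  moreover have "measure lborel {t<..t'} = t' - t" using assms by simp
  ultimately show ?thesis using local_time_add[OF assms, of v] by linarith
qed

lemma local_time_0: "local_time p v 0 = 1"
proof -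
  have "measure lborel {s \<in> {0..0}. p s = v} = 0"
    by (rule measure_lborel_subset_singleton[of _ 0]) auto
  then show ?thesis unfolding local_time_eq by linarith
qed

lemma local_time_ge_1: "1 \<le> local_time p v t"
  by (simp add: local_time_eq)

lemma local_time_le: "0 \<le> t \<Longrightarrow> local_time p v t \<le> 1 + t"
  using local_time_lipschitz[of 0 t v] by (simp add: local_time_0)

lemma local_time_const:
  assumes "0 \<le> t" "t \<le> t'" "\<And>s. t \<le> s \<Longrightarrow> s < t' \<Longrightarrow> p s = x"
  shows "local_time p v t' = local_time p v t + of_bool (v = x) * (t' - t)"
proof -
  \<comment> \<open>The sets can differ only at \<open>t'\<close>, about which the hypothesis says
    nothing; a point is a null set.\<close>
  have sub: "{t<..<t'} \<inter> {s. x = v} \<subseteq> {s \<in> {t<..t'}. p s = v}"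
    "{s \<in> {t<..t'}. p s = v} \<subseteq> ({t<..<t'} \<inter> {s. x = v}) \<union> {t'}"
    using assms(3) by force+
  have "measure lborel {s \<in> {t<..t'}. p s = v} = of_bool (v = x) * (t' - t)"
  proof (cases "x = v")
    case True
    have "measure lborel {t<..<t'} \<le> measure lborel {s \<in> {t<..t'}. p s = v}"
    proof (rule measure_mono_fmeasurable)
      show "{s \<in> {t<..t'}. p s = v} \<in> fmeasurable lborel"
        by (rule fmeasurable_lborel_bounded[of _ t t', OF path_sets'[OF assms(1)]]) auto
    qed (use sub True in auto)
    moreover have "measure lborel {s \<in> {t<..t'}. p s = v} \<le> t' - t"
      using local_time_lipschitz[OF assms(1,2), of v] unfolding local_time_add[OF assms(1,2), of v] by linarith
    ultimately show ?thesis using True assms by simp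
  next
    case False
    then have "{s \<in> {t<..t'}. p s = v} \<subseteq> {t'}" using sub(2) by auto
    then show ?thesis using False measure_lborel_subset_singleton by simp
  qed
  then show ?thesis unfolding local_time_add[OF assms(1,2), of v] by linarith
qed

lemma local_time_unvisited:
  assumes "0 \<le> t" "\<And>s. 0 \<le> s \<Longrightarrow> s < t \<Longrightarrow> p s \<noteq> v"
  shows "local_time p v t = 1"
proof -
  have "measure lborel {s \<in> {0..t}. p s = v} = 0"
    by (rule measure_lborel_subset_singleton[of _ t]) (use assms in force)
  then show ?thesis unfolding local_time_eq by linarith
qed

lemma continuous_local_time: "continuous_on {0..} (local_time p v)"
proof -
  have "1-lipschitz_on {0..} (local_time p v)"
  proof (rule lipschitz_onI)
    fix x y :: real assume xy: "x \<in> {0..}" "y \<in> {0..}"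
    show "dist (local_time p v x) (local_time p v y) \<le> 1 * dist x y"
      using xy local_time_mono[of x y v] local_time_mono[of y x v]
        local_time_lipschitz[of x y v] local_time_lipschitz[of y x v]
      by (cases "x \<le> y") (auto simp: dist_real_def abs_if)
  qed simp
  then show ?thesis by (rule lipschitz_on_continuous_on)
qed

section \<open>Jump times\<close>

lemma one_jump:
  assumes "0 \<le> u" "{u<..v} \<inter> jump_times p = {s}"
  shows "u < s" "s \<le> v"
    and "\<And>r. u \<le> r \<Longrightarrow> r < s \<Longrightarrow> p r = p u"
    and "\<And>r. s \<le> r \<Longrightarrow> r \<le> v \<Longrightarrow> p r = p s"
    and "p u \<noteq> p s" "adj (p u) (p s)" "jumps_to p s (p s)"
proof -
  have s: "s \<in> {u<..v}" "s \<in> jump_times p" using assms(2) by blast+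
  then show us: "u < s" and "s \<le> v" by simp_all
  show j: "jumps_to p s (p s)" using s by (simp add: jump_times_def)
  have none: "r \<notin> jump_times p" if "u < r" "r \<le> v" "r \<noteq> s" for r
    using assms(2) that by (metis IntI greaterThanAtMost_iff singletonD)
  show before: "p r = p u" if "u \<le> r" "r < s" for r
    by (rule path_const) (use that assms(1) none \<open>s \<le> v\<close> in \<open>auto simp: disjoint_iff\<close>)
  show "p r = p s" if "s \<le> r" "r \<le> v" for r
    by (rule path_const) (use that assms(1) us none in \<open>auto simp: disjoint_iff\<close>)
  obtain d x where d: "d > 0" "x \<noteq> p s" "adj x (p s)" "\<And>r. s - d < r \<Longrightarrow> r < s \<Longrightarrow> p r = x"
    using jumps_toE[OF _ j] us assms(1) by (metis order_le_less_trans)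
  obtain r where "max u (s - d) < r" "r < s" using dense[of "max u (s - d)" s] d(1) us by auto
  then have "p u = x" using before[of r] d(4)[of r] by simp
  then show "p u \<noteq> p s" "adj (p u) (p s)" using d by auto
qed

text \<open>This reduces an existential over all real times to a countable one and so makes jump
  events measurable. Rational witnesses exist because the path is constant for a while before and
  after a jump.\<close>

lemma jumps_in_interval_iff:
  assumes "0 \<le> u"
  shows "(\<exists>s\<in>{u<..<v}. jumps_to p s y) \<longleftrightarrow>
    (\<exists>q\<in>\<rat>. \<exists>r\<in>\<rat>. u < q \<and> q < r \<and> r < v \<and> p q \<noteq> y \<and> p r = y)"
proof
  assume "\<exists>s\<in>{u<..<v}. jumps_to p s y"
  then obtain s where s: "u < s" "s < v" "jumps_to p s y" by auto
  obtain d x where d: "d > 0" "p s = y" "x \<noteq> y" "\<And>r. s - d < r \<Longrightarrow> r < s \<Longrightarrow> p r = x"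
    using jumps_toE[OF _ s(3)] s assms by (metis order_le_less_trans)
  obtain e where e: "e > 0" "\<And>r. s \<le> r \<Longrightarrow> r < s + e \<Longrightarrow> p r = p s"
    using right_nbhd[of s] s assms by (metis order_le_less_trans less_imp_le)
  obtain q where q: "q \<in> \<rat>" "max u (s - d) < q" "q < s"
    using Rats_dense_in_real[of "max u (s - d)" s] s d(1) by auto
  obtain r where r: "r \<in> \<rat>" "s < r" "r < min v (s + e)"
    using Rats_dense_in_real[of s "min v (s + e)"] s e(1) by auto
  show "\<exists>q\<in>\<rat>. \<exists>r\<in>\<rat>. u < q \<and> q < r \<and> r < v \<and> p q \<noteq> y \<and> p r = y"
    using q r d(2,3) d(4)[of q] e(2)[of r] by (intro bexI[of _ q] bexI[of _ r]) auto
next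
  assume "\<exists>q\<in>\<rat>. \<exists>r\<in>\<rat>. u < q \<and> q < r \<and> r < v \<and> p q \<noteq> y \<and> p r = y"
  then obtain q r where qr: "u < q" "q < r" "r < v" "p q \<noteq> y" "p r = y" by auto
  \<comment> \<open>Since the path changes between \<open>q\<close> and \<open>r\<close>, there is a
    jump; the last one must land on \<open>y\<close>, because the path is constant from then until
    \<open>r\<close>.\<close>
  define S where "S = {q<..r} \<inter> jump_times p"
  have fin: "finite S"
    by (rule finite_subset[OF _ finite_jump_times[of r]]) (auto simp: S_def)
  have ne: "S \<noteq> {}" using path_const[of q r] qr assms by (auto simp: S_def)
  have m: "Max S \<in> S" using fin ne by simp
  have "p r = p (Max S)"
  proof (rule path_const)
    show "{Max S<..r} \<inter> jump_times p = {}"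
      using Max_ge[OF fin] m by (fastforce simp: S_def)
  qed (use m qr assms in \<open>auto simp: S_def\<close>)
  then have "jumps_to p (Max S) y" using m qr by (auto simp: S_def jump_times_def)
  then show "\<exists>s\<in>{u<..<v}. jumps_to p s y" using m qr by (auto simp: S_def)
qed

definition jump_count :: "real \<Rightarrow> nat" where
  "jump_count t = card (jump_times p \<inter> {..t})"

lemma jump_count_mono: "s \<le> t \<Longrightarrow> jump_count s \<le> jump_count t"
  unfolding jump_count_def by (rule card_mono) (auto intro: finite_jump_times)

lemma jump_count_0: "jump_count 0 = 0"
proof -
  have "jump_times p \<inter> {..0} = {}" by (auto simp: jump_times_def)
  then show ?thesis by (simp add: jump_count_def)
qed

text \<open>Once a time grid is finer than this gap, no cell contains two jumps.\<close>

lemma jump_gap: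
  obtains d where "d > 0"
    "\<And>a b. a \<in> jump_times p \<Longrightarrow> b \<in> jump_times p \<Longrightarrow> a \<le> T \<Longrightarrow> b \<le> T \<Longrightarrow> a \<noteq> b \<Longrightarrow> d \<le> \<bar>a - b\<bar>"
proof -
  \<comment> \<open>The element 1 keeps the set nonempty when there are fewer than two
    jumps.\<close>
  define D where "D = insert 1 ((\<lambda>(a, b). \<bar>a - b\<bar>) ` (((jump_times p \<inter> {..T}) \<times> (jump_times p \<inter> {..T})) - Id))"
  have fin: "finite D" unfolding D_def using finite_jump_times[of T] by auto
  have pos: "x > 0" if "x \<in> D" for x using that by (auto simp: D_def)
  show ?thesis
  proof (rule that[of "Min D"])
    have "Min D \<in> D" by (rule Min_in[OF fin]) (simp add: D_def)
    then show "Min D > 0" by (rule pos)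
    fix a b assume "a \<in> jump_times p" "b \<in> jump_times p" "a \<le> T" "b \<le> T" "a \<noteq> b"
    then have "\<bar>a - b\<bar> \<in> D" unfolding D_def by (intro insertI2 image_eqI[of _ _ "(a, b)"]) auto
    then show "Min D \<le> \<bar>a - b\<bar>" by (rule Min_le[OF fin])
  qed
qed

lemma jump_count_split:
  fixes a h :: real
  assumes "0 \<le> a" "0 \<le> h"
  shows "jump_count (a + real n * h) =
    jump_count a + (\<Sum>i<n. card ({a + real i * h<..a + real (Suc i) * h} \<inter> jump_times p))"
proof (induction n)
  case (Suc n)
  have eq: "jump_times p \<inter> {..a + real (Suc n) * h} = (jump_times p \<inter> {..a + real n * h}) \<union>
    ({a + real n * h<..a + real (Suc n) * h} \<inter> jump_times p)"
    using assms(2) by (auto simp: algebra_simps)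
  have "card ((jump_times p \<inter> {..a + real n * h}) \<union>
    ({a + real n * h<..a + real (Suc n) * h} \<inter> jump_times p)) = jump_count (a + real n * h)
      + card ({a + real n * h<..a + real (Suc n) * h} \<inter> jump_times p)"
    unfolding jump_count_def
    by (rule card_Un_disjoint) (auto intro: finite_jump_times
        finite_subset[OF _ finite_jump_times[of "a + real (Suc n) * h"]])
  then show ?case unfolding jump_count_def[of "a + real (Suc n) * h"] eq
    by (simp only: Suc.IH sum.lessThan_Suc add.assoc)
qed simp

text \<open>On a grid finer than the gap between jumps, a cell contains a jump if and only if its
  end values differ. The jump count thus becomes a limit of functions of finitely many positions,
  which makes it adapted.\<close>

lemma jump_count_limit:
  assumes "0 \<le> t"
  shows "(\<lambda>n. \<Sum>i<Suc n. of_bool (p (real i * (t / Suc n)) \<noteq> p (real (Suc i) * (t / Suc n))) :: real)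
    \<longlonglongrightarrow> real (jump_count t)"
proof -
  obtain d where d: "d > 0" "\<And>a b. a \<in> jump_times p \<Longrightarrow> b \<in> jump_times p \<Longrightarrow>
    a \<le> t \<Longrightarrow> b \<le> t \<Longrightarrow> a \<noteq> b \<Longrightarrow> d \<le> \<bar>a - b\<bar>"
    using jump_gap by blast
  have "\<forall>\<^sub>F n in sequentially. t / Suc n < d"
  proof -
    have "(\<lambda>n. t / real (Suc n)) \<longlonglongrightarrow> 0" by real_asymp
    then show ?thesis using d(1) by (rule order_tendstoD(2))
  qed
  then have "\<forall>\<^sub>F n in sequentially. real (jump_count t) =
    (\<Sum>i<Suc n. of_bool (p (real i * (t / Suc n)) \<noteq> p (real (Suc i) * (t / Suc n))) :: real)"
  proof (rule eventually_mono)
    fix n assume n: "t / Suc n < d"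
    define h where "h = t / Suc n"
    have h: "0 \<le> h" "h < d" "real (Suc n) * h = t" using assms n by (auto simp: h_def)
    have cell: "real (card ({0 + real i * h<..0 + real (Suc i) * h} \<inter> jump_times p)) =
      of_bool (p (real i * h) \<noteq> p (real (Suc i) * h))" if i: "i < Suc n" for i
    proof -
      define S where "S = {real i * h<..real (Suc i) * h} \<inter> jump_times p"
      have ub: "real (Suc i) * h \<le> t"
        unfolding h(3)[symmetric] using i h(1) by (intro mult_right_mono) auto
      have single: "a = b" if "a \<in> S" "b \<in> S" for a b
      proof (rule ccontr)
        assume "a \<noteq> b"
        then have "d \<le> \<bar>a - b\<bar>" using d(2)[of a b] that ub by (auto simp: S_def)
        moreover have "\<bar>a - b\<bar> \<le> h" using that by (auto simp: S_def algebra_simps)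
        ultimately show False using h by simp
      qed
      show ?thesis
      proof (cases "S = {}")
        case True
        have "p (real (Suc i) * h) = p (real i * h)"
          by (rule path_const) (use True h(1) in \<open>auto simp: S_def mult_right_mono\<close>)
        then show ?thesis using True by (simp add: S_def)
      next
        case False
        then obtain s where sS: "s \<in> S" by blast
        have s: "S = {s}"
        proof (intro equalityI subsetI)
          fix r assume "r \<in> S"
          then have "r = s" using sS by (rule single)
          then show "r \<in> {s}" by simp
        qed (use sS in simp)
        have "0 \<le> real i * h" using h(1) by simp
        note oj = one_jump[OF this s[unfolded S_def]]
        have "p (real i * h) \<noteq> p s" "p (real (Suc i) * h) = p s"
          by (rule oj(5), rule oj(4)[OF oj(2) order_refl])
        then show ?thesis using s by (simp add: S_def)
      qed
    qed
    have "real (jump_count (0 + real (Suc n) * h)) =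
      (\<Sum>i<Suc n. real (card ({0 + real i * h<..0 + real (Suc i) * h} \<inter> jump_times p)))"
      using jump_count_split[of 0 h "Suc n"] h(1) jump_count_0 by (simp del: of_nat_Suc sum.lessThan_Suc)
    also have "\<dots> = (\<Sum>i<Suc n. of_bool (p (real i * h) \<noteq> p (real (Suc i) * h)))"
      by (rule sum.cong) (use cell in auto)
    finally show "real (jump_count t) =
      (\<Sum>i<Suc n. of_bool (p (real i * (t / Suc n)) \<noteq> p (real (Suc i) * (t / Suc n))) :: real)"
      using h(3) by (simp only: h_def add_0)
  qed
  then show ?thesis by (rule Lim_transform_eventually[OF tendsto_const])
qed

end

text \<open>A ball in the graph, not a sphere: a path with at most \<open>k\<close> jumps has to
  stay inside one fixed set, which is finite by local finiteness.\<close>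

primrec reachable :: "('v \<Rightarrow> 'v \<Rightarrow> bool) \<Rightarrow> 'v \<Rightarrow> nat \<Rightarrow> 'v set" where
  "reachable adj x 0 = {x}"
| "reachable adj x (Suc k) = reachable adj x k \<union> (\<Union>y\<in>reachable adj x k. {z. adj y z})"

lemma reachable_mono: "j \<le> k \<Longrightarrow> reachable adj x j \<subseteq> reachable adj x k"
  by (induction rule: dec_induct) auto

text \<open>Induction on the number of jumps, stepping back to a time just before the last
  one.\<close>

lemma (in jump_path) path_reachable:
  assumes "0 \<le> t"
  shows "p t \<in> reachable adj (p 0) (jump_count t)"
  using assms
proof (induction "jump_count t" arbitrary: t rule: less_induct)
  case less
  show ?case
  proof (cases "jump_times p \<inter> {..t} = {}")
    case True
    have "p t = p 0" by (rule path_const) (use True less.prems in auto)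
    then show ?thesis using reachable_mono[of 0 "jump_count t" adj "p 0"] by simp
  next
    case False
    define s where "s = Max (jump_times p \<inter> {..t})"
    have s: "s \<in> jump_times p" "s \<le> t"
      using Max_in[OF finite_jump_times[of t] False] by (auto simp: s_def)
    then have s0: "0 < s" by (simp add: jump_times_def)
    have max: "r \<le> s" if "r \<in> jump_times p" "r \<le> t" for r
      using Max_ge[OF finite_jump_times[of t]] that by (simp add: s_def)
    have pt: "p t = p s" by (rule path_const) (use s s0 max in \<open>force simp: disjoint_iff\<close>)+
    obtain d x where d: "d > 0" "d \<le> s" "adj x (p s)" "\<And>r. s - d < r \<Longrightarrow> r < s \<Longrightarrow> p r = x"
      using jumps_toE[of s "p s"] s s0 by (simp add: jump_times_def) metis
    define r where "r = s - d / 2"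
    have r: "0 \<le> r" "r < s" "p r = x" using d(1,2) d(4)[of r] by (auto simp: r_def)
    have "jump_times p \<inter> {..r} \<subset> jump_times p \<inter> {..t}" using s r by force
    then have lt: "jump_count r < jump_count t"
      unfolding jump_count_def by (intro psubset_card_mono finite_jump_times)
    have "x \<in> reachable adj (p 0) (jump_count r)" using less.hyps[OF lt r(1)] r(3) by simp
    then have "p s \<in> reachable adj (p 0) (Suc (jump_count r))" using d(3) by auto
    then show ?thesis using reachable_mono[of "Suc (jump_count r)" "jump_count t" adj "p 0"] lt pt by auto
  qed
qed

section \<open>The history of the process and its jump rates\<close>

text \<open>A countable vertex type allows functions of the present vertex and the local times to be
  treated as measurable one vertex at a time. The starting point is prescribed only almost
  surely.\<close>

locale rooted_vrjp = vrjp M V adj X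
  for M :: "'a measure" and V :: "'v::countable set" and adj X +
  fixes x0 :: 'v
  assumes start: "AE \<omega> in M. X 0 \<omega> = x0"
begin

lemma jump_path: "\<omega> \<in> space M \<Longrightarrow> jump_path adj (\<lambda>u. X u \<omega>)"
  by unfold_locales (use right_continuous jumps_nearest in auto)

lemma history_generator: "{X s -` A \<inter> space M | s A. s \<in> {0..t}} \<subseteq> Pow (space M)"
  by auto

lemma space_history: "space (history M X t) = space M"
  unfolding history_def by (rule space_measure_of[OF history_generator])

lemma sets_history:
  "sets (history M X t) = sigma_sets (space M) {X s -` A \<inter> space M | s A. s \<in> {0..t}}"
  unfolding history_def by (rule sets_measure_of[OF history_generator])

lemma sets_history_mono: "s \<le> t \<Longrightarrow> sets (history M X s) \<subseteq> sets (history M X t)"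
  unfolding sets_history by (rule sigma_sets_mono') force

lemma random_vertex_UNIV: "0 \<le> t \<Longrightarrow> X t \<in> M \<rightarrow>\<^sub>M count_space UNIV"
proof (rule measurableI)
  fix A assume t: "0 \<le> t"
  have "X t -` A \<inter> space M = X t -` (A \<inter> V) \<inter> space M"
    using measurable_space[OF random_vertex[OF t]] by auto
  then show "X t -` A \<inter> space M \<in> sets M"
    using measurable_sets[OF random_vertex[OF t], of "A \<inter> V"] by simp
qed simp

lemma subalgebra_history: "subalgebra M (history M X t)"
proof (unfold subalgebra_def, intro conjI)
  show "sets (history M X t) \<subseteq> sets M"
    unfolding sets_history
  proof (rule sets.sigma_sets_subset, safe)
    fix s A assume "s \<in> {0..t}"
    then show "X s -` A \<inter> space M \<in> sets M" using measurable_sets[OF random_vertex_UNIV, of s A] by simp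
  qed
qed (rule space_history)

lemma history_measurable_imp: "f \<in> history M X t \<rightarrow>\<^sub>M N \<Longrightarrow> f \<in> M \<rightarrow>\<^sub>M N"
  using measurable_from_subalg[OF subalgebra_history] .

lemma adapted: "0 \<le> s \<Longrightarrow> s \<le> t \<Longrightarrow> X s \<in> history M X t \<rightarrow>\<^sub>M count_space UNIV"
proof (rule measurableI)
  fix A assume "0 \<le> s" "s \<le> t"
  then have "X s -` A \<inter> space M \<in> {X s -` A \<inter> space M | s A. s \<in> {0..t}}" by auto
  then show "X s -` A \<inter> space (history M X t) \<in> sets (history M X t)"
    unfolding sets_history space_history by (rule sigma_sets.Basic)
qed simp

text \<open>This is progressive measurability: right-continuity approximates the path, jointly in
  sample point and time, by step processes that use only positions up to time
  \<open>t\<close>.\<close>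

lemma adapted_local_time:
  assumes "0 \<le> t"
  shows "(\<lambda>\<omega>. local_time (\<lambda>u. X u \<omega>) v t) \<in> borel_measurable (history M X t)"
proof -
  define F where "F = history M X t"
  \<comment> \<open>The next grid point to the right of \<open>s\<close>, capped at \<open>t\<close>
    to stay within the history. It takes countably many values, and for each of them the time at
    which \<open>X\<close> is evaluated no longer depends on \<open>s\<close>.\<close>
  define g where "g n s = min t ((real_of_int \<lfloor>real (Suc n) * s\<rfloor> + 1) / real (Suc n))" for n s
  have meas: "(\<lambda>(\<omega>, s). of_bool (X (max 0 (g n s)) \<omega> = v) :: real) \<in> borel_measurable (F \<Otimes>\<^sub>M lborel)" for n
  proof -
    have "(\<lambda>x. X (max 0 (min t ((real_of_int \<lfloor>real (Suc n) * snd x\<rfloor> + 1) / real (Suc n)))) (fst x))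
      \<in> F \<Otimes>\<^sub>M lborel \<rightarrow>\<^sub>M count_space UNIV"
    proof (rule measurable_compose_countable[where g = "\<lambda>x. \<lfloor>real (Suc n) * snd x\<rfloor>"
          and f = "\<lambda>i x. X (max 0 (min t ((real_of_int i + 1) / real (Suc n)))) (fst x)"])
      fix i :: int
      have "X (max 0 (min t ((real_of_int i + 1) / real (Suc n)))) \<in> F \<rightarrow>\<^sub>M count_space UNIV"
        unfolding F_def by (rule adapted) (use assms in auto)
      then show "(\<lambda>x. X (max 0 (min t ((real_of_int i + 1) / real (Suc n)))) (fst x))
        \<in> F \<Otimes>\<^sub>M lborel \<rightarrow>\<^sub>M count_space UNIV"
        using measurable_compose[OF measurable_fst] by blast
    qed measurable
    from measurable_compose[OF this, of "\<lambda>x. of_bool (x = v) :: real" borel]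
    show ?thesis unfolding g_def by (simp add: case_prod_beta')
  qed
  have "(\<lambda>x. indicator {0..<t} (snd x) * of_bool (X (snd x) (fst x) = v) :: real) \<in> borel_measurable (F \<Otimes>\<^sub>M lborel)"
  proof (rule borel_measurable_LIMSEQ_real)
    fix x :: "'a \<times> real" assume x: "x \<in> space (F \<Otimes>\<^sub>M lborel)"
    obtain \<omega> s where xs: "x = (\<omega>, s)" by (cases x)
    have \<omega>: "\<omega> \<in> space M" using x xs by (simp add: space_pair_measure F_def space_history)
    interpret p: jump_path adj "\<lambda>u. X u \<omega>" by (rule jump_path[OF \<omega>])
    show "(\<lambda>n. indicator {0..<t} (snd x) * of_bool (X (max 0 (g n (snd x))) (fst x) = v) :: real) \<longlonglongrightarrow>
      indicator {0..<t} (snd x) * of_bool (X (snd x) (fst x) = v)"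
    proof (cases "s \<in> {0..<t}")
      case True
      obtain d where d: "d > 0" "\<And>r. s \<le> r \<Longrightarrow> r < s + d \<Longrightarrow> X r \<omega> = X s \<omega>"
        using p.right_nbhd[of s] True by auto
      have "\<forall>\<^sub>F n in sequentially. 1 / real (Suc n) < d"
        using d(1) LIMSEQ_inverse_real_of_nat by (intro order_tendstoD(2)) (auto simp: inverse_eq_divide)
      then have "\<forall>\<^sub>F n in sequentially. X s \<omega> = X (max 0 (g n s)) \<omega>"
      proof (rule eventually_mono)
        fix n assume n: "1 / real (Suc n) < d"
        define N where "N = real (Suc n)"
        have N: "N > 0" "1 / N < d" using n by (auto simp: N_def)
        have f1: "N * s < real_of_int \<lfloor>N * s\<rfloor> + 1" and f2: "real_of_int \<lfloor>N * s\<rfloor> \<le> N * s"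
          by linarith+
        have "s < (real_of_int \<lfloor>N * s\<rfloor> + 1) / N" using f1 N by (simp add: field_simps)
        moreover have "(real_of_int \<lfloor>N * s\<rfloor> + 1) / N \<le> s + 1 / N" using f2 N by (simp add: field_simps)
        ultimately have "s \<le> max 0 (g n s)" "max 0 (g n s) < s + d"
          using True N unfolding g_def N_def[symmetric] by auto
        then show "X s \<omega> = X (max 0 (g n s)) \<omega>" using d(2) by simp
      qed
      then have "\<forall>\<^sub>F n in sequentially. (indicator {0..<t} s * of_bool (X s \<omega> = v) :: real) =
          indicator {0..<t} s * of_bool (X (max 0 (g n s)) \<omega> = v)"
        by (rule eventually_mono) simp
      then show ?thesis unfolding xs fst_conv snd_conv
        by (rule Lim_transform_eventually[OF tendsto_const])
    qed (simp add: xs)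
  next
    fix n
    have "(\<lambda>x. indicator {0..<t} (snd x) :: real) \<in> borel_measurable (F \<Otimes>\<^sub>M lborel)"
      by measurable
    then show "(\<lambda>x. indicator {0..<t} (snd x) * of_bool (X (max 0 (g n (snd x))) (fst x) = v) :: real)
      \<in> borel_measurable (F \<Otimes>\<^sub>M lborel)"
      using meas[of n] by (intro borel_measurable_times) (simp_all add: case_prod_beta')
  qed
  then have "(\<lambda>(\<omega>, s). indicator {0..<t} s * of_bool (X s \<omega> = v) :: real) \<in> borel_measurable (F \<Otimes>\<^sub>M lborel)"
    by (simp add: case_prod_beta')
  then have A: "(\<lambda>\<omega>. LINT s|lborel. (indicator {0..<t} s * of_bool (X s \<omega> = v) :: real)) \<in> borel_measurable F"
    by (rule lborel.borel_measurable_lebesgue_integral)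
  have eq: "local_time (\<lambda>u. X u \<omega>) v t = 1 + (LINT s|lborel. (indicator {0..<t} s * of_bool (X s \<omega> = v) :: real))"
    if "\<omega> \<in> space F" for \<omega>
  proof -
    interpret p: jump_path adj "\<lambda>u. X u \<omega>" by (rule jump_path) (use that in \<open>simp add: F_def space_history\<close>)
    have eq: "{s \<in> {0..<t}. X s \<omega> = v} = {s \<in> {0..t}. X s \<omega> = v} - {t}" by auto
    have m: "{s \<in> {0..<t}. X s \<omega> = v} \<in> sets borel"
      unfolding eq by (intro sets.Diff p.path_sets borel_closed closed_singleton)
    have "(LINT s:{0..t}|lborel. of_bool (X s \<omega> = v) :: real) =
      (LINT s|lborel. indicator {s \<in> {0..t}. X s \<omega> = v} s)"
      unfolding set_lebesgue_integral_def
      by (intro Bochner_Integration.integral_cong refl) (simp split: split_indicator)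
    also have "\<dots> = (LINT s|lborel. indicator {s \<in> {0..<t}. X s \<omega> = v} s)"
    proof (rule integral_cong_AE)
      show "AE s in lborel. (indicator {s \<in> {0..t}. X s \<omega> = v} s :: real) = indicator {s \<in> {0..<t}. X s \<omega> = v} s"
        using AE_lborel_singleton[of t] by eventually_elim (auto simp: indicator_def)
    qed (use m p.path_sets[of t v] in simp_all)
    also have "\<dots> = (LINT s|lborel. (indicator {0..<t} s * of_bool (X s \<omega> = v) :: real))"
      by (intro Bochner_Integration.integral_cong refl) (simp split: split_indicator)
    finally show ?thesis by (simp add: local_time_def)
  qed
  have B: "(\<lambda>\<omega>. 1 + (LINT s|lborel. (indicator {0..<t} s * of_bool (X s \<omega> = v) :: real))) \<in> borel_measurable F"
    by (rule borel_measurable_add[OF borel_measurable_const A])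
  show ?thesis unfolding F_def[symmetric]
    by (rule measurable_cong[where g = "\<lambda>\<omega>. 1 + (LINT s|lborel. (indicator {0..<t} s * of_bool (X s \<omega> = v) :: real))", THEN iffD2])
      (rule eq, assumption, rule B)
qed

lemma adapted_jump_count:
  assumes "0 \<le> t"
  shows "(\<lambda>\<omega>. real (jump_path.jump_count (\<lambda>u. X u \<omega>) t)) \<in> borel_measurable (history M X t)"
proof (rule borel_measurable_LIMSEQ_real)
  fix \<omega> assume "\<omega> \<in> space (history M X t)"
  then interpret p: jump_path adj "\<lambda>u. X u \<omega>" by (intro jump_path) (simp add: space_history)
  show "(\<lambda>n. \<Sum>i<Suc n. of_bool (X (real i * (t / Suc n)) \<omega> \<noteq> X (real (Suc i) * (t / Suc n)) \<omega>) :: real)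
    \<longlonglongrightarrow> real (p.jump_count t)"
    by (rule p.jump_count_limit[OF assms])
next
  fix n
  show "(\<lambda>\<omega>. \<Sum>i<Suc n. of_bool (X (real i * (t / Suc n)) \<omega> \<noteq> X (real (Suc i) * (t / Suc n)) \<omega>) :: real)
    \<in> borel_measurable (history M X t)"
  proof (rule borel_measurable_sum)
    fix i assume "i \<in> {..<Suc n}"
    then have i: "i \<le> n" "Suc i \<le> Suc n" by auto
    have time: "real j * (t / Suc n) \<le> t" if "j \<le> Suc n" for j
    proof -
      have "real j * (t / Suc n) \<le> real (Suc n) * (t / Suc n)"
        by (rule mult_right_mono) (use that assms in auto)
      then show ?thesis by simp
    qed
    have "X (real i * (t / Suc n)) \<in> history M X t \<rightarrow>\<^sub>M count_space UNIV"
      "X (real (Suc i) * (t / Suc n)) \<in> history M X t \<rightarrow>\<^sub>M count_space UNIV"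
      using time[of i] time[of "Suc i"] i assms by (auto intro!: adapted)
    note m = this
    show "(\<lambda>\<omega>. of_bool (X (real i * (t / Suc n)) \<omega> \<noteq> X (real (Suc i) * (t / Suc n)) \<omega>) :: real)
      \<in> borel_measurable (history M X t)"
      by (rule measurable_compose_countable[where f = "\<lambda>y \<omega>. of_bool (X (real i * (t / Suc n)) \<omega> \<noteq> y)",
            OF _ m(2)]) (rule measurable_compose[OF m(1)], simp)
  qed
qed

definition jump_event :: "real \<Rightarrow> real \<Rightarrow> 'v \<Rightarrow> 'a set" where
  "jump_event t h y = {\<omega> \<in> space M. \<exists>s\<in>{t<..<t + h}. jumps_to (\<lambda>u. X u \<omega>) s y}"

lemma sets_jump_event:
  assumes "0 \<le> t"
  shows "jump_event t h y \<in> sets M"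
proof -
  have "jump_event t h y = (\<Union>q\<in>\<rat> \<inter> {t<..}. \<Union>r\<in>\<rat> \<inter> {q<..<t + h}.
    (space M - (X q -` {y} \<inter> space M)) \<inter> (X r -` {y} \<inter> space M))" (is "_ = ?R")
  proof (rule set_eqI)
    fix \<omega>
    show "\<omega> \<in> jump_event t h y \<longleftrightarrow> \<omega> \<in> ?R"
    proof (cases "\<omega> \<in> space M")
      case True
      interpret p: jump_path adj "\<lambda>u. X u \<omega>" by (rule jump_path[OF True])
      show ?thesis using True unfolding jump_event_def mem_Collect_eq p.jumps_in_interval_iff[OF assms]
        by (auto simp: Bex_def)
    qed (auto simp: jump_event_def)
  qed
  also have "\<dots> \<in> sets M"
  proof (rule sets.countable_UN'')
    fix q :: real assume q: "q \<in> \<rat> \<inter> {t<..}"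
    show "(\<Union>r\<in>\<rat> \<inter> {q<..<t + h}. (space M - (X q -` {y} \<inter> space M)) \<inter> (X r -` {y} \<inter> space M)) \<in> sets M"
    proof (rule sets.countable_UN'')
      fix r :: real assume r: "r \<in> \<rat> \<inter> {q<..<t + h}"
      show "(space M - (X q -` {y} \<inter> space M)) \<inter> (X r -` {y} \<inter> space M) \<in> sets M"
        using q r assms by (intro sets.Int sets.Diff sets.top measurable_sets[OF random_vertex_UNIV]) auto
    qed (intro countable_Int1 countable_rat)
  qed (intro countable_Int1 countable_rat)
  finally show ?thesis .
qed

text \<open>The jump rate in weak form: \<open>W\<close> is a bounded test variable known at time
  \<open>t\<close> and carried by the event that the process is at \<open>x\<close>. Integrals
  against such \<open>W\<close> replace conditional expectations from here on.\<close>

abbreviation rate_close :: "'v \<Rightarrow> 'v \<Rightarrow> real \<Rightarrow> real \<Rightarrow> real \<Rightarrow> bool" where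
  "rate_close x y \<epsilon> t h \<equiv> \<forall>W C. W \<in> borel_measurable (history M X t) \<longrightarrow>
    (\<forall>\<omega>\<in>space M. \<bar>W \<omega>\<bar> \<le> C) \<longrightarrow> (\<forall>\<omega>\<in>space M. X t \<omega> \<noteq> x \<longrightarrow> W \<omega> = 0) \<longrightarrow>
    \<bar>(\<integral>\<omega>. W \<omega> * indicator (jump_event t h y) \<omega> \<partial>M)
      - h * (\<integral>\<omega>. W \<omega> * local_time (\<lambda>u. X u \<omega>) y t \<partial>M)\<bar> \<le> C * \<epsilon> * h"

text \<open>A variable known at time \<open>t\<close> can be moved through the conditional
  expectation, and it vanishes off the event on which the error is controlled. The step bound does
  not depend on \<open>W\<close> or \<open>C\<close>.\<close>

lemma jump_rate_integral:
  assumes "adj x y" "0 < \<epsilon>"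
  shows "\<exists>\<delta>>0. \<forall>t\<in>{0..T}. \<forall>h\<in>{0<..<\<delta>}. rate_close x y \<epsilon> t h"
proof -
  obtain \<delta> where \<delta>: "\<delta> > 0" "\<forall>t\<in>{0..T}. \<forall>h\<in>{0<..<\<delta>}. AE \<omega> in M. X t \<omega> = x \<longrightarrow>
    \<bar>real_cond_exp M (history M X t) (indicator (jump_event t h y)) \<omega>
      - local_time (\<lambda>u. X u \<omega>) y t * h\<bar> \<le> \<epsilon> * h"
    using jump_rate[OF assms, of T] unfolding jump_event_def by blast
  show ?thesis
  proof (intro exI[of _ \<delta>] conjI \<delta>(1) ballI allI impI)
    fix t h C :: real and W :: "'a \<Rightarrow> real"
    assume t: "t \<in> {0..T}" and h: "h \<in> {0<..<\<delta>}" and W: "W \<in> borel_measurable (history M X t)"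
      and C': "\<forall>\<omega>\<in>space M. \<bar>W \<omega>\<bar> \<le> C" and supp': "\<forall>\<omega>\<in>space M. X t \<omega> \<noteq> x \<longrightarrow> W \<omega> = 0"
    note C = C'[rule_format] and supp = supp'[rule_format]
    define E where "E = jump_event t h y"
    define c where "c = real_cond_exp M (history M X t) (indicator E)"
    define L where "L \<omega> = local_time (\<lambda>u. X u \<omega>) y t" for \<omega>
    interpret finite_measure_subalgebra M "history M X t"
      by unfold_locales (rule subalgebra_history)
    have [measurable]: "E \<in> sets M" unfolding E_def using sets_jump_event t by auto
    have [measurable]: "W \<in> borel_measurable M" using history_measurable_imp[OF W] .
    have Lm[measurable]: "L \<in> borel_measurable M" unfolding L_def
      using history_measurable_imp[OF adapted_local_time, of t y] t by auto
    have L: "\<bar>L \<omega>\<bar> \<le> 1 + T" if "\<omega> \<in> space M" for \<omega>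
      using jump_path.local_time_le[OF jump_path[OF that], of t y] t
        jump_path.local_time_ge_1[OF jump_path[OF that], of y t] by (auto simp: L_def)
    obtain \<omega>0 where "\<omega>0 \<in> space M" using not_empty by blast
    from C[OF this] have C0: "0 \<le> C" by linarith
    have WE: "integrable M (\<lambda>\<omega>. W \<omega> * indicator E \<omega>)"
      by (rule integrable_const_bound[where B = C]) (use C C0 in \<open>auto simp: indicator_def\<close>)
    have WL: "integrable M (\<lambda>\<omega>. W \<omega> * L \<omega>)"
      by (rule integrable_const_bound[where B = "C * (1 + T)"])
        (use C C0 L in \<open>auto simp: abs_mult intro!: mult_mono\<close>)
    note ci = real_cond_exp_intg[OF WE W, folded c_def]
    have eq: "(\<integral>\<omega>. W \<omega> * indicator E \<omega> \<partial>M) - h * (\<integral>\<omega>. W \<omega> * L \<omega> \<partial>M) =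
      (\<integral>\<omega>. W \<omega> * c \<omega> - h * (W \<omega> * L \<omega>) \<partial>M)"
      using ci WL by (simp add: Bochner_Integration.integral_diff)
    have "\<bar>\<integral>\<omega>. W \<omega> * c \<omega> - h * (W \<omega> * L \<omega>) \<partial>M\<bar> \<le> (\<integral>\<omega>. \<bar>W \<omega> * c \<omega> - h * (W \<omega> * L \<omega>)\<bar> \<partial>M)"
      by (rule integral_abs_bound)
    also have "\<dots> \<le> (\<integral>\<omega>. C * \<epsilon> * h \<partial>M)"
    proof (rule integral_mono_AE)
      have "AE \<omega> in M. X t \<omega> = x \<longrightarrow> \<bar>c \<omega> - L \<omega> * h\<bar> \<le> \<epsilon> * h"
        using \<delta>(2) t h unfolding c_def L_def E_def by blast
      then show "AE \<omega> in M. \<bar>W \<omega> * c \<omega> - h * (W \<omega> * L \<omega>)\<bar> \<le> C * \<epsilon> * h"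
        using AE_space
      proof eventually_elim
        case (elim \<omega>)
        have "\<bar>W \<omega> * c \<omega> - h * (W \<omega> * L \<omega>)\<bar> = \<bar>W \<omega>\<bar> * \<bar>c \<omega> - L \<omega> * h\<bar>"
          by (simp add: abs_mult[symmetric] algebra_simps)
        also have "\<dots> \<le> C * (\<epsilon> * h)"
        proof (cases "X t \<omega> = x")
          case True
          then show ?thesis using elim C C0 by (intro mult_mono) auto
        next
          case False
          then show ?thesis using supp elim C0 assms(2) h by simp
        qed
        finally show ?case by (simp add: mult.assoc)
      qed
    qed (use ci WL in auto)
    finally show "\<bar>(\<integral>\<omega>. W \<omega> * indicator (jump_event t h y) \<omega> \<partial>M)
        - h * (\<integral>\<omega>. W \<omega> * local_time (\<lambda>u. X u \<omega>) y t \<partial>M)\<bar> \<le> C * \<epsilon> * h"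
      using eq by (simp add: E_def L_def prob_space)
  qed
qed

text \<open>A jump at \<open>s\<close> from \<open>x\<close> to \<open>y\<close> forces, for all
  large \<open>n\<close>, the process to be at \<open>x\<close> at time \<open>s - r n\<close> and
  to jump to \<open>y\<close> within the next \<open>2 * r n\<close>, which has probability of order
  \<open>r n\<close>. The starting times vary with \<open>n\<close>, so this rests on the uniformity
  of the error in time. It reconciles the open intervals of jump events with the half-open cells of
  a grid.\<close>

lemma no_jump_at_fixed_time:
  assumes "0 < s"
  shows "AE \<omega> in M. s \<notin> jump_times (\<lambda>u. X u \<omega>)"
proof -
  define r where "r n = s / real (n + 2)" for n
  have r: "0 < r n" "r n \<le> s" for n using assms by (auto simp: r_def field_simps)
  have r0: "r \<longlonglongrightarrow> 0" unfolding r_def by real_asymp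
  define C where "C x y n = (X (s - r n) -` {x} \<inter> space M) \<inter> jump_event (s - r n) (2 * r n) y" for x y n
  have C_sets[measurable]: "C x y n \<in> sets M" for x y n
    unfolding C_def using r[of n] by (intro sets.Int sets_jump_event measurable_sets[OF random_vertex_UNIV]) auto
  \<comment> \<open>The local time is at most \<open>1 + s\<close>, and the error with \<epsilon> =
    1 adds one more unit of rate.\<close>
  have small: "\<forall>\<^sub>F n in sequentially. measure M (C x y n) \<le> 2 * r n * (2 + s)" if xy: "adj x y" for x y
  proof -
    obtain \<delta> where \<delta>: "\<delta> > 0" "\<forall>t\<in>{0..s}. \<forall>h\<in>{0<..<\<delta>}. rate_close x y 1 t h"
      using jump_rate_integral[OF xy zero_less_one, of s] by blast
    have "\<forall>\<^sub>F n in sequentially. 2 * r n < \<delta>"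
      using tendsto_mult_right_zero[OF r0, of 2] \<delta>(1) by (rule order_tendstoD(2))
    then show ?thesis
    proof (rule eventually_mono)
      fix n assume n: "2 * r n < \<delta>"
      define t where "t = s - r n"
      define W where "W \<omega> = (indicator (X t -` {x} \<inter> space M) \<omega> :: real)" for \<omega>
      have t: "t \<in> {0..s}" using r[of n] by (auto simp: t_def)
      have "X t -` {x} \<inter> space (history M X t) \<in> sets (history M X t)"
        by (rule measurable_sets[OF adapted]) (use t in auto)
      then have Wm: "W \<in> borel_measurable (history M X t)"
        unfolding W_def space_history by (intro borel_measurable_indicator) simp
      have [measurable]: "W \<in> borel_measurable M" by (rule history_measurable_imp[OF Wm])
      have [measurable]: "(\<lambda>\<omega>. local_time (\<lambda>u. X u \<omega>) y t) \<in> borel_measurable M"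
        using history_measurable_imp[OF adapted_local_time] t by auto
      have L: "1 \<le> local_time (\<lambda>u. X u \<omega>) y t" "local_time (\<lambda>u. X u \<omega>) y t \<le> 1 + s" if "\<omega> \<in> space M" for \<omega>
        using jump_path.local_time_le[OF jump_path[OF that], of t y] t
        jump_path.local_time_ge_1[OF jump_path[OF that], of y t] by auto
      have "\<bar>(\<integral>\<omega>. W \<omega> * indicator (jump_event t (2 * r n) y) \<omega> \<partial>M)
        - 2 * r n * (\<integral>\<omega>. W \<omega> * local_time (\<lambda>u. X u \<omega>) y t \<partial>M)\<bar> \<le> 1 * 1 * (2 * r n)"
        by (rule \<delta>(2)[rule_format, OF _ _ Wm]) (use t n r[of n] in \<open>auto simp: W_def indicator_def\<close>)
      moreover have "(\<integral>\<omega>. W \<omega> * local_time (\<lambda>u. X u \<omega>) y t \<partial>M) \<le> (\<integral>\<omega>. 1 + s \<partial>M)"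
      proof (rule integral_mono')
        show "0 \<le> 1 + s" using assms by simp
        show "W \<omega> * local_time (\<lambda>u. X u \<omega>) y t \<le> 1 + s" if "\<omega> \<in> space M" for \<omega>
          using L[OF that] assms by (auto simp: W_def indicator_def)
      qed simp
      then have "2 * r n * (\<integral>\<omega>. W \<omega> * local_time (\<lambda>u. X u \<omega>) y t \<partial>M) \<le> 2 * r n * (1 + s)"
        using r[of n] by (intro mult_left_mono) (auto simp: prob_space)
      moreover have "(\<integral>\<omega>. W \<omega> * indicator (jump_event t (2 * r n) y) \<omega> \<partial>M) = measure M (C x y n)"
      proof -
        have "(\<integral>\<omega>. W \<omega> * indicator (jump_event t (2 * r n) y) \<omega> \<partial>M) = (\<integral>\<omega>. indicator (C x y n) \<omega> \<partial>M)"
          by (intro Bochner_Integration.integral_cong refl) (simp add: W_def C_def t_def split: split_indicator)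
        then show ?thesis using sets.sets_into_space[OF C_sets[of x y n]] by (simp add: Int_absorb2)
      qed
      ultimately show "measure M (C x y n) \<le> 2 * r n * (2 + s)" by (simp add: algebra_simps)
    qed
  qed
  have "AE \<omega> in M. \<omega> \<notin> (\<Inter>n\<in>{m..}. C x y n)" if xy: "adj x y" for x y m
  proof -
    have m: "(\<Inter>n\<in>{m..}. C x y n) \<in> sets M" by (rule sets.countable_INT') auto
    have "\<forall>\<^sub>F n in sequentially. measure M (\<Inter>n\<in>{m..}. C x y n) \<le> 2 * r n * (2 + s)"
      using small[OF xy] eventually_ge_at_top[of m]
    proof eventually_elim
      case (elim n)
      have "measure M (\<Inter>n\<in>{m..}. C x y n) \<le> measure M (C x y n)"
        by (rule finite_measure_mono) (use elim in auto)
      then show ?case using elim by simp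
    qed
    moreover have "(\<lambda>n. 2 * r n * (2 + s)) \<longlonglongrightarrow> 0"
      using tendsto_mult_left_zero[OF tendsto_mult_right_zero[OF r0, of 2], of "2 + s"] .
    ultimately have "measure M (\<Inter>n\<in>{m..}. C x y n) \<le> 0"
      by (intro tendsto_lowerbound) auto
    then have "emeasure M (\<Inter>n\<in>{m..}. C x y n) = 0"
      by (simp add: emeasure_eq_measure measure_le_0_iff)
    then show ?thesis using m by (intro AE_not_in null_setsI)
  qed
  then have "AE \<omega> in M. \<forall>x y m. adj x y \<longrightarrow> \<omega> \<notin> (\<Inter>n\<in>{m..}. C x y n)"
    by (subst AE_all_countable | subst AE_impI)+ auto
  then show ?thesis using AE_space
  proof eventually_elim
    case (elim \<omega>)
    interpret p: jump_path adj "\<lambda>u. X u \<omega>" by (rule jump_path[OF elim(2)])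
    show ?case
    proof
      assume "s \<in> jump_times (\<lambda>u. X u \<omega>)"
      then have "jumps_to (\<lambda>u. X u \<omega>) s (X s \<omega>)" by (simp add: jump_times_def)
      then obtain d x where d: "d > 0" "adj x (X s \<omega>)" "\<And>u. s - d < u \<Longrightarrow> u < s \<Longrightarrow> X u \<omega> = x"
        using p.jumps_toE[OF assms] by metis
      have "\<forall>\<^sub>F n in sequentially. r n < d" using r0 d(1) by (rule order_tendstoD(2))
      then obtain m where m: "\<And>n. n \<ge> m \<Longrightarrow> r n < d" unfolding eventually_sequentially by blast
      have "\<omega> \<in> C x (X s \<omega>) n" if "n \<ge> m" for n
      proof -
        have "X (s - r n) \<omega> = x" using d(3)[of "s - r n"] m[OF that] r[of n] by simp
        moreover have "\<omega> \<in> jump_event (s - r n) (2 * r n) (X s \<omega>)"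
          unfolding jump_event_def using elim(2) r[of n] \<open>jumps_to _ s (X s \<omega>)\<close>
          by (auto intro!: bexI[of _ s])
        ultimately show ?thesis using elim(2) by (simp add: C_def)
      qed
      then have "\<omega> \<in> (\<Inter>n\<in>{m..}. C x (X s \<omega>) n)" by auto
      then show False using elim(1) d(2) by blast
    qed
  qed
qed

end

section \<open>Supersolutions\<close>

abbreviation state_space :: "('v \<Rightarrow> real) measure" where
  "state_space \<equiv> (\<Pi>\<^sub>M v\<in>UNIV. borel)"

text \<open>
  \<open>D\<close> bounds the drift of \<open>F\<close> during a visit, and \<open>J x y\<close> bounds its change at a jump from
  \<open>x\<close> to \<open>y\<close>. The increments \<open>u\<close> and \<open>w\<close> are the times spent at \<open>x\<close> before and at \<open>y\<close>
  after a jump that happens within a short time step.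
\<close>

definition supersolution ::
    "'v set \<Rightarrow> ('v \<Rightarrow> 'v \<Rightarrow> bool) \<Rightarrow> ('v \<Rightarrow> ('v \<Rightarrow> real) \<Rightarrow> real) \<Rightarrow>
      ('v \<Rightarrow> ('v \<Rightarrow> real) \<Rightarrow> real) \<Rightarrow> ('v \<Rightarrow> 'v \<Rightarrow> ('v \<Rightarrow> real) \<Rightarrow> real) \<Rightarrow> bool" where
  "supersolution V adj F D J \<longleftrightarrow>
    (\<forall>x. F x \<in> borel_measurable state_space \<and> D x \<in> borel_measurable state_space \<and>
      (\<forall>y. J x y \<in> borel_measurable state_space)) \<and>
    (\<forall>T\<ge>0. \<exists>C\<ge>0. \<forall>x\<in>V. \<forall>L. (\<forall>v. 1 \<le> L v \<and> L v \<le> 1 + T) \<longrightarrow>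
      0 \<le> F x L \<and> F x L \<le> C \<and> \<bar>D x L\<bar> \<le> C \<and> (\<forall>y. adj x y \<longrightarrow> \<bar>J x y L\<bar> \<le> C) \<and>
      (\<forall>h\<in>{0..1}. F x (L(x := L x + h)) \<le> F x L + h * D x L + C * h\<^sup>2) \<and>
      (\<forall>y u w. adj x y \<longrightarrow> 0 \<le> u \<longrightarrow> 0 \<le> w \<longrightarrow> u + w \<le> 1 \<longrightarrow>
        F y (L(x := L x + u, y := L y + w)) \<le> F x L + J x y L + C * (u + w))) \<and>
    (\<forall>x\<in>V. \<forall>L. (\<forall>v. 1 \<le> L v) \<longrightarrow> D x L + (\<Sum>y | adj x y. L y * J x y L) \<le> 0)"

section \<open>Nonnegative supermartingales from supersolutions\<close>

context rooted_vrjp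
begin

abbreviation local_times :: "real \<Rightarrow> 'a \<Rightarrow> 'v \<Rightarrow> real" where
  "local_times t \<omega> \<equiv> \<lambda>v. local_time (\<lambda>u. X u \<omega>) v t"

abbreviation at_time :: "('v \<Rightarrow> ('v \<Rightarrow> real) \<Rightarrow> 'b) \<Rightarrow> real \<Rightarrow> 'a \<Rightarrow> 'b" where
  "at_time \<Phi> t \<omega> \<equiv> \<Phi> (X t \<omega>) (local_times t \<omega>)"

lemma measurable_local_times:
  assumes "0 \<le> t" "\<Phi> \<in> borel_measurable state_space"
  shows "(\<lambda>\<omega>. \<Phi> (local_times t \<omega>)) \<in> borel_measurable (history M X t)"
proof (rule measurable_compose[OF _ assms(2)])
  show "local_times t \<in> history M X t \<rightarrow>\<^sub>M state_space"
    by (rule measurable_PiM_single') (use adapted_local_time[OF assms(1)] in auto)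
qed

lemma measurable_at_time:
  assumes "0 \<le> t" "\<And>x. \<Phi> x \<in> borel_measurable state_space"
  shows "at_time \<Phi> t \<in> borel_measurable (history M X t)"
  by (rule measurable_compose_countable[where f = "\<lambda>x \<omega>. \<Phi> x (local_times t \<omega>)", OF _ adapted])
    (use assms measurable_local_times in auto)

lemma X_in_V: "\<omega> \<in> space M \<Longrightarrow> 0 \<le> t \<Longrightarrow> X t \<omega> \<in> V"
  using measurable_space[OF random_vertex] by auto

lemma local_times_bounds:
  assumes "\<omega> \<in> space M" "0 \<le> t" "t \<le> T"
  shows "1 \<le> local_times t \<omega> v" "local_times t \<omega> v \<le> 1 + T"
  using jump_path.local_time_le[OF jump_path[OF assms(1)] assms(2), of v] assms(3)
    jump_path.local_time_ge_1[OF jump_path[OF assms(1)], of v t] by auto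

abbreviation count :: "real \<Rightarrow> 'a \<Rightarrow> nat" where
  "count t \<omega> \<equiv> jump_path.jump_count (\<lambda>u. X u \<omega>) t"

text \<open>The starting point is part of the event because it is prescribed only almost surely,
  whereas confinement to a finite ball has to hold at every sample point of the event.\<close>

definition few_jumps :: "nat \<Rightarrow> real \<Rightarrow> 'a set" where
  "few_jumps K t = {\<omega> \<in> space M. X 0 \<omega> = x0 \<and> count t \<omega> \<le> K}"

definition double_jump :: "real \<Rightarrow> real \<Rightarrow> 'a set" where
  "double_jump t h = {\<omega> \<in> space M. count t \<omega> + 2 \<le> count (t + h) \<omega>}"

lemma sets_few_jumps: "0 \<le> t \<Longrightarrow> few_jumps K t \<in> sets (history M X t)"
proof -
  assume t: "0 \<le> t"
  have "few_jumps K t = (X 0 -` {x0} \<inter> space (history M X t)) \<inter>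
    ((\<lambda>\<omega>. real (count t \<omega>)) -` {..real K} \<inter> space (history M X t))"
    by (auto simp: few_jumps_def space_history)
  then show ?thesis
    using measurable_sets[OF adapted[of 0 t], of "{x0}"] measurable_sets[OF adapted_jump_count[OF t], of "{..real K}"] t
    by auto
qed

lemma sets_double_jump: "0 \<le> t \<Longrightarrow> 0 \<le> h \<Longrightarrow> double_jump t h \<in> sets M"
proof -
  assume t: "0 \<le> t" "0 \<le> h"
  have m: "(\<lambda>\<omega>. real (count t \<omega>)) \<in> borel_measurable M" "(\<lambda>\<omega>. real (count (t + h) \<omega>)) \<in> borel_measurable M"
    using history_measurable_imp[OF adapted_jump_count] t by auto
  have "double_jump t h = {\<omega> \<in> space M. real (count t \<omega>) + 2 \<le> real (count (t + h) \<omega>)}"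
    unfolding double_jump_def by (intro Collect_cong conj_cong refl) linarith
  also have "\<dots> \<in> sets M" using m by (intro borel_measurable_le borel_measurable_add) auto
  finally show ?thesis .
qed

lemma few_jumps_antimono: "s \<le> t \<Longrightarrow> few_jumps K t \<subseteq> few_jumps K s"
  using jump_path.jump_count_mono[OF jump_path] by (fastforce simp: few_jumps_def)

lemma few_jumps_reachable: "\<omega> \<in> few_jumps K t \<Longrightarrow> 0 \<le> t \<Longrightarrow> X t \<omega> \<in> reachable adj x0 K"
  using jump_path.path_reachable[OF jump_path, of \<omega> t] reachable_mono[of "count t \<omega>" K adj x0]
  by (auto simp: few_jumps_def)

lemma finite_neighbours': "finite {y. adj x y}"
proof (cases "x \<in> V")
  case False
  then have "{y. adj x y} = {}" using adj_in by blast
  then show ?thesis by (simp only: finite.emptyI)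
qed (rule finite_neighbours)

lemma finite_reachable: "finite (reachable adj x0 K)"
  by (induction K) (auto intro: finite_neighbours')

lemma local_times_no_jump:
  assumes "\<omega> \<in> space M" "0 \<le> t" "0 \<le> h" "{t<..t + h} \<inter> jump_times (\<lambda>u. X u \<omega>) = {}"
  shows "X (t + h) \<omega> = X t \<omega>"
    "local_times (t + h) \<omega> = (local_times t \<omega>)(X t \<omega> := local_times t \<omega> (X t \<omega>) + h)"
proof -
  interpret p: jump_path adj "\<lambda>u. X u \<omega>" by (rule jump_path[OF assms(1)])
  have c: "X s \<omega> = X t \<omega>" if "t \<le> s" "s \<le> t + h" for s
  proof (rule p.path_const)
    have "{t<..s} \<inter> jump_times (\<lambda>u. X u \<omega>) \<subseteq> {t<..t + h} \<inter> jump_times (\<lambda>u. X u \<omega>)"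
      using that by auto
    then show "{t<..s} \<inter> jump_times (\<lambda>u. X u \<omega>) = {}" using assms(4) by simp
  qed (use assms(2) that in auto)
  show "X (t + h) \<omega> = X t \<omega>" by (rule c) (use assms(3) in auto)
  show "local_times (t + h) \<omega> = (local_times t \<omega>)(X t \<omega> := local_times t \<omega> (X t \<omega>) + h)"
  proof
    fix v
    show "local_times (t + h) \<omega> v = ((local_times t \<omega>)(X t \<omega> := local_times t \<omega> (X t \<omega>) + h)) v"
      using p.local_time_const[OF assms(2) _ c, of "t + h" v] assms(3) by simp
  qed
qed

lemma local_times_one_jump:
  assumes "\<omega> \<in> space M" "0 \<le> t" "{t<..t + h} \<inter> jump_times (\<lambda>u. X u \<omega>) = {s}" "X t \<omega> = x" "X s \<omega> = y"
  shows "X (t + h) \<omega> = y" "adj x y"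
    "local_times (t + h) \<omega> = (local_times t \<omega>)(x := local_times t \<omega> x + (s - t), y := local_times t \<omega> y + (t + h - s))"
    "t < s" "s \<le> t + h"
    "s < t + h \<Longrightarrow> \<omega> \<in> jump_event t h z \<longleftrightarrow> z = y"
proof -
  interpret p: jump_path adj "\<lambda>u. X u \<omega>" by (rule jump_path[OF assms(1)])
  note oj = p.one_jump[OF assms(2,3)]
  show ts: "t < s" "s \<le> t + h" by (fact oj(1,2))+
  show "X (t + h) \<omega> = y" using oj(4)[OF ts(2) order_refl] assms(5) by simp
  show xy: "adj x y" using oj(6) assms by simp
  have ne: "x \<noteq> y" using xy adj_irrefl by blast
  show "local_times (t + h) \<omega> = (local_times t \<omega>)(x := local_times t \<omega> x + (s - t), y := local_times t \<omega> y + (t + h - s))"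
  proof
    fix v
    have "local_times s \<omega> v = local_times t \<omega> v + of_bool (v = x) * (s - t)"
      using p.local_time_const[OF assms(2) less_imp_le[OF ts(1)] oj(3), of v] assms(4) by simp
    moreover have "local_times (t + h) \<omega> v = local_times s \<omega> v + of_bool (v = y) * (t + h - s)"
      using p.local_time_const[OF _ ts(2) oj(4), of v] ts assms(2,5) by simp
    ultimately show "local_times (t + h) \<omega> v = ((local_times t \<omega>)(x := local_times t \<omega> x + (s - t),
      y := local_times t \<omega> y + (t + h - s))) v" using ne by simp
  qed
  show "\<omega> \<in> jump_event t h z \<longleftrightarrow> z = y" if "s < t + h"
  proof
    assume "\<omega> \<in> jump_event t h z"
    then obtain r where r: "t < r" "r < t + h" "jumps_to (\<lambda>u. X u \<omega>) r z" by (auto simp: jump_event_def)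
    then have "r \<in> {t<..t + h} \<inter> jump_times (\<lambda>u. X u \<omega>)"
      using assms(2) by (auto simp: jump_times_def jumps_to_def)
    then have "r = s" unfolding assms(3) by simp
    then show "z = y" using r assms(5) by (simp add: jumps_to_def)
  next
    assume "z = y"
    then show "\<omega> \<in> jump_event t h z"
      using oj(7) assms that ts by (auto simp: jump_event_def)
  qed
qed

lemma no_jump_event:
  assumes "0 \<le> t" "{t<..t + h} \<inter> jump_times (\<lambda>u. X u \<omega>) = {}"
  shows "\<omega> \<notin> jump_event t h z"
proof
  assume "\<omega> \<in> jump_event t h z"
  then obtain r where "t < r" "r < t + h" "jumps_to (\<lambda>u. X u \<omega>) r z" by (auto simp: jump_event_def)
  then have "r \<in> {t<..t + h} \<inter> jump_times (\<lambda>u. X u \<omega>)"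
    using assms(1) by (auto simp: jump_times_def jumps_to_def)
  then show False using assms(2) by blast
qed

lemma card_jumps_cell:
  assumes "\<omega> \<in> space M" "0 \<le> t" "0 \<le> h"
  shows "count (t + h) \<omega> = count t \<omega> + card ({t<..t + h} \<inter> jump_times (\<lambda>u. X u \<omega>))"
  using jump_path.jump_count_split[OF jump_path[OF assms(1)] assms(2,3), of 1] by simp

text \<open>Error budget of one time step. For a single jump, one \<open>C * h\<close> pays for the
  drift term and one for the time spent before and after the jump. For several jumps,
  \<open>C * (2 + d)\<close> pays for the new value, the drift term and the at most \<open>d\<close>
  jump terms.\<close>

abbreviation cell_bound where
  "cell_bound F D J C d t h \<omega> \<equiv> at_time F t \<omega> + h * at_time D t \<omega>
    + (\<Sum>y | adj (X t \<omega>) y. indicator (jump_event t h y) \<omega> * at_time (\<lambda>x. J x y) t \<omega>)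
    + 2 * C * h * (\<Sum>y | adj (X t \<omega>) y. indicator (jump_event t h y) \<omega>)
    + C * h\<^sup>2 + C * (2 + real d) * indicator (double_jump t h) \<omega>"

lemma cell_increment:
  assumes B: "0 \<le> C" "0 \<le> at_time F t \<omega>" "at_time F (t + h) \<omega> \<le> C" "\<bar>at_time D t \<omega>\<bar> \<le> C"
      "\<And>y. adj (X t \<omega>) y \<Longrightarrow> \<bar>at_time (\<lambda>x. J x y) t \<omega>\<bar> \<le> C"
    and flow: "F (X t \<omega>) ((local_times t \<omega>)(X t \<omega> := local_times t \<omega> (X t \<omega>) + h))
      \<le> at_time F t \<omega> + h * at_time D t \<omega> + C * h\<^sup>2"
    and jump: "\<And>y u w. adj (X t \<omega>) y \<Longrightarrow> 0 \<le> u \<Longrightarrow> 0 \<le> w \<Longrightarrow> u + w \<le> 1 \<Longrightarrow>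
      F y ((local_times t \<omega>)(X t \<omega> := local_times t \<omega> (X t \<omega>) + u, y := local_times t \<omega> y + w))
        \<le> at_time F t \<omega> + at_time (\<lambda>x. J x y) t \<omega> + C * (u + w)"
    and \<omega>: "\<omega> \<in> space M" and t: "0 \<le> t" and h: "0 < h" "h \<le> 1"
    and nj: "t + h \<notin> jump_times (\<lambda>u. X u \<omega>)" and d: "card {y. adj (X t \<omega>) y} \<le> d"
  shows "at_time F (t + h) \<omega> \<le> cell_bound F D J C d t h \<omega>"
proof -
  let ?N = "{y. adj (X t \<omega>) y}" and ?I = "\<lambda>y. indicator (jump_event t h y) \<omega> :: real"
  let ?J = "\<lambda>y. at_time (\<lambda>x. J x y) t \<omega>"
  let ?S = "{t<..t + h} \<inter> jump_times (\<lambda>u. X u \<omega>)"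
  have fin: "finite ?S"
    by (rule finite_subset[OF _ jump_path.finite_jump_times[OF jump_path[OF \<omega>], of "t + h"]]) auto
  have finN: "finite ?N" by (rule finite_neighbours')
  have i0: "0 \<le> (\<Sum>y\<in>?N. ?I y)" by (rule sum_nonneg) auto
  consider "card ?S = 0" | "card ?S = 1" | "card ?S \<ge> 2" by linarith
  then show ?thesis
  proof cases
    case 1
    then have e: "?S = {}" using fin by simp
    have "?I y = 0" for y using no_jump_event[OF t e] by simp
    then have "(\<Sum>y\<in>?N. ?I y * ?J y) = 0" "(\<Sum>y\<in>?N. ?I y) = 0" by simp_all
    moreover have "at_time F (t + h) \<omega> \<le> at_time F t \<omega> + h * at_time D t \<omega> + C * h\<^sup>2"
      using flow unfolding local_times_no_jump[OF \<omega> t less_imp_le[OF h(1)] e] .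
    moreover have "0 \<le> C * (2 + real d) * indicator (double_jump t h) \<omega>" using B(1) by simp
    ultimately show ?thesis by simp
  next
    case 2
    then obtain s where s: "?S = {s}" by (auto simp: card_1_singleton_iff)
    define y where "y = X s \<omega>"
    note oj = local_times_one_jump[OF \<omega> t s refl y_def[symmetric]]
    \<comment> \<open>The jump is not at the right end of the cell, so the open-interval event sees
      it.\<close>
    have "s \<noteq> t + h" using nj s by auto
    then have "s < t + h" using oj(5) by simp
    then have I: "?I z = of_bool (z = y)" for z using oj(6) by (simp add: indicator_def)
    have "(\<Sum>z\<in>?N. ?I z * ?J z) = ?J y" "(\<Sum>z\<in>?N. ?I z) = 1"
      using oj(2) finN unfolding I by (simp_all add: of_bool_def sum.delta' if_distrib[of "\<lambda>x. x * _"] cong: if_cong)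
    moreover have "at_time F (t + h) \<omega> \<le> at_time F t \<omega> + ?J y + C * h"
      using jump[OF oj(2), of "s - t" "t + h - s"] oj(4,5) h unfolding oj(1) oj(3) by simp
    moreover have "0 \<le> h * at_time D t \<omega> + C * h"
    proof -
      have "h * \<bar>at_time D t \<omega>\<bar> \<le> h * C" using B(4) h by (intro mult_left_mono) auto
      moreover have "h * at_time D t \<omega> \<ge> - (h * \<bar>at_time D t \<omega>\<bar>)" using h by (auto simp: abs_if)
      ultimately show ?thesis by (simp add: mult.commute)
    qed
    moreover have "0 \<le> C * (2 + real d) * indicator (double_jump t h) \<omega>" using B(1) by simp
    moreover have "0 \<le> C * h\<^sup>2" using B(1) by simp
    ultimately show ?thesis by simp
  next
    case 3
    then have "\<omega> \<in> double_jump t h"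
      using card_jumps_cell[OF \<omega> t less_imp_le[OF h(1)]] \<omega> by (simp add: double_jump_def)
    moreover have "h * at_time D t \<omega> \<ge> - C"
    proof -
      have "h * \<bar>at_time D t \<omega>\<bar> \<le> 1 * C" using B(1,4) h by (intro mult_mono) auto
      moreover have "h * at_time D t \<omega> \<ge> - (h * \<bar>at_time D t \<omega>\<bar>)" using h by (auto simp: abs_if)
      ultimately show ?thesis by simp
    qed
    moreover have "(\<Sum>y\<in>?N. ?I y * ?J y) \<ge> - (C * real d)"
    proof -
      have "(\<Sum>y\<in>?N. ?I y * ?J y) \<ge> (\<Sum>y\<in>?N. - C)"
      proof (rule sum_mono)
        fix y assume "y \<in> ?N"
        then show "- C \<le> ?I y * ?J y" using B(5)[of y] B(1) by (auto simp: indicator_def abs_le_iff)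
      qed
      moreover have "C * real (card ?N) \<le> C * real d" using d B(1) by (intro mult_left_mono) auto
      ultimately show ?thesis by (simp add: mult.commute)
    qed
    moreover have "0 \<le> 2 * C * h * (\<Sum>y\<in>?N. ?I y)" "0 \<le> C * h\<^sup>2" using B(1) h i0 by simp_all
    ultimately show ?thesis using B(2,3) by (simp add: algebra_simps)
  qed
qed

lemma supersolution_bounds:
  assumes "supersolution V adj F D J" "0 \<le> T"
  obtains C where "0 \<le> C"
    "\<And>\<omega> t. \<omega> \<in> space M \<Longrightarrow> 0 \<le> t \<Longrightarrow> t \<le> T \<Longrightarrow> 0 \<le> at_time F t \<omega> \<and> at_time F t \<omega> \<le> C"
    "\<And>\<omega> t. \<omega> \<in> space M \<Longrightarrow> 0 \<le> t \<Longrightarrow> t \<le> T \<Longrightarrow> \<bar>at_time D t \<omega>\<bar> \<le> C"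
    "\<And>\<omega> t y. \<omega> \<in> space M \<Longrightarrow> 0 \<le> t \<Longrightarrow> t \<le> T \<Longrightarrow> adj (X t \<omega>) y \<Longrightarrow>
      \<bar>at_time (\<lambda>x. J x y) t \<omega>\<bar> \<le> C"
    "\<And>\<omega> t h d. \<omega> \<in> space M \<Longrightarrow> 0 \<le> t \<Longrightarrow> 0 < h \<Longrightarrow> h \<le> 1 \<Longrightarrow> t + h \<le> T \<Longrightarrow>
      t + h \<notin> jump_times (\<lambda>u. X u \<omega>) \<Longrightarrow> card {y. adj (X t \<omega>) y} \<le> d \<Longrightarrow>
      at_time F (t + h) \<omega> \<le> cell_bound F D J C d t h \<omega>"
proof -
  obtain C where C: "0 \<le> C" and C': "\<forall>x\<in>V. \<forall>L. (\<forall>v. 1 \<le> L v \<and> L v \<le> 1 + T) \<longrightarrow>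
      0 \<le> F x L \<and> F x L \<le> C \<and> \<bar>D x L\<bar> \<le> C \<and> (\<forall>y. adj x y \<longrightarrow> \<bar>J x y L\<bar> \<le> C) \<and>
      (\<forall>h\<in>{0..1}. F x (L(x := L x + h)) \<le> F x L + h * D x L + C * h\<^sup>2) \<and>
      (\<forall>y u w. adj x y \<longrightarrow> 0 \<le> u \<longrightarrow> 0 \<le> w \<longrightarrow> u + w \<le> 1 \<longrightarrow>
        F y (L(x := L x + u, y := L y + w)) \<le> F x L + J x y L + C * (u + w))"
    using assms(1)[unfolded supersolution_def, THEN conjunct2, THEN conjunct1, THEN spec, THEN mp, OF assms(2)]
    by (elim exE conjE) (rule that; assumption)
  have state: "0 \<le> at_time F t \<omega> \<and> at_time F t \<omega> \<le> C \<and> \<bar>at_time D t \<omega>\<bar> \<le> C \<and>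
      (\<forall>y. adj (X t \<omega>) y \<longrightarrow> \<bar>at_time (\<lambda>x. J x y) t \<omega>\<bar> \<le> C) \<and>
      (\<forall>h\<in>{0..1}. F (X t \<omega>) ((local_times t \<omega>)(X t \<omega> := local_times t \<omega> (X t \<omega>) + h))
        \<le> at_time F t \<omega> + h * at_time D t \<omega> + C * h\<^sup>2) \<and>
      (\<forall>y u w. adj (X t \<omega>) y \<longrightarrow> 0 \<le> u \<longrightarrow> 0 \<le> w \<longrightarrow> u + w \<le> 1 \<longrightarrow>
        F y ((local_times t \<omega>)(X t \<omega> := local_times t \<omega> (X t \<omega>) + u, y := local_times t \<omega> y + w))
          \<le> at_time F t \<omega> + at_time (\<lambda>x. J x y) t \<omega> + C * (u + w))"
    if "\<omega> \<in> space M" "0 \<le> t" "t \<le> T" for \<omega> t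
    by (rule C'[THEN bspec, OF X_in_V[OF that(1,2)], THEN spec, THEN mp])
      (use local_times_bounds[OF that] in simp)
  show ?thesis
  proof (rule that[OF C])
    fix \<omega> t h d
    assume *: "\<omega> \<in> space M" "0 \<le> t" "0 < h" "h \<le> 1" "t + h \<le> T"
      "t + h \<notin> jump_times (\<lambda>u. X u \<omega>)" "card {y. adj (X t \<omega>) y} \<le> d"
    have tT: "t \<le> T" using * by simp
    have th: "0 \<le> t + h" using * by simp
    note st = state[OF *(1,2) tT]
    show "at_time F (t + h) \<omega> \<le> cell_bound F D J C d t h \<omega>"
    proof (rule cell_increment[OF C _ _ _ _ _ _ *(1,2,3,4,6,7)])
      show "at_time F (t + h) \<omega> \<le> C" using state[OF *(1) th *(5)] by blast
      show "F (X t \<omega>) ((local_times t \<omega>)(X t \<omega> := local_times t \<omega> (X t \<omega>) + h))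
        \<le> at_time F t \<omega> + h * at_time D t \<omega> + C * h\<^sup>2" using st *(3,4) by simp
    qed (use st in blast)+
  qed (use state in blast)+
qed

text \<open>
  Killing the process at its jump number \<open>K + 1\<close> confines it to finitely many vertices,
  on which the error terms of the jump rates are uniform, and leaves at most \<open>K + 1\<close> time
  steps with more than one jump, so that dominated convergence disposes of these.
  Killing can only help, since \<open>F\<close> is nonnegative.
\<close>

lemma killed_cell_expectation:
  assumes sup: "supersolution V adj F D J" and T: "0 \<le> T"
  obtains C1 C2 where "0 \<le> C1" "0 \<le> C2"
    "\<And>\<epsilon>. 0 < \<epsilon> \<Longrightarrow> \<epsilon> \<le> 1 \<Longrightarrow> \<forall>\<^sub>F h in at_right 0. \<forall>t A. 0 \<le> t \<longrightarrow> t + h \<le> T \<longrightarrow> A \<in> sets (history M X t) \<longrightarrow>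
      (\<integral>\<omega>. indicator (A \<inter> few_jumps K (t + h)) \<omega> * at_time F (t + h) \<omega> \<partial>M) \<le>
      (\<integral>\<omega>. indicator (A \<inter> few_jumps K t) \<omega> * at_time F t \<omega> \<partial>M) + C1 * h * (\<epsilon> + h)
        + C2 * measure M (few_jumps K t \<inter> double_jump t h)"
proof -
  obtain C where C: "0 \<le> C"
    "\<And>\<omega> t. \<omega> \<in> space M \<Longrightarrow> 0 \<le> t \<Longrightarrow> t \<le> T \<Longrightarrow> 0 \<le> at_time F t \<omega> \<and> at_time F t \<omega> \<le> C"
    "\<And>\<omega> t. \<omega> \<in> space M \<Longrightarrow> 0 \<le> t \<Longrightarrow> t \<le> T \<Longrightarrow> \<bar>at_time D t \<omega>\<bar> \<le> C"
    "\<And>\<omega> t y. \<omega> \<in> space M \<Longrightarrow> 0 \<le> t \<Longrightarrow> t \<le> T \<Longrightarrow> adj (X t \<omega>) y \<Longrightarrow>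
      \<bar>at_time (\<lambda>x. J x y) t \<omega>\<bar> \<le> C"
    "\<And>\<omega> t h d. \<omega> \<in> space M \<Longrightarrow> 0 \<le> t \<Longrightarrow> 0 < h \<Longrightarrow> h \<le> 1 \<Longrightarrow> t + h \<le> T \<Longrightarrow>
      t + h \<notin> jump_times (\<lambda>u. X u \<omega>) \<Longrightarrow> card {y. adj (X t \<omega>) y} \<le> d \<Longrightarrow>
      at_time F (t + h) \<omega> \<le> cell_bound F D J C d t h \<omega>"
    by (rule supersolution_bounds[OF sup T]) (rule that; assumption)
  define R where "R = reachable adj x0 K"
  define N where "N x = {y. adj x y}" for x
  have fin: "finite R" "finite (N x)" for x
    unfolding R_def N_def by (rule finite_reachable, rule finite_neighbours')
  \<comment> \<open>The number of directed edges leaving the ball; it also bounds the degree of each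
    vertex in it.\<close>
  define d where "d = (\<Sum>x\<in>R. card (N x))"
  have d: "card (N x) \<le> d" if "x \<in> R" for x
    unfolding d_def by (rule member_le_sum) (use that fin in auto)
  define C1 where "C1 = real d * C + 2 * C * real d * (2 + T) + C"
  define C2 where "C2 = C * (2 + real d)"
  note supm[measurable] = sup[unfolded supersolution_def, THEN conjunct1, rule_format, THEN conjunct1]
    sup[unfolded supersolution_def, THEN conjunct1, rule_format, THEN conjunct2, THEN conjunct1]
    sup[unfolded supersolution_def, THEN conjunct1, rule_format, THEN conjunct2, THEN conjunct2, rule_format]
  have drift: "D x L + (\<Sum>y\<in>N x. L y * J x y L) \<le> 0" if "x \<in> V" "\<And>v. 1 \<le> L v" for x L
    unfolding N_def
    by (rule sup[unfolded supersolution_def, THEN conjunct2, THEN conjunct2, THEN bspec, OF that(1), THEN spec, THEN mp])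
      (use that(2) in simp)
  show ?thesis
  proof (rule that[of C1 C2])
    show "0 \<le> C1" "0 \<le> C2" using C(1) T by (auto simp: C1_def C2_def)
    fix \<epsilon> :: real assume \<epsilon>: "0 < \<epsilon>" "\<epsilon> \<le> 1"
    have "\<forall>\<^sub>F h in at_right 0. \<forall>x\<in>R. \<forall>y\<in>N x. \<forall>t\<in>{0..T}. rate_close x y \<epsilon> t h"
    proof (rule eventually_ball_finite[OF fin(1)], rule ballI, rule eventually_ball_finite[OF fin(2)], rule ballI)
      fix x y assume "y \<in> N x"
      then have "adj x y" by (simp add: N_def)
      from jump_rate_integral[OF this \<epsilon>(1), of T] obtain \<delta> where \<delta>: "\<delta> > 0"
        "\<forall>t\<in>{0..T}. \<forall>h\<in>{0<..<\<delta>}. rate_close x y \<epsilon> t h" by blast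
      show "\<forall>\<^sub>F h in at_right 0. \<forall>t\<in>{0..T}. rate_close x y \<epsilon> t h"
        using eventually_at_right_real[OF \<delta>(1)] by (rule eventually_mono) (use \<delta>(2) in blast)
    qed
    moreover have "\<forall>\<^sub>F h in at_right 0. h \<in> {0<..<(1::real)}" by (rule eventually_at_right_real) simp
    ultimately show "\<forall>\<^sub>F h in at_right 0. \<forall>t A. 0 \<le> t \<longrightarrow> t + h \<le> T \<longrightarrow> A \<in> sets (history M X t) \<longrightarrow>
      (\<integral>\<omega>. indicator (A \<inter> few_jumps K (t + h)) \<omega> * at_time F (t + h) \<omega> \<partial>M) \<le>
      (\<integral>\<omega>. indicator (A \<inter> few_jumps K t) \<omega> * at_time F t \<omega> \<partial>M) + C1 * h * (\<epsilon> + h)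
        + C2 * measure M (few_jumps K t \<inter> double_jump t h)"
    proof (eventually_elim, intro allI impI)
      case (elim h)
      note rate = elim(1)[rule_format]
      fix t A assume t: "0 \<le> t" "t + h \<le> T" and A: "A \<in> sets (history M X t)"
      have h: "0 < h" "h \<le> 1" using elim(2) by auto
      have tT: "t \<le> T" "t \<in> {0..T}" "0 \<le> t + h" using t h by auto
      let ?W = "\<lambda>\<omega>. indicator (A \<inter> few_jumps K t) \<omega> :: real"
      let ?E = "\<lambda>y \<omega>. indicator (jump_event t h y) \<omega> :: real"
      let ?X = "\<lambda>x \<omega>. indicator (X t -` {x} \<inter> space M) \<omega> :: real"
      let ?L = "\<lambda>y \<omega>. local_times t \<omega> y"
      let ?F = "at_time F t" and ?D = "at_time D t"
      let ?J = "\<lambda>x y \<omega>. J x y (local_times t \<omega>)"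
      let ?B = "few_jumps K t \<inter> double_jump t h"
      have meas_h: "?W \<in> borel_measurable (history M X t)" "?X x \<in> borel_measurable (history M X t)"
        "?J x y \<in> borel_measurable (history M X t)" for x y
      proof -
        show "?W \<in> borel_measurable (history M X t)"
          by (intro borel_measurable_indicator sets.Int A sets_few_jumps t)
        have "X t -` {x} \<inter> space (history M X t) \<in> sets (history M X t)"
          by (rule measurable_sets[OF adapted]) (use t in auto)
        then show "?X x \<in> borel_measurable (history M X t)"
          unfolding space_history by (rule borel_measurable_indicator)
        show "?J x y \<in> borel_measurable (history M X t)"
          by (rule measurable_local_times[OF t(1)]) simp
      qed
      note [measurable] = history_measurable_imp[OF meas_h(1)] history_measurable_imp[OF meas_h(2)]
        history_measurable_imp[OF meas_h(3)] history_measurable_imp[OF adapted_local_time[OF t(1)]]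
        sets_jump_event[OF t(1)] sets_double_jump[OF t(1) less_imp_le[OF h(1)]]
      have [measurable]: "?F \<in> borel_measurable M" "?D \<in> borel_measurable M"
        by (rule history_measurable_imp[OF measurable_at_time[OF t(1)]], rule supm)+
      have [measurable]: "at_time F (t + h) \<in> borel_measurable M"
        by (rule history_measurable_imp[OF measurable_at_time[OF tT(3)]], rule supm)
      have few: "few_jumps K t \<in> sets M" "few_jumps K (t + h) \<in> sets M" "A \<in> sets M"
        using sets_few_jumps[OF t(1)] sets_few_jumps[OF tT(3)] A subalgebra_history
        unfolding subalgebra_def by blast+
      note [measurable] = few
      have bL: "\<bar>?L y \<omega>\<bar> \<le> 1 + T" if "\<omega> \<in> space M" for y \<omega>
        using local_times_bounds[OF that t(1) tT(1), of y] by simp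
      have bJ: "\<bar>?X x \<omega> * ?J x y \<omega>\<bar> \<le> C" if "\<omega> \<in> space M" "y \<in> N x" for x y \<omega>
        using C(1) C(4)[OF that(1) t(1) tT(1), of y] that(2) by (auto simp: N_def indicator_def)
      let ?G1 = "\<lambda>x y \<omega>. ?W \<omega> * (?X x \<omega> * ?J x y \<omega>)"
      let ?G2 = "\<lambda>x \<omega>. ?W \<omega> * ?X x \<omega>"
      have bG1: "\<bar>?G1 x y \<omega>\<bar> \<le> C" if "\<omega> \<in> space M" "y \<in> N x" for x y \<omega>
        using bJ[OF that] C(1) by (simp add: indicator_def split: if_splits)
      have bG2: "\<bar>?G2 x \<omega>\<bar> \<le> 1" for x \<omega> by (simp add: indicator_def)
      have i1: "integrable M (\<lambda>\<omega>. ?W \<omega> * ?F \<omega>)" "integrable M (\<lambda>\<omega>. ?W \<omega> * ?D \<omega>)"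
        by (rule integrable_const_bound[where B = C],
          use C(2,3)[OF _ t(1) tT(1)] C(1) in \<open>force simp: indicator_def\<close>, measurable)+
      have i2: "integrable M (\<lambda>\<omega>. ?G1 x y \<omega> * ?E y \<omega>)" if "y \<in> N x" for x y
        by (rule integrable_const_bound[where B = C], use bG1[OF _ that] C(1) in \<open>force simp: indicator_def\<close>, measurable)
      have i3: "integrable M (\<lambda>\<omega>. ?G2 x \<omega> * ?E y \<omega>)" for x y
        by (rule integrable_const_bound[where B = 1], force simp: indicator_def, measurable)
      have i4: "integrable M (\<lambda>\<omega>. ?G1 x y \<omega> * ?L y \<omega>)" if "y \<in> N x" for x y
      proof (rule integrable_const_bound[where B = "C * (1 + T)"])
        show "AE \<omega> in M. norm (?G1 x y \<omega> * ?L y \<omega>) \<le> C * (1 + T)"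
        proof (rule AE_I2)
          fix \<omega> assume \<omega>: "\<omega> \<in> space M"
          show "norm (?G1 x y \<omega> * ?L y \<omega>) \<le> C * (1 + T)"
            unfolding real_norm_def abs_mult[of "?G1 x y \<omega>"]
            by (rule mult_mono[OF bG1[OF \<omega> that] bL[OF \<omega>]]) (use C(1) in auto)
        qed
      qed measurable
      have i5: "integrable M (\<lambda>\<omega>. ?G2 x \<omega> * ?L y \<omega>)" for x y
      proof (rule integrable_const_bound[where B = "1 * (1 + T)"])
        show "AE \<omega> in M. norm (?G2 x \<omega> * ?L y \<omega>) \<le> 1 * (1 + T)"
        proof (rule AE_I2)
          fix \<omega> assume \<omega>: "\<omega> \<in> space M"
          show "norm (?G2 x \<omega> * ?L y \<omega>) \<le> 1 * (1 + T)"
            unfolding real_norm_def abs_mult[of "?G2 x \<omega>"]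
            by (rule mult_mono[OF bG2 bL[OF \<omega>]]) auto
        qed
      qed measurable
      \<comment> \<open>The rate estimate concerns a fixed edge, so the bound is first decomposed
        according to the value \<open>x\<close> of the present vertex.\<close>
      let ?rhs = "\<lambda>\<omega>. ?W \<omega> * ?F \<omega> + h * (?W \<omega> * ?D \<omega>)
        + (\<Sum>x\<in>R. \<Sum>y\<in>N x. ?G1 x y \<omega> * ?E y \<omega>)
        + 2 * C * h * (\<Sum>x\<in>R. \<Sum>y\<in>N x. ?G2 x \<omega> * ?E y \<omega>)
        + C * h\<^sup>2 + C2 * indicator ?B \<omega>"
      have "(\<integral>\<omega>. indicator (A \<inter> few_jumps K (t + h)) \<omega> * at_time F (t + h) \<omega> \<partial>M) \<le> (\<integral>\<omega>. ?rhs \<omega> \<partial>M)"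
      proof (rule integral_mono_AE)
        show "integrable M (\<lambda>\<omega>. indicator (A \<inter> few_jumps K (t + h)) \<omega> * at_time F (t + h) \<omega>)"
          by (rule integrable_const_bound[where B = C],
            use C(2)[OF _ tT(3) t(2)] C(1) in \<open>force simp: indicator_def\<close>, measurable)
        show "integrable M ?rhs"
          using i1 i2 i3 by (intro Bochner_Integration.integrable_add integrable_mult_right
              Bochner_Integration.integrable_sum) (auto simp: less_top[symmetric])
        show "AE \<omega> in M. indicator (A \<inter> few_jumps K (t + h)) \<omega> * at_time F (t + h) \<omega> \<le> ?rhs \<omega>"
          using no_jump_at_fixed_time[OF add_nonneg_pos[OF t(1) h(1)]] AE_space
        proof eventually_elim
          case (elim \<omega>)
          show ?case
          proof (cases "\<omega> \<in> A \<inter> few_jumps K t")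
            case False
            then have "\<omega> \<notin> A \<inter> few_jumps K (t + h)" using few_jumps_antimono[of t "t + h" K] h by auto
            then show ?thesis using False C(1) h by (simp add: C2_def)
          next
            case True
            then have xR: "X t \<omega> \<in> R" using few_jumps_reachable t by (auto simp: R_def)
            have collapse: "(\<Sum>x\<in>R. \<Sum>y\<in>N x. ?X x \<omega> * g x y) = (\<Sum>y\<in>N (X t \<omega>). g (X t \<omega>) y)" for g :: "'v \<Rightarrow> 'v \<Rightarrow> real"
            proof -
              have "(\<Sum>x\<in>R. \<Sum>y\<in>N x. ?X x \<omega> * g x y) = (\<Sum>x\<in>R. if x = X t \<omega> then \<Sum>y\<in>N x. g x y else 0)"
                using elim(2) by (intro sum.cong refl) (auto simp: indicator_def)
              then show ?thesis using xR fin by simp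
            qed
            have W: "?W \<omega> = 1" and B: "indicator ?B \<omega> = (indicator (double_jump t h) \<omega> :: real)"
              using True by (auto simp: indicator_def)
            have dd: "card {y. adj (X t \<omega>) y} \<le> d" using d[OF xR] by (simp add: N_def)
            have "t + h \<notin> jump_times (\<lambda>u. X u \<omega>)" using elim(1) h t by auto
            note inc = C(5)[OF elim(2) t(1) h t(2) this dd, folded N_def C2_def]
            have "indicator (A \<inter> few_jumps K (t + h)) \<omega> * at_time F (t + h) \<omega> \<le> at_time F (t + h) \<omega>"
              using C(2)[OF elim(2) tT(3) t(2)] by (auto simp: indicator_def)
            also have "\<dots> \<le> ?rhs \<omega>"
              using inc unfolding W B mult_1 mult.assoc collapse by (simp add: mult.commute mult.assoc)
            finally show ?thesis .
          qed
        qed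
      qed
      also have "(\<integral>\<omega>. ?rhs \<omega> \<partial>M) = (\<integral>\<omega>. ?W \<omega> * ?F \<omega> \<partial>M) + h * (\<integral>\<omega>. ?W \<omega> * ?D \<omega> \<partial>M)
        + (\<Sum>x\<in>R. \<Sum>y\<in>N x. \<integral>\<omega>. ?G1 x y \<omega> * ?E y \<omega> \<partial>M)
        + 2 * C * h * (\<Sum>x\<in>R. \<Sum>y\<in>N x. \<integral>\<omega>. ?G2 x \<omega> * ?E y \<omega> \<partial>M)
        + C * h\<^sup>2 + C2 * measure M ?B"
        using i1 i2 i3 by (simp add: Bochner_Integration.integral_sum Bochner_Integration.integrable_sum
            prob_space less_top[symmetric])
      \<comment> \<open>Jump indicators are now replaced by rates. In the sum with the prefactor
        \<open>2 * C * h\<close> a crude bound is enough: a rate of at most \<open>1 + T\<close>,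
        plus an error \<epsilon> \<le> 1.\<close>
      also have "\<dots> \<le> (\<integral>\<omega>. ?W \<omega> * ?F \<omega> \<partial>M) + h * (\<integral>\<omega>. ?W \<omega> * ?D \<omega> \<partial>M)
        + (\<Sum>x\<in>R. \<Sum>y\<in>N x. h * (\<integral>\<omega>. ?G1 x y \<omega> * ?L y \<omega> \<partial>M) + C * \<epsilon> * h)
        + 2 * C * h * (\<Sum>x\<in>R. \<Sum>y\<in>N x. h * (2 + T))
        + C * h\<^sup>2 + C2 * measure M ?B"
      proof (intro add_mono mult_left_mono sum_mono order_refl)
        fix x y assume xy: "x \<in> R" "y \<in> N x"
        have "\<bar>(\<integral>\<omega>. ?G1 x y \<omega> * ?E y \<omega> \<partial>M) - h * (\<integral>\<omega>. ?G1 x y \<omega> * ?L y \<omega> \<partial>M)\<bar> \<le> C * \<epsilon> * h"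
          by (rule rate[OF xy tT(2)]) (use meas_h bG1[OF _ xy(2)] in \<open>auto simp: indicator_def\<close>)
        then show "(\<integral>\<omega>. ?G1 x y \<omega> * ?E y \<omega> \<partial>M) \<le> h * (\<integral>\<omega>. ?G1 x y \<omega> * ?L y \<omega> \<partial>M) + C * \<epsilon> * h" by linarith
        have "\<bar>(\<integral>\<omega>. ?G2 x \<omega> * ?E y \<omega> \<partial>M) - h * (\<integral>\<omega>. ?G2 x \<omega> * ?L y \<omega> \<partial>M)\<bar> \<le> 1 * \<epsilon> * h"
          by (rule rate[OF xy tT(2)]) (use meas_h bG2 in \<open>auto simp: indicator_def\<close>)
        moreover have "(\<integral>\<omega>. ?G2 x \<omega> * ?L y \<omega> \<partial>M) \<le> (\<integral>\<omega>. 1 + T \<partial>M)"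
        proof (rule integral_mono[OF i5])
          fix \<omega> assume "\<omega> \<in> space M"
          then show "?G2 x \<omega> * ?L y \<omega> \<le> 1 + T" using bL[of \<omega> y] T by (auto simp: indicator_def)
        qed simp
        then have "h * (\<integral>\<omega>. ?G2 x \<omega> * ?L y \<omega> \<partial>M) \<le> h * (1 + T)"
          using h by (intro mult_left_mono) (auto simp: prob_space)
        moreover have "\<epsilon> * h \<le> h" using \<epsilon> h by simp
        ultimately show "(\<integral>\<omega>. ?G2 x \<omega> * ?E y \<omega> \<partial>M) \<le> h * (2 + T)" by (simp add: algebra_simps)
      qed (use C(1) h in \<open>simp_all add: C2_def\<close>)
      also have "\<dots> = (\<integral>\<omega>. ?W \<omega> * ?F \<omega> \<partial>M)
        + h * ((\<integral>\<omega>. ?W \<omega> * ?D \<omega> \<partial>M) + (\<Sum>x\<in>R. \<Sum>y\<in>N x. \<integral>\<omega>. ?G1 x y \<omega> * ?L y \<omega> \<partial>M))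
        + (real d * (C * \<epsilon> * h) + 2 * C * h * (real d * (h * (2 + T))) + C * h\<^sup>2) + C2 * measure M ?B"
        by (simp add: sum.distrib sum_distrib_left[symmetric] sum_distrib_right[symmetric] d_def algebra_simps)
      \<comment> \<open>With the rates in place, the coefficient of \<open>h\<close> is the integral
        of drift plus rate-weighted jumps, which the supersolution inequality makes
        nonpositive.\<close>
      also have "\<dots> \<le> (\<integral>\<omega>. ?W \<omega> * ?F \<omega> \<partial>M) + 0 + C1 * h * (\<epsilon> + h) + C2 * measure M ?B"
      proof (intro add_mono order_refl)
        have "(\<integral>\<omega>. ?W \<omega> * ?D \<omega> \<partial>M) + (\<Sum>x\<in>R. \<Sum>y\<in>N x. \<integral>\<omega>. ?G1 x y \<omega> * ?L y \<omega> \<partial>M)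
          = (\<integral>\<omega>. ?W \<omega> * ?D \<omega> + (\<Sum>x\<in>R. \<Sum>y\<in>N x. ?G1 x y \<omega> * ?L y \<omega>) \<partial>M)"
          using i1 i4 by (simp add: Bochner_Integration.integral_sum Bochner_Integration.integrable_sum)
        also have "\<dots> \<le> (\<integral>\<omega>. 0 \<partial>M)"
        proof (rule integral_mono')
          fix \<omega> assume \<omega>: "\<omega> \<in> space M"
          show "?W \<omega> * ?D \<omega> + (\<Sum>x\<in>R. \<Sum>y\<in>N x. ?G1 x y \<omega> * ?L y \<omega>) \<le> 0"
          proof (cases "\<omega> \<in> A \<inter> few_jumps K t")
            case True
            then have xR: "X t \<omega> \<in> R" using few_jumps_reachable t by (auto simp: R_def)
            have "(\<Sum>x\<in>R. \<Sum>y\<in>N x. ?G1 x y \<omega> * ?L y \<omega>) =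
              (\<Sum>x\<in>R. if x = X t \<omega> then \<Sum>y\<in>N x. ?L y \<omega> * ?J x y \<omega> else 0)"
              using \<omega> True by (intro sum.cong refl) (auto simp: indicator_def mult.commute)
            also have "\<dots> = (\<Sum>y\<in>N (X t \<omega>). ?L y \<omega> * ?J (X t \<omega>) y \<omega>)" using xR fin by simp
            finally show ?thesis
              using drift[OF X_in_V[OF \<omega> t(1)] local_times_bounds(1)[OF \<omega> t(1) tT(1)]] True by simp
          qed simp
        qed simp_all
        finally show "h * ((\<integral>\<omega>. ?W \<omega> * ?D \<omega> \<partial>M) + (\<Sum>x\<in>R. \<Sum>y\<in>N x. \<integral>\<omega>. ?G1 x y \<omega> * ?L y \<omega> \<partial>M)) \<le> 0"
          using h by (intro mult_nonneg_nonpos) simp_all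
        have "C1 * h * (\<epsilon> + h) - (real d * (C * \<epsilon> * h) + 2 * C * h * (real d * (h * (2 + T))) + C * h\<^sup>2)
          = real d * C * h * h + 2 * C * real d * (2 + T) * h * \<epsilon> + C * h * \<epsilon>"
          by (simp add: C1_def algebra_simps power2_eq_square)
        also have "\<dots> \<ge> 0" using C(1) h T \<epsilon> by (intro add_nonneg_nonneg mult_nonneg_nonneg) auto
        finally show "real d * (C * \<epsilon> * h) + 2 * C * h * (real d * (h * (2 + T))) + C * h\<^sup>2 \<le> C1 * h * (\<epsilon> + h)"
          by linarith
      qed
      finally show "(\<integral>\<omega>. indicator (A \<inter> few_jumps K (t + h)) \<omega> * at_time F (t + h) \<omega> \<partial>M) \<le>
        (\<integral>\<omega>. indicator (A \<inter> few_jumps K t) \<omega> * at_time F t \<omega> \<partial>M) + C1 * h * (\<epsilon> + h)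
        + C2 * measure M (few_jumps K t \<inter> double_jump t h)" by simp
    qed
  qed
qed

text \<open>The constant \<open>K + 1\<close> is the dominating function for letting the mesh tend
  to 0. The bound by the jump count is what carries the induction: a cell is counted only if at most
  \<open>K\<close> jumps came before it, so at most \<open>K\<close> cells were counted
  earlier.\<close>

lemma double_jump_sum_le:
  assumes \<omega>: "\<omega> \<in> space M" and s: "0 \<le> s" and h: "0 \<le> h"
  shows "(\<Sum>j<n. indicator (few_jumps K (s + real j * h) \<inter> double_jump (s + real j * h) h) \<omega> :: real)
    \<le> min (real (count (s + real n * h) \<omega>)) (real K + 1)"
proof (induction n)
  case (Suc n)
  let ?t = "s + real n * h"
  let ?E = "few_jumps K ?t \<inter> double_jump ?t h"
  have t: "s + real (Suc n) * h = ?t + h" by (simp add: algebra_simps)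
  have mono: "count ?t \<omega> \<le> count (?t + h) \<omega>"
    by (rule jump_path.jump_count_mono[OF jump_path[OF \<omega>]]) (use h in simp)
  show ?case
  proof (cases "\<omega> \<in> ?E")
    case True
    then have "count ?t \<omega> \<le> K" "count ?t \<omega> + 2 \<le> count (?t + h) \<omega>"
      by (auto simp: few_jumps_def double_jump_def)
    then have "real (count ?t \<omega>) \<le> real K" "real (count ?t \<omega>) + 2 \<le> real (count (?t + h) \<omega>)" by linarith+
    then show ?thesis using Suc True unfolding t by simp
  next
    case False
    have "real (count ?t \<omega>) \<le> real (count (?t + h) \<omega>)" using mono by simp
    then show ?thesis using Suc False unfolding t by simp
  qed
qed simp

text \<open>For each path the sum vanishes as soon as the mesh is below the gap between its
  jumps.\<close>

lemma double_jump_sum_tendsto_0: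
  assumes \<omega>: "\<omega> \<in> space M" and s: "0 \<le> s" "s \<le> t"
  shows "(\<lambda>n. \<Sum>j<Suc n. indicator (few_jumps K (s + real j * ((t - s) / Suc n))
      \<inter> double_jump (s + real j * ((t - s) / Suc n)) ((t - s) / Suc n)) \<omega> :: real) \<longlonglongrightarrow> 0"
proof -
  interpret p: jump_path adj "\<lambda>u. X u \<omega>" by (rule jump_path[OF \<omega>])
  obtain d where d: "d > 0" "\<And>a b. a \<in> jump_times (\<lambda>u. X u \<omega>) \<Longrightarrow> b \<in> jump_times (\<lambda>u. X u \<omega>) \<Longrightarrow>
    a \<le> t \<Longrightarrow> b \<le> t \<Longrightarrow> a \<noteq> b \<Longrightarrow> d \<le> \<bar>a - b\<bar>"
    using p.jump_gap by blast
  have "(\<lambda>n. (t - s) / real (Suc n)) \<longlonglongrightarrow> 0" by real_asymp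
  then have "\<forall>\<^sub>F n in sequentially. (t - s) / real (Suc n) < d" using d(1) by (rule order_tendstoD(2))
  then have "\<forall>\<^sub>F n in sequentially. 0 = (\<Sum>j<Suc n. indicator (few_jumps K (s + real j * ((t - s) / Suc n))
      \<inter> double_jump (s + real j * ((t - s) / Suc n)) ((t - s) / Suc n)) \<omega> :: real)"
  proof (rule eventually_mono)
    fix n assume n: "(t - s) / real (Suc n) < d"
    define h where "h = (t - s) / real (Suc n)"
    have h: "0 \<le> h" "h < d" "s + real (Suc n) * h = t" using n s by (auto simp: h_def)
    have "\<omega> \<notin> double_jump (s + real j * h) h" if j: "j < Suc n" for j
    proof
      assume dj: "\<omega> \<in> double_jump (s + real j * h) h"
      let ?t = "s + real j * h"
      let ?S = "{?t<..?t + h} \<inter> jump_times (\<lambda>u. X u \<omega>)"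
      have ub: "?t + h \<le> t"
      proof -
        have "real (Suc j) * h \<le> real (Suc n) * h" using j h(1) by (intro mult_right_mono) auto
        then show ?thesis using h(3) by (simp add: algebra_simps)
      qed
      have t0: "0 \<le> ?t" using s h by simp
      have fin: "finite ?S" by (rule finite_subset[OF _ p.finite_jump_times[of t]]) (use ub in auto)
      have "2 \<le> card ?S" using dj card_jumps_cell[OF \<omega> t0 h(1)] by (simp add: double_jump_def)
      then obtain a b where ab: "a \<in> ?S" "b \<in> ?S" "a \<noteq> b"
        using card_le_Suc0_iff_eq[OF fin] by fastforce
      then have "d \<le> \<bar>a - b\<bar>" using d(2)[of a b] ub by auto
      moreover have "\<bar>a - b\<bar> \<le> h" using ab by auto
      ultimately show False using h(2) by simp
    qed
    then show "0 = (\<Sum>j<Suc n. indicator (few_jumps K (s + real j * ((t - s) / Suc n))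
      \<inter> double_jump (s + real j * ((t - s) / Suc n)) ((t - s) / Suc n)) \<omega> :: real)"
      unfolding h_def[symmetric] by (intro sum.neutral[symmetric]) auto
  qed
  then show ?thesis by (rule Lim_transform_eventually[OF tendsto_const])
qed

text \<open>Summing the one-step inequality over a grid costs
  \<open>C1 * (t - s) * (\<epsilon> + h)\<close> plus a multiple of the expected number of cells
  with several jumps. First the mesh tends to 0, by dominated convergence, and then
  \<epsilon>.\<close>

lemma killed_supermartingale:
  assumes sup: "supersolution V adj F D J" and st: "0 \<le> s" "s < t" and A: "A \<in> sets (history M X s)"
  shows "(\<integral>\<omega>. indicator (A \<inter> few_jumps K t) \<omega> * at_time F t \<omega> \<partial>M)
    \<le> (\<integral>\<omega>. indicator (A \<inter> few_jumps K s) \<omega> * at_time F s \<omega> \<partial>M)"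
proof -
  have t0: "0 \<le> t" using st by simp
  define Y where "Y r = (\<integral>\<omega>. indicator (A \<inter> few_jumps K r) \<omega> * at_time F r \<omega> \<partial>M)" for r
  obtain C1 C2 where C: "0 \<le> C1" "0 \<le> C2"
    and cell: "\<And>\<epsilon>. 0 < \<epsilon> \<Longrightarrow> \<epsilon> \<le> 1 \<Longrightarrow> \<forall>\<^sub>F h in at_right 0. \<forall>r A. 0 \<le> r \<longrightarrow> r + h \<le> t \<longrightarrow> A \<in> sets (history M X r) \<longrightarrow>
      (\<integral>\<omega>. indicator (A \<inter> few_jumps K (r + h)) \<omega> * at_time F (r + h) \<omega> \<partial>M) \<le>
      (\<integral>\<omega>. indicator (A \<inter> few_jumps K r) \<omega> * at_time F r \<omega> \<partial>M) + C1 * h * (\<epsilon> + h)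
        + C2 * measure M (few_jumps K r \<inter> double_jump r h)"
    by (rule killed_cell_expectation[OF sup t0, of K]) (rule that; assumption)
  define h where "h n = (t - s) / real (Suc n)" for n
  define b where "b n \<omega> = (\<Sum>j<Suc n. indicator (few_jumps K (s + real j * h n)
      \<inter> double_jump (s + real j * h n) (h n)) \<omega> :: real)" for n \<omega>
  have h0: "0 < h n" "s + real (Suc n) * h n = t" for n using st by (auto simp: h_def)
  have few_sets[measurable]: "few_jumps K r \<inter> double_jump r (h n) \<in> sets M" if "0 \<le> r" for r n
    using sets_few_jumps[OF that, of K] subalgebra_history sets_double_jump[OF that, of "h n"] h0[of n]
    unfolding subalgebra_def by auto
  have ib: "integrable M (\<lambda>\<omega>. indicator (few_jumps K (s + real j * h n)
      \<inter> double_jump (s + real j * h n) (h n)) \<omega> :: real)" for j n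
    using few_sets[of "s + real j * h n" n] st h0[of n] by (simp add: less_top[symmetric])
  have b_meas: "b n \<in> borel_measurable M" for n
    unfolding b_def using ib by (intro borel_measurable_sum borel_measurable_integrable)
  have b_lim: "(\<lambda>n. \<integral>\<omega>. b n \<omega> \<partial>M) \<longlonglongrightarrow> (\<integral>\<omega>. 0 \<partial>M)"
  proof (rule integral_dominated_convergence[where w = "\<lambda>_. real K + 1"])
    show "AE \<omega> in M. (\<lambda>n. b n \<omega>) \<longlonglongrightarrow> 0"
      by (rule AE_I2) (use double_jump_sum_tendsto_0 st in \<open>auto simp: b_def h_def simp del: sum.lessThan_Suc of_nat_Suc\<close>)
    show "AE \<omega> in M. norm (b n \<omega>) \<le> real K + 1" for n
    proof (rule AE_I2)
      fix \<omega> assume "\<omega> \<in> space M"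
      from double_jump_sum_le[OF this st(1) less_imp_le[OF h0(1)[of n]], of K "Suc n"]
      have "b n \<omega> \<le> real K + 1" unfolding b_def by linarith
      moreover have "0 \<le> b n \<omega>" unfolding b_def by (rule sum_nonneg) simp
      ultimately show "norm (b n \<omega>) \<le> real K + 1" by simp
    qed
  qed (use b_meas in simp_all)
  have h_lim: "h \<longlonglongrightarrow> 0" unfolding h_def by real_asymp
  have "Y t \<le> Y s + C1 * (t - s) * \<epsilon>" if \<epsilon>: "0 < \<epsilon>" "\<epsilon> \<le> 1" for \<epsilon>
  proof -
    have "filterlim h (at_right 0) sequentially"
      by (rule filterlim_at_withinI[OF h_lim]) (use h0 in \<open>auto intro: always_eventually\<close>)
    from eventually_compose_filterlim[OF cell[OF \<epsilon>] this]
    have "\<forall>\<^sub>F n in sequentially. Y t \<le> Y s + C1 * (t - s) * (\<epsilon> + h n) + C2 * (\<integral>\<omega>. b n \<omega> \<partial>M)"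
    proof (rule eventually_mono)
      fix n
      assume step: "\<forall>r A. 0 \<le> r \<longrightarrow> r + h n \<le> t \<longrightarrow> A \<in> sets (history M X r) \<longrightarrow>
        (\<integral>\<omega>. indicator (A \<inter> few_jumps K (r + h n)) \<omega> * at_time F (r + h n) \<omega> \<partial>M) \<le>
        (\<integral>\<omega>. indicator (A \<inter> few_jumps K r) \<omega> * at_time F r \<omega> \<partial>M) + C1 * h n * (\<epsilon> + h n)
          + C2 * measure M (few_jumps K r \<inter> double_jump r (h n))"
      have "Y (s + real i * h n) \<le> Y s + real i * (C1 * h n * (\<epsilon> + h n))
        + C2 * (\<Sum>j<i. measure M (few_jumps K (s + real j * h n) \<inter> double_jump (s + real j * h n) (h n)))"
        if "i \<le> Suc n" for i
        using that
      proof (induction i)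
        case (Suc i)
        let ?r = "s + real i * h n"
        have r: "0 \<le> ?r" "s \<le> ?r" using st h0[of n] by auto
        have e: "s + real (Suc i) * h n = ?r + h n" by (simp add: algebra_simps)
        have "real (Suc i) * h n \<le> real (Suc n) * h n" using Suc.prems h0(1)[of n] by (intro mult_right_mono) auto
        then have "?r + h n \<le> t" using h0(2)[of n] e by linarith
        then have "Y (?r + h n) \<le> Y ?r + C1 * h n * (\<epsilon> + h n) + C2 * measure M (few_jumps K ?r \<inter> double_jump ?r (h n))"
          unfolding Y_def using step r A sets_history_mono[OF r(2)] by blast
        then show ?case using Suc unfolding e by (simp add: algebra_simps)
      qed simp
      from this[OF order_refl] have a: "Y t \<le> Y s + (real (Suc n) * h n) * (C1 * (\<epsilon> + h n))
        + C2 * (\<Sum>j<Suc n. measure M (few_jumps K (s + real j * h n) \<inter> double_jump (s + real j * h n) (h n)))"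
        unfolding h0(2) by (simp only: mult.assoc mult.left_commute)
      have b: "real (Suc n) * h n = t - s" using h0(2)[of n] by linarith
      have c: "(\<Sum>j<Suc n. measure M (few_jumps K (s + real j * h n) \<inter> double_jump (s + real j * h n) (h n)))
        = (\<integral>\<omega>. b n \<omega> \<partial>M)"
        unfolding b_def
      proof (subst Bochner_Integration.integral_sum, rule ib, rule sum.cong[OF refl])
        fix j
        have "(few_jumps K (s + real j * h n) \<inter> double_jump (s + real j * h n) (h n)) \<inter> space M
          = few_jumps K (s + real j * h n) \<inter> double_jump (s + real j * h n) (h n)"
          by (auto simp: few_jumps_def)
        then show "measure M (few_jumps K (s + real j * h n) \<inter> double_jump (s + real j * h n) (h n))
          = (\<integral>\<omega>. indicator (few_jumps K (s + real j * h n) \<inter> double_jump (s + real j * h n) (h n)) \<omega> \<partial>M)"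
          by (simp only: Bochner_Integration.integral_indicator)
      qed
      show "Y t \<le> Y s + C1 * (t - s) * (\<epsilon> + h n) + C2 * (\<integral>\<omega>. b n \<omega> \<partial>M)"
        using a unfolding b c by (simp only: mult_ac)
    qed
    moreover have "(\<lambda>n. Y s + C1 * (t - s) * (\<epsilon> + h n) + C2 * (\<integral>\<omega>. b n \<omega> \<partial>M))
      \<longlonglongrightarrow> Y s + C1 * (t - s) * (\<epsilon> + 0) + C2 * (\<integral>\<omega>. 0 \<partial>M)"
      by (intro tendsto_intros h_lim b_lim)
    ultimately show ?thesis by (intro tendsto_lowerbound[of _ _ sequentially]) auto
  qed
  then have "\<forall>\<^sub>F \<epsilon> in at_right 0. Y t \<le> Y s + C1 * (t - s) * \<epsilon>"
    using eventually_at_right_real[of 0 1] by (auto elim!: eventually_mono)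
  moreover have "((\<lambda>\<epsilon>. Y s + C1 * (t - s) * \<epsilon>) \<longlongrightarrow> Y s + C1 * (t - s) * 0) (at_right 0)"
    by (intro tendsto_intros)
  ultimately have "Y t \<le> Y s + C1 * (t - s) * 0"
    by (intro tendsto_lowerbound[of _ _ "at_right (0::real)"]) auto
  then show ?thesis by (simp add: Y_def)
qed

text \<open>The killing is removed by letting \<open>K\<close> tend to infinity: every path has
  finitely many jumps before \<open>t\<close>, and \<open>F\<close> is bounded on bounded time
  intervals.\<close>

theorem supersolution_supermartingale:
  assumes sup: "supersolution V adj F D J" and st: "0 \<le> s" "s \<le> t" and A: "A \<in> sets (history M X s)"
  shows "(\<integral>\<omega>. indicator A \<omega> * at_time F t \<omega> \<partial>M) \<le> (\<integral>\<omega>. indicator A \<omega> * at_time F s \<omega> \<partial>M)"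
proof (cases "s = t")
  case False
  then have st': "s < t" "0 \<le> t" using st by auto
  obtain C where C: "0 \<le> C"
    "\<And>\<omega> r. \<omega> \<in> space M \<Longrightarrow> 0 \<le> r \<Longrightarrow> r \<le> t \<Longrightarrow> 0 \<le> at_time F r \<omega> \<and> at_time F r \<omega> \<le> C"
    by (rule supersolution_bounds[OF sup st'(2)]) (rule that; assumption)
  have AM: "A \<in> sets M" using A subalgebra_history unfolding subalgebra_def by blast
  have Fm: "at_time F r \<in> borel_measurable M" if "0 \<le> r" for r
    by (rule history_measurable_imp[OF measurable_at_time[OF that]])
      (use sup in \<open>simp add: supersolution_def\<close>)
  have fm: "few_jumps K r \<in> sets M" if "0 \<le> r" for r K
    using sets_few_jumps[OF that] subalgebra_history unfolding subalgebra_def by blast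
  have lim: "(\<lambda>K. \<integral>\<omega>. indicator (A \<inter> few_jumps K t) \<omega> * at_time F t \<omega> \<partial>M) \<longlonglongrightarrow>
    (\<integral>\<omega>. indicator A \<omega> * at_time F t \<omega> \<partial>M)"
  proof (rule integral_dominated_convergence[where w = "\<lambda>_. C"])
    show "AE \<omega> in M. (\<lambda>K. indicator (A \<inter> few_jumps K t) \<omega> * at_time F t \<omega>) \<longlonglongrightarrow> indicator A \<omega> * at_time F t \<omega>"
      using start AE_space
    proof eventually_elim
      case (elim \<omega>)
      have "\<forall>\<^sub>F K in sequentially. indicator A \<omega> * at_time F t \<omega> = indicator (A \<inter> few_jumps K t) \<omega> * at_time F t \<omega>"
        using eventually_ge_at_top[of "count t \<omega>"]
        by (rule eventually_mono) (use elim in \<open>auto simp: few_jumps_def indicator_def\<close>)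
      then show ?case by (rule Lim_transform_eventually[OF tendsto_const])
    qed
    show "AE \<omega> in M. norm (indicator (A \<inter> few_jumps K t) \<omega> * at_time F t \<omega>) \<le> C" for K
      by (rule AE_I2) (use C(1) C(2)[OF _ st'(2) order_refl] in \<open>simp add: indicator_def\<close>)
    show "(\<lambda>\<omega>. indicator A \<omega> * at_time F t \<omega>) \<in> borel_measurable M"
      by (intro borel_measurable_times borel_measurable_indicator AM Fm st')
    show "(\<lambda>\<omega>. indicator (A \<inter> few_jumps K t) \<omega> * at_time F t \<omega>) \<in> borel_measurable M" for K
      by (intro borel_measurable_times borel_measurable_indicator sets.Int AM fm Fm st')
  qed simp
  have "(\<integral>\<omega>. indicator (A \<inter> few_jumps K t) \<omega> * at_time F t \<omega> \<partial>M) \<le> (\<integral>\<omega>. indicator A \<omega> * at_time F s \<omega> \<partial>M)" for K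
  proof -
    have "(\<integral>\<omega>. indicator (A \<inter> few_jumps K s) \<omega> * at_time F s \<omega> \<partial>M) \<le> (\<integral>\<omega>. indicator A \<omega> * at_time F s \<omega> \<partial>M)"
    proof (rule integral_mono')
      show "integrable M (\<lambda>\<omega>. indicator A \<omega> * at_time F s \<omega>)"
      proof (rule integrable_const_bound[where B = C])
        show "AE \<omega> in M. norm (indicator A \<omega> * at_time F s \<omega>) \<le> C"
          by (rule AE_I2) (use C(1) C(2)[OF _ st] in \<open>simp add: indicator_def\<close>)
      qed (intro borel_measurable_times borel_measurable_indicator AM Fm st)
      fix \<omega> assume "\<omega> \<in> space M"
      then show "indicator (A \<inter> few_jumps K s) \<omega> * at_time F s \<omega> \<le> indicator A \<omega> * at_time F s \<omega>"
        "0 \<le> indicator A \<omega> * at_time F s \<omega>"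
        using C(2)[OF _ st, of \<omega>] by (simp_all add: indicator_def)
    qed
    then show ?thesis using killed_supermartingale[OF sup st(1) st'(1) A, of K] by linarith
  qed
  then show ?thesis by (intro tendsto_upperbound[OF lim]) auto
qed simp

end

section \<open>Upcrossings\<close>

text \<open>Only rational times occur, so that finite time grids can witness the
  oscillation.\<close>

abbreviation oscillates :: "real \<Rightarrow> real \<Rightarrow> (real \<Rightarrow> real) \<Rightarrow> bool" where
  "oscillates a b z \<equiv> (\<forall>s. \<exists>t\<in>\<rat>. s < t \<and> z t \<le> a) \<and> (\<forall>s. \<exists>t\<in>\<rat>. s < t \<and> b \<le> z t)"

text \<open>
  At the times in the list, the path makes \<open>m\<close> further passages from \<open>\<le> a\<close> to \<open>\<ge> b\<close>; the
  flag tells whether it is in the midst of one.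
\<close>

primrec upcrosses :: "real \<Rightarrow> real \<Rightarrow> (real \<Rightarrow> real) \<Rightarrow> real list \<Rightarrow> bool \<Rightarrow> nat \<Rightarrow> bool" where
  "upcrosses a b z [] below m \<longleftrightarrow> m = 0"
| "upcrosses a b z (t # ts) below m \<longleftrightarrow> m = 0 \<or>
    (if below then (if b \<le> z t then upcrosses a b z ts False (m - 1) else upcrosses a b z ts True m)
     else (if z t \<le> a then upcrosses a b z ts True m else upcrosses a b z ts False m))"

lemma upcrosses_0: "upcrosses a b z ts below 0"
  by (cases ts) auto

text \<open>The two values of the flag differ by at most one passage. This interlacing is what makes
  the count monotone under prepending a time.\<close>

lemma upcrosses_start:
  "(upcrosses a b z ts False m \<longrightarrow> upcrosses a b z ts True m) \<and>
   (upcrosses a b z ts True (Suc m) \<longrightarrow> upcrosses a b z ts False m)"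
proof (induction ts arbitrary: m)
  case (Cons t ts)
  show ?case
  proof (cases m)
    case (Suc k)
    then show ?thesis using Cons[of k] Cons[of m] by auto
  qed (use Cons[of 0] in auto)
qed simp

text \<open>Refining a grid does not lose passages, so a passage count found on a finite set of
  times persists on every larger grid.\<close>

lemma upcrosses_Cons:
  "upcrosses a b z ts below m \<Longrightarrow> upcrosses a b z (t # ts) below m"
  using upcrosses_start[of a b z ts m] upcrosses_start[of a b z ts "m - 1"]
  by (cases m; cases below) auto

lemma upcrosses_append:
  "upcrosses a b z ts below m \<Longrightarrow> upcrosses a b z (us @ ts) below m"
  by (induction us) (auto intro: upcrosses_Cons simp del: upcrosses.simps)

lemma upcrosses_Suc:
  assumes "z t \<le> a" "b \<le> z u" "upcrosses a b z ts False m"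
  shows "upcrosses a b z (t # us @ u # ts) False (Suc m)"
proof -
  have "upcrosses a b z (us @ u # ts) True (Suc m)"
    by (rule upcrosses_append) (use assms in simp)
  then show ?thesis using assms(1) by simp
qed

lemma sorted_split_two:
  assumes "sorted ts" "t \<in> set ts" "u \<in> set ts" "t < u"
  obtains xs us zs where "ts = xs @ t # us @ u # zs" "sorted zs" "{v \<in> set ts. u < v} \<subseteq> set zs"
proof -
  obtain xs ys where ts: "ts = xs @ t # ys" using assms(2) by (meson split_list)
  have "u \<in> set ys" using assms ts by (auto simp: sorted_append)
  then obtain us zs where ys: "ys = us @ u # zs" by (meson split_list)
  show ?thesis
    by (rule that[of xs us zs]) (use assms(1,4) ts ys in \<open>fastforce simp: sorted_append\<close>)+
qed

text \<open>The witness \<open>P\<close> consists of \<open>m\<close> successive low and high times.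
  Further times in between do no harm, so every sorted grid containing \<open>P\<close> will
  do.\<close>

lemma upcrosses_if_oscillating:
  assumes "a < b" "\<And>s. \<exists>t\<in>S. s < t \<and> z t \<le> a" "\<And>s. \<exists>t\<in>S. s < t \<and> b \<le> z t"
  shows "\<exists>P. finite P \<and> P \<subseteq> S \<inter> {s<..} \<and>
    (\<forall>ts. sorted ts \<longrightarrow> P \<subseteq> set ts \<longrightarrow> upcrosses a b z ts False m)"
proof (induction m arbitrary: s)
  case 0
  show ?case by (rule exI[of _ "{}"]) (simp add: upcrosses_0)
next
  case (Suc m)
  obtain t where t: "t \<in> S" "s < t" "z t \<le> a" using assms(2)[of s] by blast
  obtain u where u: "u \<in> S" "t < u" "b \<le> z u" using assms(3)[of t] by blast
  obtain P where P: "finite P" "P \<subseteq> S \<inter> {u<..}"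
    "\<And>ts. sorted ts \<Longrightarrow> P \<subseteq> set ts \<Longrightarrow> upcrosses a b z ts False m" using Suc[of u] by blast
  show ?case
  proof (intro exI[of _ "insert t (insert u P)"] conjI allI impI)
    fix ts assume ts: "sorted ts" "insert t (insert u P) \<subseteq> set ts"
    obtain xs us zs where eq: "ts = xs @ t # us @ u # zs" "sorted zs" "{v \<in> set ts. u < v} \<subseteq> set zs"
      by (rule sorted_split_two[OF ts(1) _ _ u(2)]) (use ts(2) in auto)
    have "P \<subseteq> set zs" using P(2) ts(2) eq(3) by fastforce
    then have "upcrosses a b z (t # us @ u # zs) False (Suc m)"
      by (intro upcrosses_Suc t(3) u(3) P(3) eq(2))
    then show "upcrosses a b z ts False (Suc m)" unfolding eq(1) by (rule upcrosses_append)
  qed (use P t u in auto)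
qed

text \<open>With the flag set, one passage just means reaching level \<open>b\<close>. So the
  maximal inequality is the first case of Dubins' inequality.\<close>

lemma upcrosses_once: "t \<in> set ts \<Longrightarrow> b \<le> z t \<Longrightarrow> upcrosses a b z ts True 1"
  by (induction ts) (auto simp: upcrosses_0)

section \<open>Probability bounds for limits of events, and finite grids of rational times\<close>

context prob_space
begin

lemma measure_UN_incseq_le:
  assumes "\<And>n. S n \<in> sets M" "incseq S" "\<And>n. measure M (S n) \<le> c"
  shows "measure M (\<Union>n. S n) \<le> c"
proof (rule LIMSEQ_le_const2)
  show "(\<lambda>n. measure M (S n)) \<longlonglongrightarrow> measure M (\<Union>n. S n)"
    by (rule finite_Lim_measure_incseq) (use assms in auto)
qed (use assms in auto)

text \<open>The tail intersections increase in \<open>k\<close>, and each is contained in a single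
  \<open>S k\<close>; no independence is involved.\<close>

lemma measure_liminf_le:
  fixes S :: "nat \<Rightarrow> 'a set"
  assumes "\<And>n. S n \<in> sets M" "\<And>n. measure M (S n) \<le> c"
  shows "measure M (\<Union>k. \<Inter>n\<in>{k..}. S n) \<le> c"
    and "(\<Union>k. \<Inter>n\<in>{k..}. S n) \<in> sets M"
proof -
  have m: "(\<Inter>n\<in>{k..}. S n) \<in> sets M" for k :: nat
    by (rule sets.countable_INT') (use assms in auto)
  then show "(\<Union>k. \<Inter>n\<in>{k..}. S n) \<in> sets M" by (intro sets.countable_UN) auto
  show "measure M (\<Union>k. \<Inter>n\<in>{k..}. S n) \<le> c"
  proof (rule measure_UN_incseq_le[OF m])
    show "incseq (\<lambda>k. \<Inter>n\<in>{k..}. S n)" by (rule incseq_SucI) auto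
    fix k
    have "measure M (\<Inter>n\<in>{k..}. S n) \<le> measure M (S k)"
      by (rule finite_measure_mono) (use assms in auto)
    then show "measure M (\<Inter>n\<in>{k..}. S n) \<le> c" using assms(2)[of k] by linarith
  qed
qed

lemma AE_not_in_all_small:
  assumes "\<And>n. S n \<in> sets M" "\<And>n. measure M (S n) \<le> c n" "c \<longlonglongrightarrow> (0::real)"
  shows "AE \<omega> in M. \<exists>n. \<omega> \<notin> S n"
proof -
  have m: "(\<Inter>n. S n) \<in> sets M" using assms(1) by (intro sets.countable_INT) auto
  have "measure M (\<Inter>n. S n) \<le> c n" for n
  proof -
    have "measure M (\<Inter>n. S n) \<le> measure M (S n)" by (rule finite_measure_mono) (use assms in auto)
    then show ?thesis using assms(2)[of n] by linarith
  qed
  then have "measure M (\<Inter>n. S n) \<le> 0" by (intro LIMSEQ_le_const[OF assms(3)]) auto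
  then have "emeasure M (\<Inter>n. S n) = 0" by (simp add: emeasure_eq_measure measure_le_0_iff)
  then have "AE \<omega> in M. \<omega> \<notin> (\<Inter>n. S n)" using m by (intro AE_not_in null_setsI)
  then show ?thesis by eventually_elim auto
qed

end

text \<open>Sorted finite grids that increase with \<open>n\<close> and exhaust the nonnegative
  rationals.\<close>

definition rational_times :: "nat \<Rightarrow> real list" where
  "rational_times n = sorted_list_of_set (from_nat_into {q \<in> \<rat>. 0 \<le> q} ` {..<n})"

lemma rational_times:
  "sorted (rational_times n)" "t \<in> set (rational_times n) \<Longrightarrow> 0 \<le> t"
  "finite P \<Longrightarrow> P \<subseteq> \<rat> \<inter> {0..} \<Longrightarrow> \<forall>\<^sub>F n in sequentially. P \<subseteq> set (rational_times n)"
proof -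
  let ?Q = "{q \<in> \<rat>. 0 \<le> q} :: real set"
  have Q: "countable ?Q" "?Q \<noteq> {}"
    using countable_subset[OF _ countable_rat, of ?Q] by auto
  have s: "set (rational_times n) = from_nat_into ?Q ` {..<n}" for n
    unfolding rational_times_def by simp
  show "sorted (rational_times n)" by (simp add: rational_times_def)
  show "0 \<le> t" if "t \<in> set (rational_times n)"
    using that from_nat_into[OF Q(2)] unfolding s by auto
  show "\<forall>\<^sub>F n in sequentially. P \<subseteq> set (rational_times n)" if P: "finite P" "P \<subseteq> \<rat> \<inter> {0..}"
  proof -
    have "\<forall>\<^sub>F n in sequentially. q \<in> set (rational_times n)" if q: "q \<in> P" for q
    proof -
      have "q \<in> ?Q" using q P by auto
      then obtain i where i: "from_nat_into ?Q i = q" using from_nat_into_surj[OF Q(1)] by blast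
      show ?thesis using eventually_gt_at_top[of i]
      proof (rule eventually_mono)
        fix n assume "i < n"
        then show "q \<in> set (rational_times n)" unfolding s using i by (intro image_eqI[of _ _ i]) auto
      qed
    qed
    then have "\<forall>\<^sub>F n in sequentially. \<forall>q\<in>P. q \<in> set (rational_times n)"
      by (intro eventually_ball_finite P(1)) blast
    then show ?thesis by (rule eventually_mono) blast
  qed
qed

section \<open>Dubins' inequality, absence of oscillation and the maximal inequality\<close>

context rooted_vrjp
begin

text \<open>Nonnegativity is built in, and the conditional inequality is stated through integrals
  over events known at time \<open>s\<close>, the form in which the time-step argument delivers
  it.\<close>

definition supermartingale :: "(real \<Rightarrow> 'a \<Rightarrow> real) \<Rightarrow> bool" where
  "supermartingale Z \<longleftrightarrow>
    (\<forall>t\<ge>0. Z t \<in> borel_measurable (history M X t) \<and> integrable M (Z t) \<and> (\<forall>\<omega>\<in>space M. 0 \<le> Z t \<omega>)) \<and>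
    (\<forall>s t A. 0 \<le> s \<longrightarrow> s \<le> t \<longrightarrow> A \<in> sets (history M X s) \<longrightarrow>
      (\<integral>\<omega>. indicator A \<omega> * Z t \<omega> \<partial>M) \<le> (\<integral>\<omega>. indicator A \<omega> * Z s \<omega> \<partial>M))"

lemma sets_upcrosses:
  assumes "supermartingale Z" "\<And>t. t \<in> set ts \<Longrightarrow> 0 \<le> t"
  shows "{\<omega> \<in> space M. upcrosses a b (\<lambda>t. Z t \<omega>) ts below m} \<in> sets M"
  using assms(2)
proof (induction ts arbitrary: below m)
  case Nil
  then show ?case by simp
next
  case (Cons t ts)
  have [measurable]: "Z t \<in> borel_measurable M"
    using assms(1) Cons.prems[of t] history_measurable_imp unfolding supermartingale_def by auto
  have [measurable]: "{\<omega> \<in> space M. upcrosses a b (\<lambda>t. Z t \<omega>) ts below m} \<in> sets M" for below m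
    using Cons by simp
  have [measurable]: "Measurable.pred M (\<lambda>\<omega>. upcrosses a b (\<lambda>t. Z t \<omega>) ts below m)" for below m
    unfolding pred_def by measurable
  have eq: "upcrosses a b (\<lambda>t. Z t \<omega>) (t # ts) below m \<longleftrightarrow> m = 0 \<or>
    (below \<and> (b \<le> Z t \<omega> \<and> upcrosses a b (\<lambda>t. Z t \<omega>) ts False (m - 1) \<or>
      \<not> b \<le> Z t \<omega> \<and> upcrosses a b (\<lambda>t. Z t \<omega>) ts True m) \<or>
    \<not> below \<and> (Z t \<omega> \<le> a \<and> upcrosses a b (\<lambda>t. Z t \<omega>) ts True m \<or>
      \<not> Z t \<omega> \<le> a \<and> upcrosses a b (\<lambda>t. Z t \<omega>) ts False m))" for \<omega>
    by auto
  show ?case unfolding eq by measurable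
qed

text \<open>Dubins' inequality.\<close>

lemma upcrosses_prob:
  assumes Z: "supermartingale Z" and ab: "0 \<le> a" "a < b"
    and ts: "sorted ts" "\<And>t. t \<in> set ts \<Longrightarrow> s \<le> t" and s: "0 \<le> s" and A: "A \<in> sets (history M X s)"
  shows "measure M (A \<inter> {\<omega> \<in> space M. upcrosses a b (\<lambda>t. Z t \<omega>) ts False m}) \<le> (a / b) ^ m * measure M A"
    and "measure M (A \<inter> {\<omega> \<in> space M. upcrosses a b (\<lambda>t. Z t \<omega>) ts True (Suc m)})
      \<le> (a / b) ^ m / b * (\<integral>\<omega>. indicator A \<omega> * Z s \<omega> \<partial>M)"
proof -
  let ?U = "\<lambda>ts below m. {\<omega> \<in> space M. upcrosses a b (\<lambda>t. Z t \<omega>) ts below m}"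
  have b: "0 < b" and ab0: "0 \<le> a / b" using ab by auto
  have hM: "B \<in> sets M" if "B \<in> sets (history M X r)" for B r
    using that subalgebra_history unfolding subalgebra_def by blast
  have Zi: "integrable M (\<lambda>\<omega>. indicator B \<omega> * Z r \<omega>)" if "0 \<le> r" "B \<in> sets M" for B r
    using Z that integrable_real_mult_indicator[of B M "Z r"] unfolding supermartingale_def
    by (simp add: mult.commute)
  have Z0: "0 \<le> Z r \<omega>" if "0 \<le> r" "\<omega> \<in> space M" for r \<omega>
    using Z that unfolding supermartingale_def by blast
  \<comment> \<open>The two bounds feed each other along the list. Where the first time finds a
    value at most \<open>a\<close>, the second bound takes over and the integral is at most
    \<open>a\<close> times the measure; where it finds a value at least \<open>b\<close>, the first
    takes over and the measure is at most the integral over \<open>b\<close>. Each full passage thus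
    costs a factor \<open>a / b\<close>.\<close>
  have ind: "measure M (A \<inter> ?U ts False m) \<le> (a / b) ^ m * measure M A \<and>
    measure M (A \<inter> ?U ts True (Suc m)) \<le> (a / b) ^ m / b * (\<integral>\<omega>. indicator A \<omega> * Z s \<omega> \<partial>M)" for m
    using ts s A
  proof (induction ts arbitrary: s A m)
    case Nil
    have "0 \<le> (\<integral>\<omega>. indicator A \<omega> * Z s \<omega> \<partial>M)"
      by (rule integral_nonneg_AE, rule AE_I2) (use Z0 Nil in \<open>auto simp: indicator_def\<close>)
    moreover have "measure M (A \<inter> ?U [] False m) \<le> (a / b) ^ m * measure M A"
      using mult_nonneg_nonneg[OF zero_le_power[OF ab0, of m] measure_nonneg[of M A]]
        sets.Int_space_eq2[OF hM[OF Nil(4)]] by (cases m) auto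
    ultimately show ?case using ab0 b by simp
  next
    case (Cons t ts)
    have st: "s \<le> t" "0 \<le> t" using Cons.prems(2)[of t] Cons.prems(3) by auto
    have srt: "sorted ts" "\<And>r. r \<in> set ts \<Longrightarrow> t \<le> r" "\<And>r. r \<in> set ts \<Longrightarrow> 0 \<le> r"
      using Cons.prems(1) st by auto
    have At: "A \<in> sets (history M X t)" using sets_history_mono[OF st(1)] Cons.prems by blast
    have Zt: "Z t \<in> borel_measurable (history M X t)" using Z st unfolding supermartingale_def by blast
    have pre: "A \<inter> (Z t -` S \<inter> space M) \<in> sets (history M X t)" if "S \<in> sets borel" for S
      using At measurable_sets[OF Zt that] by (simp add: space_history)
    have Us: "?U ts below k \<in> sets M" for below k by (rule sets_upcrosses[OF Z srt(3)])
    have AM: "A \<in> sets M" by (rule hM[OF At])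
    have Asp: "A \<subseteq> space M" by (rule sets.sets_into_space[OF AM])
    have "measure M (A \<inter> ?U (t # ts) False m) \<le> (a / b) ^ m * measure M A"
    proof (cases m)
      case 0
      have "A \<inter> ?U (t # ts) False m = A" using Asp 0 by auto
      then show ?thesis using 0 by simp
    next
      case (Suc k)
      let ?A1 = "A \<inter> (Z t -` {..a} \<inter> space M)" and ?A2 = "A \<inter> (Z t -` {a<..} \<inter> space M)"
      have A12: "?A1 \<in> sets (history M X t)" "?A2 \<in> sets (history M X t)" by (intro pre; simp)+
      have "A \<inter> ?U (t # ts) False m = (?A1 \<inter> ?U ts True (Suc k)) \<union> (?A2 \<inter> ?U ts False m)"
        using Suc by auto
      then have "measure M (A \<inter> ?U (t # ts) False m)
        \<le> measure M (?A1 \<inter> ?U ts True (Suc k)) + measure M (?A2 \<inter> ?U ts False m)"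
        using measure_Un_le[of "?A1 \<inter> ?U ts True (Suc k)" M "?A2 \<inter> ?U ts False m"] A12[THEN hM] Us by auto
      also have "\<dots> \<le> (a / b) ^ k / b * (\<integral>\<omega>. indicator ?A1 \<omega> * Z t \<omega> \<partial>M) + (a / b) ^ m * measure M ?A2"
        by (intro add_mono Cons.IH[OF srt(1,2) st(2) A12(1), THEN conjunct2] Cons.IH[OF srt(1,2) st(2) A12(2), THEN conjunct1])
      also have "(\<integral>\<omega>. indicator ?A1 \<omega> * Z t \<omega> \<partial>M) \<le> (\<integral>\<omega>. a * indicator ?A1 \<omega> \<partial>M)"
      proof (rule integral_mono[OF Zi[OF st(2) hM[OF A12(1)]]])
        show "integrable M (\<lambda>\<omega>. a * indicator ?A1 \<omega>)"
          using hM[OF A12(1)] by (simp add: less_top[symmetric])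
      qed (auto simp: indicator_def)
      also have "(\<integral>\<omega>. a * indicator ?A1 \<omega> \<partial>M) = a * measure M ?A1"
        using sets.Int_space_eq2[OF hM[OF A12(1)]] by simp
      also have "(a / b) ^ k / b * (a * measure M ?A1) + (a / b) ^ m * measure M ?A2
        = (a / b) ^ m * (measure M ?A1 + measure M ?A2)"
        using Suc by (simp add: algebra_simps)
      also have "measure M ?A1 + measure M ?A2 = measure M (?A1 \<union> ?A2)"
        by (rule finite_measure_Union[symmetric]) (use A12[THEN hM] in auto)
      also have "?A1 \<union> ?A2 = A" using Asp by auto
      finally show ?thesis using ab0 b by (simp add: mult_left_mono divide_right_mono)
    qed
    moreover have "measure M (A \<inter> ?U (t # ts) True (Suc m)) \<le> (a / b) ^ m / b * (\<integral>\<omega>. indicator A \<omega> * Z s \<omega> \<partial>M)"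
    proof -
      let ?A1 = "A \<inter> (Z t -` {b..} \<inter> space M)" and ?A2 = "A \<inter> (Z t -` {..<b} \<inter> space M)"
      have A12: "?A1 \<in> sets (history M X t)" "?A2 \<in> sets (history M X t)" by (intro pre; simp)+
      have "A \<inter> ?U (t # ts) True (Suc m) = (?A1 \<inter> ?U ts False m) \<union> (?A2 \<inter> ?U ts True (Suc m))"
        by auto
      then have "measure M (A \<inter> ?U (t # ts) True (Suc m))
        \<le> measure M (?A1 \<inter> ?U ts False m) + measure M (?A2 \<inter> ?U ts True (Suc m))"
        using measure_Un_le[of "?A1 \<inter> ?U ts False m" M "?A2 \<inter> ?U ts True (Suc m)"] A12[THEN hM] Us by auto
      also have "\<dots> \<le> (a / b) ^ m * measure M ?A1 + (a / b) ^ m / b * (\<integral>\<omega>. indicator ?A2 \<omega> * Z t \<omega> \<partial>M)"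
        by (intro add_mono Cons.IH[OF srt(1,2) st(2) A12(1), THEN conjunct1] Cons.IH[OF srt(1,2) st(2) A12(2), THEN conjunct2])
      also have "(a / b) ^ m * measure M ?A1 \<le> (a / b) ^ m / b * (\<integral>\<omega>. indicator ?A1 \<omega> * Z t \<omega> \<partial>M)"
      proof -
        have "b * measure M ?A1 = (\<integral>\<omega>. b * indicator ?A1 \<omega> \<partial>M)"
          using sets.Int_space_eq2[OF hM[OF A12(1)]] by simp
        also have "\<dots> \<le> (\<integral>\<omega>. indicator ?A1 \<omega> * Z t \<omega> \<partial>M)"
        proof (rule integral_mono[OF _ Zi[OF st(2) hM[OF A12(1)]]])
          show "integrable M (\<lambda>\<omega>. b * indicator ?A1 \<omega>)"
            using hM[OF A12(1)] by (simp add: less_top[symmetric])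
        qed (auto simp: indicator_def)
        finally have "(a / b) ^ m / b * (b * measure M ?A1) \<le> (a / b) ^ m / b * (\<integral>\<omega>. indicator ?A1 \<omega> * Z t \<omega> \<partial>M)"
          using ab0 b by (intro mult_left_mono) auto
        then show ?thesis using b by simp
      qed
      also have "(a / b) ^ m / b * (\<integral>\<omega>. indicator ?A1 \<omega> * Z t \<omega> \<partial>M)
          + (a / b) ^ m / b * (\<integral>\<omega>. indicator ?A2 \<omega> * Z t \<omega> \<partial>M)
        = (a / b) ^ m / b * (\<integral>\<omega>. indicator ?A1 \<omega> * Z t \<omega> + indicator ?A2 \<omega> * Z t \<omega> \<partial>M)"
        using Zi[OF st(2)] A12[THEN hM] by (simp add: distrib_left)
      also have "(\<integral>\<omega>. indicator ?A1 \<omega> * Z t \<omega> + indicator ?A2 \<omega> * Z t \<omega> \<partial>M) = (\<integral>\<omega>. indicator A \<omega> * Z t \<omega> \<partial>M)"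
        by (intro Bochner_Integration.integral_cong refl) (auto simp: indicator_def)
      also have "(\<integral>\<omega>. indicator A \<omega> * Z t \<omega> \<partial>M) \<le> (\<integral>\<omega>. indicator A \<omega> * Z s \<omega> \<partial>M)"
        using Z Cons.prems st unfolding supermartingale_def by blast
      finally show ?thesis using ab0 b by (simp add: mult_left_mono divide_right_mono)
    qed
    ultimately show ?case ..
  qed
  show "measure M (A \<inter> ?U ts False m) \<le> (a / b) ^ m * measure M A"
    "measure M (A \<inter> ?U ts True (Suc m)) \<le> (a / b) ^ m / b * (\<integral>\<omega>. indicator A \<omega> * Z s \<omega> \<partial>M)"
    using ind[of m] by blast+
qed

text \<open>An oscillating path makes \<open>m\<close> passages on all sufficiently fine grids, for
  every \<open>m\<close>, while this has probability at most \<open>(a / b) ^ m\<close>. Only this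
  consequence of the convergence theorem is used.\<close>

theorem supermartingale_not_oscillating:
  assumes Z: "supermartingale Z" and ab: "0 \<le> a" "a < b"
  shows "AE \<omega> in M. \<not> oscillates a b (\<lambda>t. Z t \<omega>)"
proof -
  define U where "U m n = {\<omega> \<in> space M. upcrosses a b (\<lambda>t. Z t \<omega>) (rational_times n) False m}" for m n
  have U_sets: "U m n \<in> sets M" for m n
    unfolding U_def by (rule sets_upcrosses[OF Z rational_times(2)])
  have U_le: "measure M (U m n) \<le> (a / b) ^ m" for m n
  proof -
    have "space M \<in> sets (history M X 0)" using sets.top[of "history M X 0"] by (simp add: space_history)
    then have "measure M (space M \<inter> {\<omega> \<in> space M. upcrosses a b (\<lambda>t. Z t \<omega>) (rational_times n) False m})
      \<le> (a / b) ^ m * measure M (space M)"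
      by (intro upcrosses_prob(1)[OF Z ab rational_times(1), where s = 0]) (auto dest: rational_times(2))
    moreover have "space M \<inter> U m n = U m n" by (auto simp: U_def)
    ultimately show ?thesis unfolding U_def[symmetric] by (simp add: prob_space)
  qed
  have "AE \<omega> in M. \<exists>m. \<omega> \<notin> (\<Union>k. \<Inter>n\<in>{k..}. U m n)"
  proof (rule AE_not_in_all_small)
    show "(\<lambda>m. (a / b) ^ m) \<longlonglongrightarrow> 0" using ab by (intro LIMSEQ_power_zero) auto
  qed (use measure_liminf_le[OF U_sets U_le] in auto)
  then show ?thesis using AE_space
  proof eventually_elim
    case (elim \<omega>)
    show ?case
    proof
      assume *: "(\<forall>s. \<exists>t\<in>\<rat>. s < t \<and> Z t \<omega> \<le> a) \<and> (\<forall>s. \<exists>t\<in>\<rat>. s < t \<and> b \<le> Z t \<omega>)"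
      have "\<omega> \<in> (\<Union>k. \<Inter>n\<in>{k..}. U m n)" for m
      proof -
        obtain P where P: "finite P" "P \<subseteq> \<rat> \<inter> {0<..}"
          "\<And>ts. sorted ts \<Longrightarrow> P \<subseteq> set ts \<Longrightarrow> upcrosses a b (\<lambda>t. Z t \<omega>) ts False m"
          using upcrosses_if_oscillating[of a b \<rat> "\<lambda>t. Z t \<omega>" 0 m] ab(2) * by blast
        have "P \<subseteq> \<rat> \<inter> {0..}" using P(2) by auto
        from rational_times(3)[OF P(1) this] obtain k where "\<And>n. n \<ge> k \<Longrightarrow> P \<subseteq> set (rational_times n)"
          unfolding eventually_sequentially by blast
        then have "\<omega> \<in> U m n" if "n \<ge> k" for n
          using P(3)[OF rational_times(1)] elim(2) that by (simp add: U_def)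
        then show ?thesis by auto
      qed
      then show False using elim(1) by blast
    qed
  qed
qed

text \<open>Restarting at a fixed time \<open>s\<close>, on an event known by then, does the work of
  optional stopping.\<close>

theorem supermartingale_maximal:
  assumes Z: "supermartingale Z" and b: "0 < b" and s: "0 \<le> s" and A: "A \<in> sets (history M X s)"
  shows "{\<omega> \<in> A. \<exists>t\<in>\<rat>. s \<le> t \<and> b \<le> Z t \<omega>} \<in> sets M"
    and "measure M {\<omega> \<in> A. \<exists>t\<in>\<rat>. s \<le> t \<and> b \<le> Z t \<omega>} \<le> (\<integral>\<omega>. indicator A \<omega> * Z s \<omega> \<partial>M) / b"
proof -
  let ?ts = "\<lambda>n. filter ((\<le>) s) (rational_times n)"
  define S where "S n = (\<Union>t\<in>set (?ts n) \<inter> \<rat>. A \<inter> {\<omega> \<in> space M. b \<le> Z t \<omega>})" for n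
  have AM: "A \<in> sets M" using A subalgebra_history unfolding subalgebra_def by blast
  have S_sets: "S n \<in> sets M" for n
    unfolding S_def
  proof (intro sets.finite_UN sets.Int AM)
    fix t assume "t \<in> set (?ts n) \<inter> \<rat>"
    then have "Z t \<in> borel_measurable M"
      using Z rational_times(2)[of t n] history_measurable_imp unfolding supermartingale_def by auto
    then show "{\<omega> \<in> space M. b \<le> Z t \<omega>} \<in> sets M" by measurable
  qed auto
  have incs: "set (rational_times n) \<subseteq> set (rational_times (Suc n))" for n
    by (auto simp: rational_times_def)
  have eq: "{\<omega> \<in> A. \<exists>t\<in>\<rat>. s \<le> t \<and> b \<le> Z t \<omega>} = (\<Union>n. S n)"
  proof (rule set_eqI)
    fix \<omega>
    show "\<omega> \<in> {\<omega> \<in> A. \<exists>t\<in>\<rat>. s \<le> t \<and> b \<le> Z t \<omega>} \<longleftrightarrow> \<omega> \<in> (\<Union>n. S n)"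
    proof
      assume "\<omega> \<in> {\<omega> \<in> A. \<exists>t\<in>\<rat>. s \<le> t \<and> b \<le> Z t \<omega>}"
      then obtain t where t: "\<omega> \<in> A" "t \<in> \<rat>" "s \<le> t" "b \<le> Z t \<omega>" by auto
      have "\<forall>\<^sub>F n in sequentially. {t} \<subseteq> set (rational_times n)"
        using t s by (intro rational_times(3)) auto
      then obtain n where "t \<in> set (rational_times n)" unfolding eventually_sequentially by auto
      then have "\<omega> \<in> S n" unfolding S_def using t sets.sets_into_space[OF AM] by auto
      then show "\<omega> \<in> (\<Union>n. S n)" by blast
    qed (auto simp: S_def)
  qed
  show "{\<omega> \<in> A. \<exists>t\<in>\<rat>. s \<le> t \<and> b \<le> Z t \<omega>} \<in> sets M" unfolding eq using S_sets by auto
  show "measure M {\<omega> \<in> A. \<exists>t\<in>\<rat>. s \<le> t \<and> b \<le> Z t \<omega>} \<le> (\<integral>\<omega>. indicator A \<omega> * Z s \<omega> \<partial>M) / b"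
    unfolding eq
  proof (rule measure_UN_incseq_le[OF S_sets])
    show "incseq S" by (rule incseq_SucI) (use incs in \<open>fastforce simp: S_def\<close>)
    fix n
    have r: "0 \<le> t" if "t \<in> set (?ts n)" for t using that s by auto
    have "measure M (S n) \<le> measure M (A \<inter> {\<omega> \<in> space M. upcrosses 0 b (\<lambda>t. Z t \<omega>) (?ts n) True (Suc 0)})"
    proof (rule finite_measure_mono)
      show "S n \<subseteq> A \<inter> {\<omega> \<in> space M. upcrosses 0 b (\<lambda>t. Z t \<omega>) (?ts n) True (Suc 0)}"
        unfolding S_def using upcrosses_once[of _ "?ts n" b "\<lambda>t. Z t _" 0] by fastforce
    qed (intro sets.Int AM sets_upcrosses[OF Z r])
    \<comment> \<open>Level \<open>a = 0\<close> and no earlier passage: \<open>(0 / b) ^ 0\<close>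
      is 1.\<close>
    also have "\<dots> \<le> (0 / b) ^ 0 / b * (\<integral>\<omega>. indicator A \<omega> * Z s \<omega> \<partial>M)"
      by (rule upcrosses_prob(2)[OF Z order_refl b _ _ s A]) (auto intro: sorted_wrt_filter simp: rational_times(1))
    finally show "measure M (S n) \<le> (\<integral>\<omega>. indicator A \<omega> * Z s \<omega> \<partial>M) / b" by simp
  qed
qed

lemma supersolution_imp_supermartingale:
  assumes "supersolution V adj F D J"
  shows "supermartingale (at_time F)"
  unfolding supermartingale_def
proof (intro conjI allI impI ballI)
  fix t :: real assume t: "0 \<le> t"
  show m: "at_time F t \<in> borel_measurable (history M X t)"
    by (rule measurable_at_time[OF t]) (use assms in \<open>simp add: supersolution_def\<close>)
  obtain C where C: "0 \<le> C"
    "\<And>\<omega> r. \<omega> \<in> space M \<Longrightarrow> 0 \<le> r \<Longrightarrow> r \<le> t \<Longrightarrow> 0 \<le> at_time F r \<omega> \<and> at_time F r \<omega> \<le> C"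
    by (rule supersolution_bounds[OF assms t]) (rule that; assumption)
  show "0 \<le> at_time F t \<omega>" if "\<omega> \<in> space M" for \<omega> using C(2)[OF that t] by simp
  show "integrable M (at_time F t)"
    by (rule integrable_const_bound[where B = C, OF AE_I2 history_measurable_imp[OF m]])
      (use C(2)[OF _ t order_refl] in simp)
qed (rule supersolution_supermartingale[OF assms]; assumption)

end

text \<open>The subtree of \<open>y\<close> is the set of lists with suffix \<open>y\<close>; a step
  prepends or drops one entry, so the subtree can be entered only along the edge from
  \<open>tl y\<close> to \<open>y\<close>.\<close>

lemma suffix_tree_step:
  assumes "tree_adj b x z" "suffix y z" "\<not> suffix y x"
  shows "z = y" "x = tl y"
proof -
  obtain i where "z = i # x \<or> x = i # z" using assms(1) by (auto simp: tree_adj_def)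
  then show "z = y" "x = tl y" using assms(2,3) by (auto simp: suffix_Cons)
qed

lemma suffix_tree_step':
  assumes "tree_adj b x z" "suffix y x" "\<not> suffix y z"
  shows "x = y" "z = tl y"
  using suffix_tree_step[of b z x y] assms by (auto simp: tree_adj_def)

lemma tree_adj_tl: "y \<in> tree_vertices b \<Longrightarrow> y \<noteq> [] \<Longrightarrow> tree_adj b (tl y) y \<and> tree_adj b y (tl y)"
  by (cases y) (auto simp: tree_adj_def tree_vertices_def)

lemma not_suffix_tl: "y \<noteq> [] \<Longrightarrow> \<not> suffix y (tl y)"
  using suffix_length_le[of y "tl y"] by (cases y) auto

lemma not_Cons_tl: "i # x \<noteq> tl x"
proof
  assume "i # x = tl x"
  then have "length (i # x) = length (tl x)" by simp
  then show False by simp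
qed

lemma finite_tree_neighbours: "finite {z. tree_adj b x z}"
  by (cases "x \<in> tree_vertices b") (auto simp: tree_degree, simp add: tree_adj_def)

section \<open>The ratio of the local times at the ends of an edge\<close>

definition ratio_fn :: "nat list \<Rightarrow> nat list \<Rightarrow> (nat list \<Rightarrow> real) \<Rightarrow> real" where
  "ratio_fn y x L = (if suffix y x then 0 else 1 / (L y)\<^sup>2) + L (tl y) / L y"

text \<open>The balance is exact. At \<open>tl y\<close> the ratio grows at rate
  \<open>1 / L y\<close>, while jumps to \<open>y\<close> have rate \<open>L y\<close> and lose
  \<open>1 / (L y)\<^sup>2\<close>. At \<open>y\<close> the ratio falls at rate
  \<open>L (tl y) / (L y)\<^sup>2\<close>, while jumps to \<open>tl y\<close> have rate
  \<open>L (tl y)\<close> and gain \<open>1 / (L y)\<^sup>2\<close>. Elsewhere neither local time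
  moves.\<close>

lemma supersolution_ratio_fn:
  assumes y: "y \<in> tree_vertices b" "y \<noteq> []"
  shows "supersolution (tree_vertices b) (tree_adj b) (ratio_fn y)
    (\<lambda>x L. if x = y then - (L (tl y) / (L y)\<^sup>2) else if x = tl y then 1 / L y else 0)
    (\<lambda>x z L. if x = tl y \<and> z = y then - (1 / (L y)\<^sup>2) else if x = y \<and> z = tl y then 1 / (L y)\<^sup>2 else 0)"
    (is "supersolution _ _ _ ?D ?J")
  unfolding supersolution_def
proof (intro conjI allI impI ballI)
  have ne: "tl y \<noteq> y" "y \<noteq> tl y" using y(2) by (cases y; simp)+
  fix x z :: "nat list"
  have [measurable]: "(\<lambda>L. L v) \<in> borel_measurable (state_space :: (nat list \<Rightarrow> real) measure)" for v
    by (rule measurable_component_singleton) simp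
  show "ratio_fn y x \<in> borel_measurable state_space" unfolding ratio_fn_def by measurable
  show "?D x \<in> borel_measurable state_space" by measurable
  show "?J x z \<in> borel_measurable state_space" by measurable
next
  have ne: "tl y \<noteq> y" "y \<noteq> tl y" using y(2) by (cases y; simp)+
  fix x and L :: "nat list \<Rightarrow> real" assume x: "x \<in> tree_vertices b" and L: "\<forall>v. 1 \<le> L v"
  have Ly: "1 \<le> L y" using L by blast
  have sum: "(\<Sum>z | tree_adj b x z. L z * (if z = w then c else 0)) = (if tree_adj b x w then L w * c else 0)" for w c
    using finite_tree_neighbours[of b x] by (simp add: if_distrib[of "\<lambda>r. _ * r"] sum.delta cong: if_cong)
  consider "x = y" | "x = tl y" | "x \<noteq> y" "x \<noteq> tl y" by blast
  then show "?D x L + (\<Sum>z | tree_adj b x z. L z * ?J x z L) \<le> 0"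
  proof cases
    case 1
    then show ?thesis using ne sum[of "tl y" "1 / (L y)\<^sup>2"] tree_adj_tl[OF y] by simp
  next
    case 2
    have "?J x z L = (if z = y then - (1 / (L y)\<^sup>2) else 0)" for z using 2 ne by simp
    then show ?thesis using 2 ne sum[of y "- (1 / (L y)\<^sup>2)"] tree_adj_tl[OF y] Ly
      by (simp add: power2_eq_square)
  qed simp
next
  have ne: "tl y \<noteq> y" "y \<noteq> tl y" using y(2) by (cases y; simp)+
  have nsuf: "\<not> suffix y (tl y)" by (rule not_suffix_tl[OF y(2)])
  fix T :: real assume T: "0 \<le> T"
  show "\<exists>C\<ge>0. \<forall>x\<in>tree_vertices b. \<forall>L. (\<forall>v. 1 \<le> L v \<and> L v \<le> 1 + T) \<longrightarrow>
      0 \<le> ratio_fn y x L \<and> ratio_fn y x L \<le> C \<and> \<bar>?D x L\<bar> \<le> C \<and> (\<forall>z. tree_adj b x z \<longrightarrow> \<bar>?J x z L\<bar> \<le> C) \<and>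
      (\<forall>h\<in>{0..1}. ratio_fn y x (L(x := L x + h)) \<le> ratio_fn y x L + h * ?D x L + C * h\<^sup>2) \<and>
      (\<forall>z u w. tree_adj b x z \<longrightarrow> 0 \<le> u \<longrightarrow> 0 \<le> w \<longrightarrow> u + w \<le> 1 \<longrightarrow>
        ratio_fn y z (L(x := L x + u, z := L z + w)) \<le> ratio_fn y x L + ?J x z L + C * (u + w))"
  \<comment> \<open>The ratio is at most \<open>1 + T\<close> and the crossing term at most
    1.\<close>
  proof (intro exI[of _ "2 + T"] conjI ballI allI impI)
    show "0 \<le> 2 + T" using T by simp
    fix x :: "nat list" and L :: "nat list \<Rightarrow> real"
    assume bd: "\<forall>v. 1 \<le> L v \<and> L v \<le> 1 + T"
    have Ly: "1 \<le> L y" and Lp: "1 \<le> L (tl y)" "L (tl y) \<le> 1 + T" using bd by blast+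
    have sq: "1 \<le> (L y)\<^sup>2" using Ly by simp
    have inv: "0 \<le> 1 / (L y)\<^sup>2" "1 / (L y)\<^sup>2 \<le> 1" using sq by (auto simp: divide_le_eq)
    have quot: "0 \<le> L (tl y) / L y" "L (tl y) / L y \<le> 1 + T"
      using Ly Lp by (auto simp: divide_le_eq intro: order_trans[OF Lp(2)] mult_left_mono[of 1 "L y" "1 + T", simplified])
    have quot2: "0 \<le> L (tl y) / (L y)\<^sup>2" "L (tl y) / (L y)\<^sup>2 \<le> 1 + T"
    proof -
      show "0 \<le> L (tl y) / (L y)\<^sup>2" using Lp by simp
      have "1 + T \<le> (1 + T) * (L y)\<^sup>2" using mult_left_mono[OF sq, of "1 + T"] T by simp
      with Lp(2) have "L (tl y) \<le> (1 + T) * (L y)\<^sup>2" by (rule order_trans)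
      then show "L (tl y) / (L y)\<^sup>2 \<le> 1 + T" using Ly by (simp add: divide_le_eq)
    qed
    show "0 \<le> ratio_fn y x L" "ratio_fn y x L \<le> 2 + T" using inv quot T by (auto simp: ratio_fn_def)
    have "0 \<le> 1 / L y" "1 / L y \<le> 1" using Ly by auto
    then show "\<bar>?D x L\<bar> \<le> 2 + T" using quot2 T by (auto simp del: divide_le_eq_1)
    show "\<bar>?J x z L\<bar> \<le> 2 + T" for z using inv T by auto
    show "ratio_fn y x (L(x := L x + h)) \<le> ratio_fn y x L + h * ?D x L + (2 + T) * h\<^sup>2" if h: "h \<in> {0..1}" for h
    proof -
      consider "x = y" | "x = tl y" | "x \<noteq> y" "x \<noteq> tl y" by blast
      then show ?thesis
      proof cases
        case 1
        have "L (tl y) / (L y + h) \<le> L (tl y) / L y - h * (L (tl y) / (L y)\<^sup>2) + (2 + T) * h\<^sup>2"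
        proof -
          let ?a = "L y" and ?c = "L (tl y)"
          \<comment> \<open>In the scaled increment,
            \<open>(1 - r + r\<^sup>2) * (1 + r) = 1 + r ^ 3\<close> yields the second-order upper
            bound for \<open>1 / (1 + r)\<close>; its quadratic term is the permitted error.\<close>
          define r where "r = h / ?a"
          have r: "0 \<le> r" "r \<le> h" using Ly h by (auto simp: r_def divide_le_eq mult_le_cancel_left1)
          have "(1 - r + r\<^sup>2) * (1 + r) = 1 + r ^ 3" by (simp add: algebra_simps power2_eq_square power3_eq_cube)
          then have "1 / (1 + r) \<le> 1 - r + r\<^sup>2" using r by (simp add: pos_divide_le_eq)
          then have "?c / ?a * (1 / (1 + r)) \<le> ?c / ?a * (1 - r + r\<^sup>2)"
            using Ly Lp by (intro mult_left_mono) auto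
          moreover have "?c / (?a + h) = ?c / ?a * (1 / (1 + r))"
          proof -
            have "?a + h = ?a * (1 + r)" using Ly by (simp add: r_def field_simps)
            then show ?thesis by simp
          qed
          moreover have "?c / ?a * (1 - r + r\<^sup>2) = ?c / ?a - h * (?c / ?a\<^sup>2) + ?c / ?a * r\<^sup>2"
            by (simp add: r_def algebra_simps power2_eq_square)
          moreover have "?c / ?a * r\<^sup>2 \<le> (2 + T) * h\<^sup>2"
            using quot r T by (intro mult_mono power_mono) auto
          ultimately show ?thesis by linarith
        qed
        then show ?thesis using 1 ne by (simp add: ratio_fn_def)
      next
        case 2
        then show ?thesis using ne nsuf T by (simp add: ratio_fn_def add_divide_distrib)
      next
        case 3
        then show ?thesis using T by (simp add: ratio_fn_def)
      qed
    qed
    show "ratio_fn y z (L(x := L x + u, z := L z + w)) \<le> ratio_fn y x L + ?J x z L + (2 + T) * (u + w)"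
      if adj: "tree_adj b x z" and uw: "0 \<le> u" "0 \<le> w" "u + w \<le> 1" for z u w
    proof -
      define L' where "L' = L(x := L x + u, z := L z + w)"
      have xz: "x \<noteq> z" using adj by (auto simp: tree_adj_def)
      have L'y: "L y \<le> L' y" using uw xz by (auto simp: L'_def)
      have L'p: "L' (tl y) \<le> L (tl y) + (u + w)" "0 \<le> L' (tl y)" using uw xz bd[rule_format, of "tl y"] by (auto simp: L'_def)
      have "L' (tl y) / L' y \<le> (L (tl y) + (u + w)) / L y"
        using L'p L'y Ly uw Lp by (intro frac_le) auto
      also have "\<dots> \<le> L (tl y) / L y + (2 + T) * (u + w)"
      proof -
        have "(u + w) / L y \<le> (u + w) / 1" using Ly uw by (intro divide_left_mono) auto
        also have "\<dots> \<le> (2 + T) * (u + w)" using T uw mult_right_mono[of 1 "2 + T" "u + w"] by simp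
        finally show ?thesis by (simp add: add_divide_distrib)
      qed
      finally have q: "L' (tl y) / L' y \<le> L (tl y) / L y + (2 + T) * (u + w)" .
      have sq': "1 / (L' y)\<^sup>2 \<le> 1 / (L y)\<^sup>2"
        using L'y Ly by (intro divide_left_mono power_mono) auto
      \<comment> \<open>The crossing term changes sides only along the edge between
        \<open>tl y\<close> and \<open>y\<close>; on every other step it can only shrink, since
        local times grow.\<close>
      have "(if suffix y z then 0 else 1 / (L' y)\<^sup>2) \<le> (if suffix y x then 0 else 1 / (L y)\<^sup>2) + ?J x z L"
      proof (cases "suffix y z \<longleftrightarrow> suffix y x")
        case True
        then have "\<not> (x = tl y \<and> z = y)" "\<not> (x = y \<and> z = tl y)" using nsuf by auto
        then have "?J x z L = 0" by auto
        then show ?thesis using True sq' by auto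
      next
        case False
        then show ?thesis
        proof (cases "suffix y z")
          case True
          then have "z = y" "x = tl y" using False suffix_tree_step[OF adj] by blast+
          then show ?thesis using nsuf by simp
        next
          case False2: False
          then have "x = y" "z = tl y" using False suffix_tree_step'[OF adj] by blast+
          then show ?thesis using nsuf sq' ne by simp
        qed
      qed
      then show ?thesis using q unfolding ratio_fn_def L'_def[symmetric] by linarith
    qed
  qed
qed

section \<open>Escape into fresh subtrees\<close>

text \<open>
  The whole subtree of \<open>z\<close> is required to be unvisited, so that the children of a fresh
  vertex are fresh in every state \<open>(x, L)\<close>, reachable or not.
\<close>

definition fresh :: "nat list \<Rightarrow> nat list \<Rightarrow> (nat list \<Rightarrow> real) \<Rightarrow> bool" where
  "fresh z x L \<longleftrightarrow> \<not> suffix z x \<and> (\<forall>v. suffix z v \<longrightarrow> L v = 1)"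

definition fresh_children :: "nat list \<Rightarrow> nat list \<Rightarrow> (nat list \<Rightarrow> real) \<Rightarrow> real" where
  "fresh_children u x L = (\<Sum>i<3. of_bool (fresh (i # u) x L))"

text \<open>The denominator is \<open>3 * (m + 3 / 2)\<close> with \<open>m\<close> the local time
  at the parent. At the root, \<open>tl\<close> gives the root itself, but the products below
  contain only vertices other than the root.\<close>

definition return_bound :: "nat list \<Rightarrow> nat list \<Rightarrow> (nat list \<Rightarrow> real) \<Rightarrow> real" where
  "return_bound u x L = 1 - fresh_children u x L * (exp (- L u / 2) / (3 * L (tl u) + 9 / 2))"

definition path_between :: "nat list \<Rightarrow> nat list \<Rightarrow> nat list set" where
  "path_between v x = {u. suffix u x \<and> strict_suffix v u}"

text \<open>To come back from \<open>x\<close> to \<open>v\<close>, the process must step from each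
  vertex of the path, \<open>v\<close> excluded and \<open>x\<close> included, to its parent; hence
  the product. At \<open>v\<close> and outside its subtree the product is empty.\<close>

definition escape_fn :: "nat list \<Rightarrow> nat list \<Rightarrow> (nat list \<Rightarrow> real) \<Rightarrow> real" where
  "escape_fn v x L = (\<Prod>u\<in>path_between v x. return_bound u x L)"

lemma finite_path_between: "finite (path_between v x)"
  by (rule finite_subset[of _ "set (suffixes x)"]) (auto simp: path_between_def)

lemma path_between_empty: "\<not> strict_suffix v x \<Longrightarrow> path_between v x = {}"
  unfolding path_between_def using suffix_order.less_le_trans[of v _ x] by blast

lemma path_between_Cons:
  "strict_suffix v (i # x) \<Longrightarrow> path_between v (i # x) = insert (i # x) (path_between v x)"
  unfolding path_between_def by (auto simp: suffix_Cons)

lemma path_between_length: "u \<in> path_between v x \<Longrightarrow> u \<noteq> [] \<and> length u \<le> length x"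
  unfolding path_between_def by (auto simp: strict_suffix_def dest: suffix_length_le)

lemma fresh_children_bounds: "0 \<le> fresh_children u x L" "fresh_children u x L \<le> 3"
proof -
  show "0 \<le> fresh_children u x L" unfolding fresh_children_def by (intro sum_nonneg) simp
  have "fresh_children u x L \<le> (\<Sum>i<(3::nat). 1)" unfolding fresh_children_def by (intro sum_mono) simp
  then show "fresh_children u x L \<le> 3" by simp
qed

text \<open>The quadratic Taylor polynomial gives \<open>1 + 1 / 2 + 1 / 8 = 13 / 8\<close> as a
  lower bound for \<open>exp (1 / 2)\<close>.\<close>

lemma exp_minus_half: "exp (- 1 / 2 :: real) \<le> 8 / 13"
proof -
  have "13 / 8 \<le> exp (1 / 2 :: real)"
    using exp_lower_Taylor_quadratic[of "1 / 2 :: real"] by (simp add: power2_eq_square)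
  then have "1 / exp (1 / 2 :: real) \<le> 1 / (13 / 8)" by (intro divide_left_mono) auto
  then show ?thesis by (simp add: exp_minus inverse_eq_divide)
qed

text \<open>The worst case is \<open>l = m = 1\<close>, and
  \<open>16 / 195 = (8 / 13) / (15 / 2)\<close>. Three times this stays below 1, so the factors are
  nonnegative; twice this stays below \<open>1 / 6\<close>, which absorbs the quadratic term in the
  supersolution inequality.\<close>

lemma return_weight_bounds:
  fixes l m :: real
  assumes "1 \<le> l" "1 \<le> m"
  shows "0 < exp (- l / 2) / (3 * m + 9 / 2)" "exp (- l / 2) / (3 * m + 9 / 2) \<le> 16 / 195"
proof -
  have "exp (- l / 2) \<le> exp (- 1 / 2)" using assms by simp
  then have "exp (- l / 2) \<le> 8 / 13" using exp_minus_half by linarith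
  then have "exp (- l / 2) / (3 * m + 9 / 2) \<le> (8 / 13) / (15 / 2)" using assms by (intro frac_le) auto
  then show "exp (- l / 2) / (3 * m + 9 / 2) \<le> 16 / 195" by simp
  show "0 < exp (- l / 2) / (3 * m + 9 / 2)" using assms by simp
qed

lemma return_bound_bounds:
  assumes "\<And>v. 1 \<le> L v"
  shows "0 \<le> return_bound u x L" "return_bound u x L \<le> 1"
proof -
  note g = return_weight_bounds[OF assms[of u] assms[of "tl u"]]
  note k = fresh_children_bounds[of u x L]
  have "fresh_children u x L * (exp (- L u / 2) / (3 * L (tl u) + 9 / 2)) \<le> 3 * (16 / 195)"
    using g k by (intro mult_mono) auto
  then show "0 \<le> return_bound u x L" unfolding return_bound_def by linarith
  have "0 \<le> fresh_children u x L * (exp (- L u / 2) / (3 * L (tl u) + 9 / 2))"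
    using g(1) k by (intro mult_nonneg_nonneg) auto
  then show "return_bound u x L \<le> 1" unfolding return_bound_def by linarith
qed

lemma prod_return_bound:
  assumes "\<And>v. 1 \<le> L v"
  shows "0 \<le> (\<Prod>u\<in>S. return_bound u x L)" "(\<Prod>u\<in>S. return_bound u x L) \<le> 1"
  using return_bound_bounds[OF assms] by (auto intro!: prod_nonneg prod_le_1)

lemma escape_fn_bounds:
  assumes "\<And>v. 1 \<le> L v"
  shows "0 \<le> escape_fn v x L" "escape_fn v x L \<le> 1"
  unfolding escape_fn_def using prod_return_bound[OF assms] by auto

text \<open>The factors of the ancestors are at most 1, so right after a vertex has been discovered
  its own factor alone keeps the product away from 1.\<close>

lemma escape_fn_le_return_bound:
  assumes "\<And>v. 1 \<le> L v" "strict_suffix v x"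
  shows "escape_fn v x L \<le> return_bound x x L"
proof -
  obtain i x' where x: "x = i # x'" using assms(2) by (cases x) auto
  have n: "i # x' \<notin> path_between v x'" using path_between_length by fastforce
  have "escape_fn v x L = return_bound x x L * (\<Prod>u\<in>path_between v x'. return_bound u x L)"
    using assms(2) n finite_path_between unfolding escape_fn_def x by (simp add: path_between_Cons)
  also have "\<dots> \<le> return_bound x x L * 1"
    by (intro mult_left_mono prod_return_bound return_bound_bounds assms)
  finally show ?thesis by simp
qed

lemma exp_decrease: "exp (- l / 2) * (1 - h / 2) \<le> exp (- (l + h) / 2)" for l h :: real
proof -
  have "exp (- (l + h) / 2) = exp (- l / 2) * exp (- h / 2)"
    by (simp add: exp_add[symmetric] field_simps)
  moreover have "1 - h / 2 \<le> exp (- h / 2)" using exp_ge_add_one_self[of "- h / 2"] by simp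
  ultimately show ?thesis by (simp add: mult_left_mono)
qed

text \<open>The tangent line bounds the exponential from below, so time spent at \<open>u\<close>
  enlarges its factor at most linearly. Allowing \<open>k\<close> to be any lower bound for the new
  number of fresh children covers waiting and jumping at once.\<close>

lemma return_bound_increase:
  assumes L: "\<And>v. 1 \<le> L v" and h: "0 \<le> h"
    and L': "L' u = L u + h" "L' (tl u) = L (tl u)"
    and k: "k \<le> fresh_children u x' L'" "0 \<le> k"
  shows "return_bound u x' L' \<le> 1 - k * (exp (- L u / 2) / (3 * L (tl u) + 9 / 2)) * (1 - h / 2)"
proof -
  define D where "D = 3 * L (tl u) + 9 / 2"
  have D: "0 < D" using L[of "tl u"] by (simp add: D_def)
  have "k * (exp (- L u / 2) / D) * (1 - h / 2) = k * ((exp (- L u / 2) * (1 - h / 2)) / D)" by simp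
  also have "\<dots> \<le> k * (exp (- (L u + h) / 2) / D)"
    using k D by (intro mult_left_mono divide_right_mono exp_decrease) auto
  also have "\<dots> \<le> fresh_children u x' L' * (exp (- (L u + h) / 2) / D)"
    using k D by (intro mult_right_mono) auto
  finally show ?thesis unfolding return_bound_def L' D_def by simp
qed

text \<open>The subtree of \<open>y\<close> can be entered only at \<open>y\<close> itself, so after
  a step elsewhere both vertices whose local time may have changed lie outside it.\<close>

lemma fresh_step:
  assumes "tree_adj b x z" "z \<noteq> y" "fresh y x L" "\<And>v. v \<noteq> x \<Longrightarrow> v \<noteq> z \<Longrightarrow> L' v = L v"
  shows "fresh y z L'"
proof -
  have z: "\<not> suffix y z" using suffix_tree_step(1)[OF assms(1)] assms(2,3) by (auto simp: fresh_def)
  have "L' v = 1" if "suffix y v" for v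
  proof -
    have "v \<noteq> x" "v \<noteq> z" using that z assms(3) by (auto simp: fresh_def)
    then show ?thesis using assms(3,4) that by (simp add: fresh_def)
  qed
  then show ?thesis using z by (simp add: fresh_def)
qed

text \<open>Freshness of a child of \<open>u\<close> is lost only by entering it. If
  \<open>z\<close> is a child of \<open>u\<close>, the second assumption places \<open>x\<close> in
  the subtree of \<open>z\<close>, so that \<open>z\<close> was not fresh before.\<close>

lemma fresh_children_step:
  assumes "tree_adj b x z" "\<And>i. z = i # u \<Longrightarrow> suffix z x" "\<And>v. v \<noteq> x \<Longrightarrow> v \<noteq> z \<Longrightarrow> L' v = L v"
  shows "fresh_children u x L \<le> fresh_children u z L'"
  unfolding fresh_children_def
proof (rule sum_mono)
  fix i :: nat
  have "fresh (i # u) z L'" if "fresh (i # u) x L"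
    using fresh_step[OF assms(1) _ that assms(3)] assms(2)[of i] that by (auto simp: fresh_def)
  then show "(of_bool (fresh (i # u) x L) :: real) \<le> of_bool (fresh (i # u) z L')" by simp
qed

lemma fresh_children_step_child:
  assumes "tree_adj 3 x (j # x)" "\<And>v. v \<noteq> x \<Longrightarrow> v \<noteq> j # x \<Longrightarrow> L' v = L v"
  shows "fresh_children x x L - of_bool (fresh (j # x) x L) \<le> fresh_children x (j # x) L'"
proof -
  have j: "j \<in> {..<3}" using assms(1) by (auto simp: tree_adj_def tree_vertices_def)
  have "fresh_children x x L - of_bool (fresh (j # x) x L) = (\<Sum>i\<in>{..<3} - {j}. of_bool (fresh (i # x) x L))"
    unfolding fresh_children_def using j by (subst sum.remove[of _ j]) auto
  also have "\<dots> \<le> (\<Sum>i\<in>{..<3} - {j}. of_bool (fresh (i # x) (j # x) L'))"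
    by (intro sum_mono) (use fresh_step[OF assms(1) _ _ assms(2)] in auto)
  also have "\<dots> \<le> fresh_children x (j # x) L'"
    unfolding fresh_children_def by (intro sum_mono2) auto
  finally show ?thesis .
qed

lemma fresh_children_of_fresh:
  assumes "fresh z x L" "tree_adj b x z" "\<And>v. v \<noteq> x \<Longrightarrow> v \<noteq> z \<Longrightarrow> L' v = L v"
  shows "fresh_children z z L' = 3"
proof -
  have "fresh (i # z) z L'" for i
  proof -
    have "L' v = 1" if v: "suffix (i # z) v" for v
    proof -
      have zv: "suffix z v" using v by (rule suffix_ConsD)
      have "length z < length v" using suffix_length_le[OF v] by simp
      then have "v \<noteq> x" "v \<noteq> z" using zv assms(1) by (auto simp: fresh_def)
      then show ?thesis using assms(1,3) zv by (simp add: fresh_def)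
    qed
    then show ?thesis using suffix_length_le[of "i # z" z] by (auto simp: fresh_def)
  qed
  then show ?thesis by (simp add: fresh_children_def)
qed

section \<open>Drift and jumps of the escape function\<close>

definition path_weight :: "nat list \<Rightarrow> nat list \<Rightarrow> (nat list \<Rightarrow> real) \<Rightarrow> real" where
  "path_weight v x L = (\<Prod>u\<in>path_between v (tl x). return_bound u x L)"

definition escape_weight :: "nat list \<Rightarrow> (nat list \<Rightarrow> real) \<Rightarrow> real" where
  "escape_weight x L = exp (- L x / 2) / (3 * L (tl x) + 9 / 2)"

text \<open>One minus the factor that a fresh child of \<open>x\<close> contributes on entry: its
  local time is 1, its parent is \<open>x\<close>, and its own three children are fresh.\<close>

definition entry_weight :: "nat list \<Rightarrow> (nat list \<Rightarrow> real) \<Rightarrow> real" where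
  "entry_weight x L = 3 * (exp (- 1 / 2) / (3 * L x + 9 / 2))"

definition escape_drift :: "nat list \<Rightarrow> nat list \<Rightarrow> (nat list \<Rightarrow> real) \<Rightarrow> real" where
  "escape_drift v x L = (if strict_suffix v x
    then path_weight v x L * (fresh_children x x L * escape_weight x L / 2) else 0)"

text \<open>A step to the parent removes the factor of \<open>x\<close>. A step to a fresh child
  uses up one fresh child of \<open>x\<close> and adds the factor of that child. For a child already
  explored 0 is an upper bound, since its new factor is at most 1; where the product is empty it
  already has its maximal value 1.\<close>

definition escape_jump :: "nat list \<Rightarrow> nat list \<Rightarrow> nat list \<Rightarrow> (nat list \<Rightarrow> real) \<Rightarrow> real" where
  "escape_jump v x z L = (if \<not> strict_suffix v x then 0
    else if z = tl x then path_weight v x L * (fresh_children x x L * escape_weight x L)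
    else if fresh z x L then path_weight v x L *
      ((1 - (fresh_children x x L - 1) * escape_weight x L) * (1 - entry_weight x L)
        - (1 - fresh_children x x L * escape_weight x L))
    else 0)"

lemma path_weight_bounds:
  "(\<And>v. 1 \<le> L v) \<Longrightarrow> 0 \<le> path_weight v x L \<and> path_weight v x L \<le> 1"
  unfolding path_weight_def using prod_return_bound by auto

lemma escape_fn_strict:
  assumes "strict_suffix v x"
  shows "escape_fn v x L = (1 - fresh_children x x L * escape_weight x L) * path_weight v x L"
proof -
  obtain i x' where x: "x = i # x'" using assms by (cases x) auto
  have n: "i # x' \<notin> path_between v x'" using path_between_length by fastforce
  show ?thesis
    using assms n finite_path_between unfolding escape_fn_def x path_weight_def escape_weight_def
    by (simp add: path_between_Cons return_bound_def)
qed

lemma escape_fn_not_strict: "\<not> strict_suffix v x \<Longrightarrow> escape_fn v x L = 1"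
  by (simp add: escape_fn_def path_between_empty)

text \<open>No quadratic error appears, because the tangent line of the exponential errs on the
  right side. On the path, the local time at \<open>x\<close> enters only the factor of
  \<open>x\<close>, and waiting at \<open>x\<close> changes no freshness.\<close>

lemma escape_flow:
  assumes L: "\<And>v. 1 \<le> L v" and h: "0 \<le> h"
  shows "escape_fn v x (L(x := L x + h)) \<le> escape_fn v x L + h * escape_drift v x L"
proof (cases "strict_suffix v x")
  case True
  then have xne: "tl x \<noteq> x" "x \<noteq> []" by (cases x; auto)+
  define L' where "L' = L(x := L x + h)"
  have L'1: "1 \<le> L' v" for v using L h by (auto simp: L'_def intro: add_increasing2)
  have fr: "fresh y x L' = fresh y x L" for y
    unfolding fresh_def L'_def by auto
  have k: "fresh_children u x L' = fresh_children u x L" for u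
    by (simp add: fresh_children_def fr)
  have P: "path_weight v x L' = path_weight v x L"
    unfolding path_weight_def
  proof (rule prod.cong[OF refl])
    fix u assume "u \<in> path_between v (tl x)"
    then have "u \<noteq> []" "length u \<le> length (tl x)" using path_between_length by blast+
    then have "u \<noteq> x" "tl u \<noteq> x" using xne by (cases u; cases x; auto)+
    then show "return_bound u x L' = return_bound u x L"
      unfolding return_bound_def k by (simp add: L'_def)
  qed
  have "return_bound x x L' \<le> 1 - fresh_children x x L * (exp (- L x / 2) / (3 * L (tl x) + 9 / 2)) * (1 - h / 2)"
  proof (rule return_bound_increase[OF L h])
    show "L' x = L x + h" "L' (tl x) = L (tl x)" using xne by (simp_all add: L'_def)
  qed (use k fresh_children_bounds in simp_all)
  moreover have "fresh_children x x L * escape_weight x L * (1 - h / 2)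
    = fresh_children x x L * escape_weight x L - h * (fresh_children x x L * escape_weight x L / 2)"
    by (simp add: field_simps)
  ultimately have "(1 - fresh_children x x L' * escape_weight x L')
      \<le> (1 - fresh_children x x L * escape_weight x L) + h * (fresh_children x x L * escape_weight x L / 2)"
    unfolding return_bound_def escape_weight_def[symmetric] by linarith
  then have "(1 - fresh_children x x L' * escape_weight x L') * path_weight v x L
      \<le> ((1 - fresh_children x x L * escape_weight x L) + h * (fresh_children x x L * escape_weight x L / 2)) * path_weight v x L"
    using path_weight_bounds[where L = L, OF L] by (intro mult_right_mono) auto
  then show ?thesis using True
    unfolding L'_def[symmetric] escape_fn_strict[OF True] P escape_drift_def by (simp add: algebra_simps)
next
  case False
  then show ?thesis by (simp add: escape_fn_not_strict escape_drift_def)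
qed

text \<open>The time \<open>u\<close> spent at \<open>x\<close> has no effect, as the factor of
  \<open>x\<close> is gone. The time \<open>w\<close> spent at \<open>z\<close> enlarges the factor
  of \<open>z\<close> by at most \<open>w / 2\<close>, and no vertex of the remaining path loses a
  fresh child.\<close>

lemma escape_jump_to_parent:
  assumes L: "\<And>v. 1 \<le> L v" and adj: "tree_adj b x z" and z: "z = tl x" and v: "strict_suffix v x"
    and uw: "0 \<le> u" "0 \<le> w" "u + w \<le> 1"
  shows "escape_fn v z (L(x := L x + u, z := L z + w)) \<le> path_weight v x L + (u + w)"
proof -
  define L' where "L' = L(x := L x + u, z := L z + w)"
  have xz: "x \<noteq> z" "x \<noteq> []" using v adj by (auto simp: tree_adj_def strict_suffix_def)
  have lz: "length z < length x" using z xz by (cases x) auto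
  have L'1: "1 \<le> L' v" for v using L uw by (auto simp: L'_def intro: add_increasing2)
  have L'L: "L' v = L v" if "v \<noteq> x" "v \<noteq> z" for v using that by (simp add: L'_def)
  have k: "fresh_children q x L \<le> fresh_children q z L'" if "length q \<le> length z" for q
  proof (rule fresh_children_step[OF adj _ L'L])
    show "suffix z x" unfolding z by simp
  qed
  have le: "return_bound q z L' \<le> return_bound q x L" if q: "q \<in> path_between v z" "q \<noteq> z" for q
  proof -
    have "q \<noteq> []" "length q \<le> length z" using path_between_length[OF q(1)] by auto
    then have e: "L' q = L q + 0" "L' (tl q) = L (tl q)"
      using lz q(2) by (cases q; fastforce simp: L'_def)+
    show ?thesis
      using return_bound_increase[OF L order_refl e k[OF \<open>length q \<le> length z\<close>] fresh_children_bounds(1)]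
      by (simp add: return_bound_def)
  qed
  show ?thesis
  proof (cases "strict_suffix v z")
    case False
    then show ?thesis using uw by (simp add: escape_fn_not_strict path_weight_def path_between_empty z)
  next
    case True
    then obtain i z' where zz: "z = i # z'" by (cases z) auto
    have path: "path_between v z = insert z (path_between v z')" "z \<notin> path_between v z'"
      using path_between_Cons[of v i z'] True path_between_length[of z v z'] unfolding zz by auto
    have "L' z = L z + w" "L' (tl z) = L (tl z)" using xz lz by (auto simp: L'_def zz)
    note return_bound_increase[OF L uw(2) this k[OF order_refl] fresh_children_bounds(1)]
    moreover have "c * (1 - w / 2) = c - w / 2 * c" for c :: real by (simp add: algebra_simps)
    ultimately have "return_bound z z L' \<le> return_bound z x L
      + w / 2 * (fresh_children z x L * (exp (- L z / 2) / (3 * L (tl z) + 9 / 2)))"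
      unfolding return_bound_def[of z x L] by simp
    also have "w / 2 * (fresh_children z x L * (exp (- L z / 2) / (3 * L (tl z) + 9 / 2))) \<le> w / 2 * 1"
    proof (rule mult_left_mono)
      show "fresh_children z x L * (exp (- L z / 2) / (3 * L (tl z) + 9 / 2)) \<le> 1"
        using return_bound_bounds(1)[where L = L, OF L, of z x] by (simp add: return_bound_def)
    qed (use uw in simp)
    finally have rz: "return_bound z z L' \<le> return_bound z x L + (u + w)" using uw by simp
    define Q where "Q = (\<Prod>q\<in>path_between v z'. return_bound q x L)"
    have Q: "0 \<le> Q" "Q \<le> 1" unfolding Q_def using prod_return_bound[where L = L, OF L] by auto
    have "escape_fn v z L' = return_bound z z L' * (\<Prod>q\<in>path_between v z'. return_bound q z L')"
      unfolding escape_fn_def path(1) using path(2) finite_path_between by simp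
    also have "\<dots> \<le> (return_bound z x L + (u + w)) * Q"
      unfolding Q_def
    proof (intro mult_mono rz prod_mono conjI)
      fix q assume q: "q \<in> path_between v z'"
      then have "q \<in> path_between v z" "q \<noteq> z" using path by auto
      then show "return_bound q z L' \<le> return_bound q x L" by (rule le)
    qed (use return_bound_bounds[where L = L, OF L] return_bound_bounds[where L = L', OF L'1] uw prod_return_bound[where L = L', OF L'1] in \<open>auto intro: add_nonneg_nonneg\<close>)
    also have "\<dots> \<le> return_bound z x L * Q + (u + w)"
      using mult_left_mono[OF Q(2), of "u + w"] uw by (simp add: algebra_simps)
    also have "return_bound z x L * Q = path_weight v x L"
      unfolding path_weight_def z[symmetric] path(1) Q_def using path(2) finite_path_between by simp
    finally show ?thesis unfolding L'_def .
  qed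
qed

text \<open>Two factors are perturbed, those of \<open>x\<close> and \<open>z\<close>, each by at
  most \<open>h = u + w\<close>. As both are at most 1 and \<open>h\<close> is at most 1, their
  product changes by at most \<open>h * (1 + 1 + h)\<close>, which is where the 3 comes
  from.\<close>

lemma escape_jump_to_child:
  assumes L: "\<And>v. 1 \<le> L v" and adj: "tree_adj 3 x z" and z: "z = j # x" and v: "strict_suffix v x"
    and uw: "0 \<le> u" "0 \<le> w" "u + w \<le> 1"
  shows "escape_fn v z (L(x := L x + u, z := L z + w)) \<le> escape_fn v x L + escape_jump v x z L + 3 * (u + w)"
proof -
  define L' where "L' = L(x := L x + u, z := L z + w)"
  define h where "h = u + w"
  have h: "0 \<le> h" "h \<le> 1" "u \<le> h" "w \<le> h" using uw by (auto simp: h_def)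
  have xne: "x \<noteq> []" "tl x \<noteq> x" "x \<noteq> z" using v z by (cases x; auto simp: strict_suffix_def)+
  have "length z \<noteq> length (tl x)" using z by simp
  then have zt: "z \<noteq> tl x" by auto
  have L'1: "1 \<le> L' v" for v using L uw by (auto simp: L'_def intro: add_increasing2)
  have L'L: "L' v = L v" if "v \<noteq> x" "v \<noteq> z" for v using that by (simp add: L'_def)
  \<comment> \<open>The indicator \<open>b\<close> treats fresh and explored children together:
    \<open>x\<close> keeps at least \<open>k - b\<close> fresh children, and \<open>z\<close>
    contributes \<open>1 - b * G\<close>.\<close>
  define P k g G b where "P = path_weight v x L" and "k = fresh_children x x L"
    and "g = escape_weight x L" and "G = entry_weight x L" and "b = (of_bool (fresh z x L) :: real)"
  have P: "0 \<le> P" "P \<le> 1" using path_weight_bounds[where L = L, OF L] by (auto simp: P_def)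
  have k: "0 \<le> k" "k \<le> 3" using fresh_children_bounds by (auto simp: k_def)
  have g: "0 < g" "g \<le> 16 / 195" using return_weight_bounds[OF L L] by (auto simp: g_def escape_weight_def)
  have kb: "0 \<le> k - b"
  proof -
    have j: "j \<in> {..<3}" using adj z by (auto simp: tree_adj_def tree_vertices_def)
    have "(of_bool (fresh (j # x) x L) :: real) \<le> k"
      unfolding k_def fresh_children_def by (rule member_le_sum[OF j]) auto
    then show ?thesis by (simp add: b_def z)
  qed
  have kg: "0 \<le> (k - b) * g" "(k - b) * g \<le> 1"
  proof -
    show "0 \<le> (k - b) * g" using kb g by simp
    have "(k - b) * g \<le> 3 * (16 / 195)" using kb k g by (intro mult_mono) (auto simp: b_def)
    then show "(k - b) * g \<le> 1" by simp
  qed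
  have path: "path_between v z = insert z (insert x (path_between v (tl x)))"
    "z \<notin> insert x (path_between v (tl x))" "x \<notin> path_between v (tl x)"
  proof -
    obtain i x' where x: "x = i # x'" using xne by (cases x) auto
    have "strict_suffix v z" using v z by (simp add: strict_suffix_def suffix_Cons) (metis suffix_length_le Suc_n_not_le_n length_Cons)
    then show "path_between v z = insert z (insert x (path_between v (tl x)))"
      using path_between_Cons[of v j x] path_between_Cons[of v i x'] v z x by simp
    show "z \<notin> insert x (path_between v (tl x))" "x \<notin> path_between v (tl x)"
      using path_between_length[of z v "tl x"] path_between_length[of x v "tl x"] z x by auto
  qed
  have rest: "(\<Prod>q\<in>path_between v (tl x). return_bound q z L') \<le> P"
    unfolding P_def path_weight_def
  proof (intro prod_mono conjI)
    fix q assume "q \<in> path_between v (tl x)"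
    then have q: "q \<noteq> []" "length q < length x" using path_between_length[of q v "tl x"] xne(1) by (cases x; auto)+
    then have e: "L' q = L q + 0" "L' (tl q) = L (tl q)"
      using z by (cases q; fastforce simp: L'_def)+
    have "fresh_children q x L \<le> fresh_children q z L'"
      by (rule fresh_children_step[OF adj _ L'L]) (use q z in auto)
    from return_bound_increase[OF L order_refl e this fresh_children_bounds(1)]
    show "return_bound q z L' \<le> return_bound q x L" by (simp add: return_bound_def)
  qed (rule return_bound_bounds[where L = L', OF L'1])
  have rx: "return_bound x z L' \<le> 1 - (k - b) * g + h"
  proof -
    have e: "L' x = L x + u" "L' (tl x) = L (tl x)"
      using xne z by (cases x; auto simp: L'_def)+
    have "k - b \<le> fresh_children x z L'"
      using fresh_children_step_child[OF adj[unfolded z] L'L[unfolded z]] by (simp add: k_def b_def z)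
    from return_bound_increase[OF L uw(1) e this kb]
    have "return_bound x z L' \<le> 1 - (k - b) * g * (1 - u / 2)"
      using k by (simp add: g_def escape_weight_def b_def)
    also have "\<dots> = 1 - (k - b) * g + (k - b) * g * (u / 2)" by (simp add: algebra_simps)
    also have "(k - b) * g * (u / 2) \<le> 1 * h" using kg uw h by (intro mult_mono) auto
    finally show ?thesis by simp
  qed
  have G: "0 \<le> G" "G \<le> 1"
  proof -
    have "G = 3 * (exp (- 1 / 2) / (3 * L x + 9 / 2))" by (simp only: G_def entry_weight_def)
    then show "0 \<le> G" "G \<le> 1" using return_weight_bounds[OF order_refl L, of x] by linarith+
  qed
  have rz: "return_bound z z L' \<le> 1 - b * G + h"
  proof (cases "fresh z x L")
    case True
    have Lz: "L z = 1" using True by (auto simp: fresh_def)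
    have k3: "fresh_children z z L' = 3" by (rule fresh_children_of_fresh[OF True adj L'L])
    define m where "m = 3 * L x + 9 / 2"
    have m: "0 < m" "3 \<le> m" using L[of x] by (auto simp: m_def)
    have "exp (- 1 / 2) * (1 - w / 2) \<le> exp (- L' z / 2)"
      using exp_decrease[of 1 w] by (simp add: L'_def Lz)
    \<comment> \<open>The time \<open>u\<close> spent at \<open>x\<close> before the jump raises the
      denominator for \<open>z\<close> from \<open>m\<close> to \<open>m + 3 * u\<close>; since
      \<open>m\<close> is at least 3, this costs at most a factor \<open>1 - u\<close>.\<close>
    moreover have "(1 - u) / m \<le> 1 / (m + 3 * u)"
    proof -
      have "(1 - u) * (m + 3 * u) \<le> m"
      proof -
        have "(1 - u) * (m + 3 * u) = m - u * (m - 3) - 3 * u\<^sup>2" by (simp add: algebra_simps power2_eq_square)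
        also have "\<dots> \<le> m" using mult_nonneg_nonneg[OF uw(1), of "m - 3"] m(2) zero_le_power2[of u] by linarith
        finally show ?thesis .
      qed
      then show ?thesis using m uw by (simp add: field_simps)
    qed
    ultimately have "(exp (- 1 / 2) * (1 - w / 2)) * ((1 - u) / m) \<le> exp (- L' z / 2) * (1 / (m + 3 * u))"
      using uw m by (intro mult_mono) auto
    moreover have "exp (- 1 / 2) / m * (1 - h) \<le> (exp (- 1 / 2) * (1 - w / 2)) * ((1 - u) / m)"
    proof -
      have "(1 - w / 2) * (1 - u) = 1 - h + w / 2 + w * u / 2" by (simp add: h_def field_simps)
      then have "1 - h \<le> (1 - w / 2) * (1 - u)" using uw by simp
      then have "exp (- 1 / 2) / m * (1 - h) \<le> exp (- 1 / 2) / m * ((1 - w / 2) * (1 - u))"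
        using m by (intro mult_left_mono) auto
      then show ?thesis by simp
    qed
    ultimately have "exp (- 1 / 2) / m * (1 - h) \<le> exp (- L' z / 2) / (m + 3 * u)" by simp
    moreover have "3 * L' (tl z) + 9 / 2 = m + 3 * u" using z xne(3) by (simp add: L'_def m_def)
    ultimately have "return_bound z z L' \<le> 1 - 3 * (exp (- 1 / 2) / m * (1 - h))"
      unfolding return_bound_def k3 by simp
    also have "\<dots> = 1 - G + G * h"
    proof -
      have "G = 3 * (exp (- 1 / 2) / m)" by (simp only: G_def entry_weight_def m_def)
      moreover have "1 - 3 * (c * (1 - h)) = 1 - 3 * c + 3 * c * h" for c :: real by (simp add: algebra_simps)
      ultimately show ?thesis by (simp only:)
    qed
    also have "\<dots> \<le> 1 - G + h" using mult_right_mono[OF G(2) h(1)] by simp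
    finally show ?thesis using True by (simp add: b_def)
  next
    case False
    then show ?thesis using return_bound_bounds(2)[where L = L', OF L'1, of z z] h by (simp add: b_def)
  qed
  have "escape_fn v z L' = return_bound z z L' * (return_bound x z L' * (\<Prod>q\<in>path_between v (tl x). return_bound q z L'))"
    unfolding escape_fn_def path(1) using path(2,3) finite_path_between by simp
  also have "\<dots> \<le> (1 - b * G + h) * ((1 - (k - b) * g + h) * P)"
    using return_bound_bounds[where L = L', OF L'1] prod_return_bound[where L = L', OF L'1] h kg G P
    by (intro mult_mono rz rx rest mult_nonneg_nonneg) (auto simp: b_def)
  also have "\<dots> \<le> (1 - b * G) * (1 - (k - b) * g) * P + 3 * h"
  proof -
    have eq: "(1 - b * G + h) * ((1 - (k - b) * g + h) * P) = (1 - b * G) * (1 - (k - b) * g) * P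
      + h * (((1 - b * G) + (1 - (k - b) * g) + h) * P)" by (simp add: algebra_simps)
    have "((1 - b * G) + (1 - (k - b) * g) + h) * P \<le> 3 * 1"
      using kg G h P by (intro mult_mono) (auto simp: b_def)
    then have "h * (((1 - b * G) + (1 - (k - b) * g) + h) * P) \<le> h * (3 * 1)"
      using h(1) by (rule mult_left_mono)
    then show ?thesis unfolding eq by simp
  qed
  also have "(1 - b * G) * (1 - (k - b) * g) * P = escape_fn v x L + escape_jump v x z L"
    using v zt xne unfolding escape_fn_strict[OF v] escape_jump_def P_def[symmetric] k_def[symmetric]
      g_def[symmetric] G_def[symmetric]
    by (cases "fresh z x L") (auto simp: b_def algebra_simps)
  finally show ?thesis unfolding L'_def h_def .
qed

text \<open>After division by \<open>p * k\<close> the claim reads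
  \<open>g * (m + 3 / 2) - G + (k - 1) * g * G \<le> 0\<close>, where \<open>3 / 2\<close> collects
  the decay \<open>1 / 2\<close> and the loss 1 of an explored child. The choice of denominators
  gives \<open>g * (m + 3 / 2) = exp (- l / 2) / 3\<close> and
  \<open>G = exp (- 1 / 2) / (l + 3 / 2)\<close>, so the linear part uses up \<open>5 / 6\<close> of
  \<open>G\<close>.\<close>

lemma escape_supersolution_inequality:
  fixes l m p k :: real
  assumes l: "1 \<le> l" and m: "1 \<le> m" and k: "0 \<le> k" "k \<le> 3" and p: "0 \<le> p"
    and g: "g = exp (- l / 2) / (3 * m + 9 / 2)" and G: "G = 3 * (exp (- 1 / 2) / (3 * l + 9 / 2))"
  shows "p * (k * g / 2) + m * (p * (k * g)) + k * (p * ((1 - (k - 1) * g) * (1 - G) - (1 - k * g))) \<le> 0"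
proof -
  have g': "0 < g" "g \<le> 16 / 195" unfolding g using return_weight_bounds[OF l m] by auto
  define e where "e = exp (- 1 / 2 :: real)"
  have e: "0 < e" by (simp add: e_def)
  \<comment> \<open>The tangent of the exponential at 0 suffices:
    \<open>l + 3 / 2 \<le> 5 / 2 * (1 + (l - 1) / 2)\<close>, with equality at
    \<open>l = 1\<close>.\<close>
  define E where "E = exp ((l - 1) / 2)"
  have "1 + (l - 1) / 2 \<le> E" unfolding E_def by (rule exp_ge_add_one_self)
  then have "5 / 2 * (1 + (l - 1) / 2) \<le> 5 / 2 * E" by (rule mult_left_mono) simp
  moreover have "l + 3 / 2 \<le> 5 / 2 * (1 + (l - 1) / 2)" using l by (simp add: field_simps)
  ultimately have "(l + 3 / 2) \<le> 5 / 2 * exp ((l - 1) / 2)" unfolding E_def by (rule order_trans[rotated])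
  then have "exp (- l / 2) * (l + 3 / 2) \<le> exp (- l / 2) * (5 / 2 * exp ((l - 1) / 2))"
    by (intro mult_left_mono) auto
  also have "\<dots> = 5 / 2 * exp (- l / 2 + (l - 1) / 2)" by (simp only: exp_add mult_ac)
  also have "- l / 2 + (l - 1) / 2 = - 1 / 2" by (simp add: field_simps)
  finally have "exp (- l / 2) * (l + 3 / 2) \<le> 5 / 2 * e" by (simp add: e_def)
  then have "exp (- l / 2) / 3 \<le> (5 / 6) * (e / (l + 3 / 2))" using l by (simp add: field_simps)
  moreover have "g * (m + 3 / 2) = exp (- l / 2) / 3" using m by (simp add: g field_simps)
  moreover have Ge: "G = e / (l + 3 / 2)" using l by (simp add: G e_def field_simps)
  ultimately have main: "g * (m + 3 / 2) \<le> 5 / 6 * G" by (simp only:)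
  have G0: "0 \<le> G" using Ge e l by simp
  \<comment> \<open>The product \<open>2 * (16 / 195)\<close> is just below \<open>1 / 6\<close>,
    the share of \<open>G\<close> that the linear part leaves.\<close>
  have "(k - 1) * g \<le> 2 * (16 / 195)"
  proof (cases "k \<le> 1")
    case True
    then have "(k - 1) * g \<le> 0" using g' by (simp add: mult_nonpos_nonneg)
    then show ?thesis by simp
  next
    case False
    then show ?thesis using k g' by (intro mult_mono) auto
  qed
  then have "(k - 1) * g * G \<le> 1 / 6 * G" using G0 by (intro mult_right_mono) auto
  then have "g * (m + 3 / 2) - G + (k - 1) * g * G \<le> 0" using main by simp
  then have "p * k * (g * (m + 3 / 2) - G + (k - 1) * g * G) \<le> 0"
    using p k by (intro mult_nonneg_nonpos mult_nonneg_nonneg) auto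
  then show ?thesis by (simp add: algebra_simps)
qed

lemma measurable_fresh_children[measurable]:
  "fresh_children u x \<in> borel_measurable state_space"
proof -
  have [measurable]: "(\<lambda>L. L v) \<in> borel_measurable (state_space :: (nat list \<Rightarrow> real) measure)" for v
    by (rule measurable_component_singleton) simp
  show ?thesis unfolding fresh_children_def[abs_def] fresh_def of_bool_def by measurable
qed

lemma supersolution_escape_fn:
  "supersolution (tree_vertices 3) (tree_adj 3) (escape_fn v) (escape_drift v) (escape_jump v)"
  unfolding supersolution_def
proof (intro conjI allI impI ballI)
  fix x z :: "nat list"
  have comp[measurable]: "(\<lambda>L. L v) \<in> borel_measurable (state_space :: (nat list \<Rightarrow> real) measure)" for v
    by (rule measurable_component_singleton) simp
  have rb[measurable]: "return_bound u x \<in> borel_measurable state_space" for u x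
    unfolding return_bound_def[abs_def] by measurable
  show "escape_fn v x \<in> borel_measurable state_space" unfolding escape_fn_def[abs_def] by measurable
  have [measurable]: "path_weight v x \<in> borel_measurable state_space" unfolding path_weight_def[abs_def] by measurable
  have [measurable]: "escape_weight x \<in> borel_measurable state_space" unfolding escape_weight_def[abs_def] by measurable
  have [measurable]: "entry_weight x \<in> borel_measurable state_space" unfolding entry_weight_def[abs_def] by measurable
  show "escape_drift v x \<in> borel_measurable state_space" unfolding escape_drift_def[abs_def] by measurable
  have [measurable]: "Measurable.pred state_space (fresh z x)" unfolding fresh_def[abs_def] by measurable
  show "escape_jump v x z \<in> borel_measurable state_space" unfolding escape_jump_def[abs_def] by measurable
next
  fix x and L :: "nat list \<Rightarrow> real" assume x: "x \<in> tree_vertices 3" and L: "\<forall>v. 1 \<le> L v"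
  show "escape_drift v x L + (\<Sum>z | tree_adj 3 x z. L z * escape_jump v x z L) \<le> 0"
  proof (cases "strict_suffix v x")
    case False
    then show ?thesis by (simp add: escape_drift_def escape_jump_def)
  next
    case True
    then obtain i x' where xx: "x = i # x'" by (cases x) auto
    define P k g G where "P = path_weight v x L" and "k = fresh_children x x L"
      and "g = escape_weight x L" and "G = entry_weight x L"
    note defs = P_def[symmetric] k_def[symmetric] g_def[symmetric] G_def[symmetric]
    define c where "c = P * ((1 - (k - 1) * g) * (1 - G) - (1 - k * g))"
    \<comment> \<open>A fresh child is entered at rate 1, since its local time is 1, and an explored
      child contributes nothing; so the sum over the children collapses to
      \<open>k * c\<close>.\<close>
    have child: "L (j # x) * escape_jump v x (j # x) L = of_bool (fresh (j # x) x L) * c" for j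
    proof (cases "fresh (j # x) x L")
      case True
      then have "L (j # x) = 1" by (auto simp: fresh_def)
      moreover have "j # x \<noteq> tl x" using not_Cons_tl[of j x] .
      ultimately show ?thesis using True \<open>strict_suffix v x\<close> by (simp add: escape_jump_def defs c_def)
    next
      case False
      moreover have "j # x \<noteq> tl x" using not_Cons_tl[of j x] .
      ultimately show ?thesis by (simp add: escape_jump_def)
    qed
    have n: "x' \<notin> (\<lambda>j. j # i # x') ` {..<3::nat}" by auto
    have "(\<Sum>z | tree_adj 3 x z. L z * escape_jump v x z L) =
      L x' * escape_jump v x x' L + (\<Sum>j<3. L (j # x) * escape_jump v x (j # x) L)"
      using x n unfolding xx tree_neighbours_Cons[OF x[unfolded xx]]
      by (simp add: sum.reindex inj_on_def)
    also have "\<dots> = L x' * (P * (k * g)) + k * c"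
    proof -
      have "escape_jump v x (tl x) L = P * (k * g)" using True by (simp add: escape_jump_def defs)
      moreover have "tl x = x'" by (simp add: xx)
      moreover have "(\<Sum>j<3. of_bool (fresh (j # x) x L) * c) = k * c"
        by (simp only: k_def fresh_children_def sum_distrib_right)
      ultimately show ?thesis unfolding child by simp
    qed
    finally have sum: "(\<Sum>z | tree_adj 3 x z. L z * escape_jump v x z L) = L x' * (P * (k * g)) + k * c" .
    have "P * (k * g / 2) + L (tl x) * (P * (k * g)) + k * (P * ((1 - (k - 1) * g) * (1 - G) - (1 - k * g))) \<le> 0"
    proof (rule escape_supersolution_inequality)
      show "g = exp (- L x / 2) / (3 * L (tl x) + 9 / 2)" by (simp add: g_def escape_weight_def)
      show "G = 3 * (exp (- 1 / 2) / (3 * L x + 9 / 2))" by (simp add: G_def entry_weight_def)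
    qed (use L path_weight_bounds[of L v x] fresh_children_bounds in \<open>auto simp: P_def k_def\<close>)
    moreover have "escape_drift v x L = P * (k * g / 2)" using True by (simp add: escape_drift_def defs)
    moreover have "tl x = x'" by (simp add: xx)
    ultimately show ?thesis unfolding sum c_def by simp
  qed
next
  fix T :: real assume T: "0 \<le> T"
  show "\<exists>C\<ge>0. \<forall>x\<in>tree_vertices 3. \<forall>L. (\<forall>v. 1 \<le> L v \<and> L v \<le> 1 + T) \<longrightarrow>
      0 \<le> escape_fn v x L \<and> escape_fn v x L \<le> C \<and> \<bar>escape_drift v x L\<bar> \<le> C \<and>
      (\<forall>z. tree_adj 3 x z \<longrightarrow> \<bar>escape_jump v x z L\<bar> \<le> C) \<and>
      (\<forall>h\<in>{0..1}. escape_fn v x (L(x := L x + h)) \<le> escape_fn v x L + h * escape_drift v x L + C * h\<^sup>2) \<and>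
      (\<forall>z u w. tree_adj 3 x z \<longrightarrow> 0 \<le> u \<longrightarrow> 0 \<le> w \<longrightarrow> u + w \<le> 1 \<longrightarrow>
        escape_fn v z (L(x := L x + u, z := L z + w)) \<le> escape_fn v x L + escape_jump v x z L + C * (u + w))"
  \<comment> \<open>The constant does not depend on \<open>T\<close>, as all factors lie between 0
    and 1; its size is dictated by the jump to a child.\<close>
  proof (intro exI[of _ 3] conjI ballI allI impI)
    fix x :: "nat list" and L :: "nat list \<Rightarrow> real"
    assume bd: "\<forall>v. 1 \<le> L v \<and> L v \<le> 1 + T"
    then have L: "1 \<le> L v" for v by blast
    show "0 \<le> escape_fn v x L" "escape_fn v x L \<le> 3" using escape_fn_bounds[of L v x, OF L] by auto
    define P k g G where "P = path_weight v x L" and "k = fresh_children x x L"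
      and "g = escape_weight x L" and "G = entry_weight x L"
    note defs = P_def[symmetric] k_def[symmetric] g_def[symmetric] G_def[symmetric]
    have P: "0 \<le> P" "P \<le> 1" using path_weight_bounds[where L = L, OF L] by (auto simp: P_def)
    have k: "0 \<le> k" "k \<le> 3" using fresh_children_bounds by (auto simp: k_def)
    have g: "0 < g" "g \<le> 16 / 195" using return_weight_bounds[OF L L] by (auto simp: g_def escape_weight_def)
    have G: "0 < G" "G \<le> 1"
    proof -
      have "G = 3 * (exp (- 1 / 2) / (3 * L x + 9 / 2))" by (simp only: G_def entry_weight_def)
      then show "0 < G" "G \<le> 1" using return_weight_bounds[OF order_refl L, of x] by linarith+
    qed
    have "k * g \<le> 3 * (16 / 195)" using k g by (intro mult_mono) auto
    then have kg: "0 \<le> k * g" "k * g \<le> 1" using k g by auto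
    have Pkg: "0 \<le> P * (k * g)" "P * (k * g) \<le> 1" using P kg by (auto intro: mult_le_one)
    show "\<bar>escape_drift v x L\<bar> \<le> 3" using Pkg by (auto simp: escape_drift_def defs)
    show "\<bar>escape_jump v x z L\<bar> \<le> 3" for z
    proof -
      have "\<bar>(1 - (k - 1) * g) * (1 - G) - (1 - k * g)\<bar> \<le> 3"
      proof -
        have a: "0 \<le> 1 - (k - 1) * g" "1 - (k - 1) * g \<le> 2" using kg g by (auto simp: algebra_simps)
        have "0 \<le> (1 - (k - 1) * g) * (1 - G)" using a G by (intro mult_nonneg_nonneg) auto
        moreover have "(1 - (k - 1) * g) * (1 - G) \<le> 2 * 1" using a G by (intro mult_mono) auto
        ultimately have "0 \<le> (1 - (k - 1) * g) * (1 - G)" "(1 - (k - 1) * g) * (1 - G) \<le> 2" by simp_all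
        then show ?thesis using kg by (auto simp: abs_le_iff)
      qed
      then have "\<bar>P * ((1 - (k - 1) * g) * (1 - G) - (1 - k * g))\<bar> \<le> 1 * 3"
        unfolding abs_mult using P by (intro mult_mono) auto
      then show ?thesis using Pkg unfolding escape_jump_def defs by auto
    qed
    show "escape_fn v x (L(x := L x + h)) \<le> escape_fn v x L + h * escape_drift v x L + 3 * h\<^sup>2"
      if "h \<in> {0..1}" for h
    proof -
      have "0 \<le> 3 * h\<^sup>2" by simp
      moreover have "escape_fn v x (L(x := L x + h)) \<le> escape_fn v x L + h * escape_drift v x L"
        by (rule escape_flow[OF L]) (use that in auto)
      ultimately show ?thesis by linarith
    qed
    show "escape_fn v z (L(x := L x + u, z := L z + w)) \<le> escape_fn v x L + escape_jump v x z L + 3 * (u + w)"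
      if adj: "tree_adj 3 x z" and uw: "0 \<le> u" "0 \<le> w" "u + w \<le> 1" for z u w
    proof (cases "strict_suffix v x")
      case False
      have "1 \<le> (L(x := L x + u, z := L z + w)) q" for q
        using L[of x] L[of z] L[of q] uw by auto
      from escape_fn_bounds(2)[where L = "L(x := L x + u, z := L z + w)", OF this, of v z]
      show ?thesis using False uw by (simp add: escape_fn_not_strict escape_jump_def)
    next
      case True
      show ?thesis
      proof (cases "z = tl x")
        case tl: True
        have "escape_fn v x L + escape_jump v x z L = P"
          unfolding escape_fn_strict[OF True] using True tl by (simp add: escape_jump_def defs algebra_simps)
        then show ?thesis using escape_jump_to_parent[where L = L, OF L adj tl True uw] uw by (simp add: P_def)
      next
        case False
        then obtain j where "z = j # x" using adj by (auto simp: tree_adj_def)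
        then show ?thesis by (rule escape_jump_to_child[where L = L, OF L adj _ True uw])
      qed
    qed
  qed simp
qed

section \<open>Drift to infinity\<close>

text \<open>The number \<open>m\<close> is the limit superior along the rationals. Values just below
  \<open>m\<close> recur, so values at most \<open>m - e\<close> cannot recur without an
  oscillation. The levels are rational because only countably many pairs of levels can be excluded
  almost surely.\<close>

lemma almost_convergent_if_not_oscillating:
  fixes f :: "real \<Rightarrow> real"
  assumes f: "\<And>t. t \<in> \<rat> \<Longrightarrow> 0 \<le> t \<Longrightarrow> 0 \<le> f t" "\<And>t. t \<in> \<rat> \<Longrightarrow> 0 \<le> t \<Longrightarrow> f t \<le> K"
    and osc: "\<And>a b. a \<in> \<rat> \<Longrightarrow> b \<in> \<rat> \<Longrightarrow> 0 \<le> a \<Longrightarrow> a < b \<Longrightarrow>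
      \<not> oscillates a b f"
    and e: "0 < e"
  obtains m s where "0 \<le> s" "\<And>t. t \<in> \<rat> \<Longrightarrow> s < t \<Longrightarrow> \<bar>f t - m\<bar> \<le> e"
proof -
  define B where "B = {b. \<exists>s\<ge>0. \<forall>t\<in>\<rat>. s < t \<longrightarrow> f t \<le> b}"
  have K: "K \<in> B" unfolding B_def using f(2) by (auto intro!: exI[of _ 0])
  have lb: "0 \<le> b" if bB: "b \<in> B" for b
  proof -
    obtain s where s: "0 \<le> s" "\<forall>t\<in>\<rat>. s < t \<longrightarrow> f t \<le> b" using bB unfolding B_def by blast
    obtain t where "t \<in> \<rat>" "s < t" using Rats_dense_in_real[of s "s + 1"] by auto
    then have "0 \<le> f t" "f t \<le> b" using s f(1)[of t] by auto
    then show ?thesis by linarith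
  qed
  have bdd: "bdd_below B" using lb by (rule bdd_belowI)
  define m where "m = Inf B"
  obtain b1 where "b1 \<in> B" "b1 < m + e"
    using cInf_lessD[of B "m + e"] K e by (auto simp: m_def)
  then obtain s1 where s1: "0 \<le> s1" "\<And>t. t \<in> \<rat> \<Longrightarrow> s1 < t \<Longrightarrow> f t < m + e"
    unfolding B_def by force
  have up: "\<exists>t\<in>\<rat>. s < t \<and> m - e / 2 < f t" for s
  proof (rule ccontr)
    assume "\<not> ?thesis"
    then have "m - e / 2 \<in> B" unfolding B_def by (auto intro!: exI[of _ "max 0 s"])
    then have "m \<le> m - e / 2" unfolding m_def using bdd by (rule cInf_lower)
    then show False using e by simp
  qed
  obtain a where a: "a \<in> \<rat>" "m - e < a" "a < m - e / 2" using Rats_dense_in_real[of "m - e" "m - e / 2"] e by auto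
  obtain b where b: "b \<in> \<rat>" "a < b" "b < m - e / 2" using Rats_dense_in_real[OF a(3)] by auto
  \<comment> \<open>Oscillations are excluded only for nonnegative lower levels; below a negative
    level \<open>f\<close> never goes.\<close>
  have "\<exists>s2\<ge>0. \<forall>t\<in>\<rat>. s2 < t \<longrightarrow> a < f t"
  proof (cases "0 \<le> a")
    case True
    have "\<forall>s. \<exists>t\<in>\<rat>. s < t \<and> b \<le> f t" using up b(3) by (meson less_imp_le less_trans)
    then obtain s where "\<forall>t\<in>\<rat>. s < t \<longrightarrow> a < f t" using osc[OF a(1) b(1) True b(2)] by force
    then show ?thesis by (intro exI[of _ "max 0 s"]) auto
  next
    case False
    then show ?thesis using f(1) by (intro exI[of _ 0]) (force intro: less_le_trans)
  qed
  then obtain s2 where s2: "0 \<le> s2" "\<And>t. t \<in> \<rat> \<Longrightarrow> s2 < t \<Longrightarrow> a < f t" by blast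
  show ?thesis
  proof (rule that[of "max s1 s2" m])
    fix t assume "t \<in> \<rat>" "max s1 s2 < t"
    then show "\<bar>f t - m\<bar> \<le> e" using s1(2)[of t] s2(2)[of t] a(2) by auto
  qed (use s1 in simp)
qed

section \<open>The local time beyond an edge that is crossed infinitely often\<close>

context jump_path
begin

lemma rational_time_after:
  assumes "0 \<le> t" "t < b"
  obtains q where "q \<in> \<rat>" "t < q" "q < b" "p q = p t"
proof -
  obtain d where d: "d > 0" "\<And>s. t \<le> s \<Longrightarrow> s < t + d \<Longrightarrow> p s = p t" using right_nbhd[OF assms(1)] by blast
  obtain q where "q \<in> \<rat>" "t < q" "q < min b (t + d)"
    using Rats_dense_in_real[of t "min b (t + d)"] d(1) assms(2) by auto
  then show ?thesis using that[of q] d(2)[of q] by simp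
qed

text \<open>Right-continuity makes the infimum of the entrance times a minimum, and the left limit
  there is still outside.\<close>

lemma first_entrance:
  assumes "0 \<le> t" "P (p t)" "\<not> P (p 0)"
  obtains \<tau> x d where "0 < \<tau>" "\<tau> \<le> t" "P (p \<tau>)" "\<And>s. 0 \<le> s \<Longrightarrow> s < \<tau> \<Longrightarrow> \<not> P (p s)"
    "adj x (p \<tau>)" "\<not> P x" "0 < d" "d \<le> \<tau>" "\<And>s. \<tau> - d < s \<Longrightarrow> s < \<tau> \<Longrightarrow> p s = x"
proof -
  define A where "A = {s. 0 \<le> s \<and> P (p s)}"
  have A: "t \<in> A" "bdd_below A" using assms by (auto simp: A_def intro: bdd_belowI[of _ 0])
  define \<tau> where "\<tau> = Inf A"
  have \<tau>0: "0 \<le> \<tau>" unfolding \<tau>_def by (rule cInf_greatest) (use A in \<open>auto simp: A_def\<close>)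
  have before: "\<not> P (p s)" if "0 \<le> s" "s < \<tau>" for s
    using cInf_lower[OF _ A(2), of s] that by (auto simp: A_def \<tau>_def)
  obtain d1 where d1: "d1 > 0" "\<And>s. \<tau> \<le> s \<Longrightarrow> s < \<tau> + d1 \<Longrightarrow> p s = p \<tau>" using right_nbhd[OF \<tau>0] by blast
  obtain s where s: "s \<in> A" "s < \<tau> + d1" using cInf_lessD[of A "\<tau> + d1"] A d1(1) by (auto simp: \<tau>_def)
  have "\<tau> \<le> s" unfolding \<tau>_def by (rule cInf_lower[OF s(1) A(2)])
  then have P\<tau>: "P (p \<tau>)" using d1(2)[of s] s by (simp add: A_def)
  then have pos: "0 < \<tau>" using assms(3) \<tau>0 by (cases "\<tau> = 0") auto
  obtain d x where d: "d > 0" "d \<le> \<tau>" "x = p \<tau> \<or> adj x (p \<tau>)" "\<And>s. \<tau> - d < s \<Longrightarrow> s < \<tau> \<Longrightarrow> p s = x"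
    using left_nbhd[OF pos] by metis
  have "p (\<tau> - d / 2) = x" using d(1,2) d(4)[of "\<tau> - d / 2"] by simp
  moreover have "\<not> P (p (\<tau> - d / 2))" by (rule before) (use d(1,2) in auto)
  ultimately have "\<not> P x" by simp
  moreover have "\<tau> \<le> t" unfolding \<tau>_def by (rule cInf_lower[OF A])
  ultimately show ?thesis using that[of \<tau> x d] pos P\<tau> before d by blast
qed

text \<open>If the local time at \<open>y\<close> stayed below \<open>B\<close>, then outside the
  subtree \<open>R\<close> would exceed the continuous ratio \<open>r\<close> by at least
  \<open>c = 1 / B\<^sup>2\<close>. Since \<open>R\<close> finally stays within \<open>c / 4\<close>
  of \<open>m\<close>, at rational times \<open>r\<close> would be above \<open>m - c / 4\<close>
  inside and below \<open>m - 3 * c / 4\<close> outside, and a continuous function cannot skip the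
  gap in between.\<close>

lemma local_time_unbounded:
  assumes infin: "\<And>s. \<exists>t>s. P (p t)" and out: "\<And>s. \<exists>t>s. \<not> P (p t)"
    and R: "\<And>t. R t = (if P (p t) then 0 else 1 / (local_time p y t)\<^sup>2) + local_time p x t / local_time p y t"
    and bd: "\<And>t. t \<in> \<rat> \<Longrightarrow> 0 \<le> t \<Longrightarrow> R t \<le> K"
    and osc: "\<And>a b. a \<in> \<rat> \<Longrightarrow> b \<in> \<rat> \<Longrightarrow> 0 \<le> a \<Longrightarrow> a < b \<Longrightarrow>
      \<not> oscillates a b R"
  shows "\<exists>t\<ge>0. B < local_time p y t"
proof (rule ccontr)
  assume "\<not> ?thesis"
  then have B: "local_time p y t \<le> B" if "0 \<le> t" for t using that by force
  have B1: "1 \<le> B" using B[of 0] by (simp add: local_time_0)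
  define c where "c = 1 / B\<^sup>2"
  have c: "0 < c" using B1 by (simp add: c_def)
  define r where "r t = local_time p x t / local_time p y t" for t
  have Rin: "R t = r t" if "P (p t)" for t using that by (simp add: R r_def)
  have Rout: "r t + c \<le> R t" if "\<not> P (p t)" "0 \<le> t" for t
  proof -
    have "(local_time p y t)\<^sup>2 \<le> B\<^sup>2" using B[OF that(2)] local_time_ge_1[of y t] by (intro power_mono) auto
    then have "c \<le> 1 / (local_time p y t)\<^sup>2"
      unfolding c_def using local_time_ge_1[of y t] B1
      by (intro divide_left_mono mult_pos_pos zero_less_power) auto
    then show ?thesis using that by (simp add: R r_def)
  qed
  have R0: "0 \<le> R t" for t
    using local_time_ge_1[of y t] local_time_ge_1[of x t] by (simp add: R)
  have c4: "0 < c / 4" using c by simp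
  obtain m s where ms: "0 \<le> s" "\<And>t. t \<in> \<rat> \<Longrightarrow> s < t \<Longrightarrow> \<bar>R t - m\<bar> \<le> c / 4"
    by (rule almost_convergent_if_not_oscillating[of R K, OF R0 bd osc c4];
      (assumption | (rule that; assumption)))
  have rin: "m - c / 4 \<le> r q" if "q \<in> \<rat>" "s < q" "P (p q)" for q
    using ms(2)[OF that(1,2)] Rin[OF that(3)] by linarith
  have rout: "r q \<le> m - 3 * c / 4" if "q \<in> \<rat>" "s < q" "\<not> P (p q)" for q
  proof -
    have "r q + c \<le> R q" by (rule Rout[OF that(3)]) (use that(2) ms(1) in linarith)
    then show ?thesis using ms(2)[OF that(1,2)] by linarith
  qed
  obtain t1 where t1: "t1 > s" "P (p t1)" using infin by blast
  obtain q1 where q1: "q1 \<in> \<rat>" "t1 < q1" "p q1 = p t1"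
    using rational_time_after[of t1 "t1 + 1"] t1 ms(1) by (metis less_add_one less_eq_real_def less_trans)
  obtain t2 where t2: "t2 > q1" "\<not> P (p t2)" using out by blast
  obtain q2 where q2: "q2 \<in> \<rat>" "t2 < q2" "p q2 = p t2"
    using rational_time_after[of t2 "t2 + 1"] t1 t2 q1 ms(1) by (metis less_add_one less_eq_real_def less_trans)
  have cont: "continuous_on {0..} r"
    unfolding r_def
  proof (rule continuous_on_divide[OF continuous_local_time continuous_local_time])
    show "\<forall>t\<in>{0..}. local_time p y t \<noteq> 0" using local_time_ge_1[of y] by (metis not_one_le_zero)
  qed
  \<comment> \<open>The value in the middle of the forbidden gap.\<close>
  have "\<exists>t\<ge>q1. t \<le> q2 \<and> r t = m - c / 2"
  proof (rule IVT2')
    show "r q2 \<le> m - c / 2" using rout[of q2] q2 t2 q1 t1 c by auto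
    show "m - c / 2 \<le> r q1" using rin[of q1] q1 t1 c by auto
    show "q1 \<le> q2" using q2 t2 by simp
    show "continuous_on {q1..q2} r" by (rule continuous_on_subset[OF cont]) (use q1 t1 ms(1) in auto)
  qed
  then obtain t where t: "q1 \<le> t" "r t = m - c / 2" by blast
  have t0: "0 \<le> t" using t q1 t1 ms(1) by simp
  \<comment> \<open>The two estimates hold only at rational times, so \<open>t\<close> is moved to a
    rational time nearby; a change of less than \<open>c / 8\<close> keeps \<open>r\<close> inside
    the gap.\<close>
  obtain e where e: "e > 0" "\<And>q. q \<in> {0..} \<Longrightarrow> dist q t < e \<Longrightarrow> dist (r q) (r t) < c / 8"
    using cont[unfolded continuous_on_iff, rule_format, of t "c / 8"] t0 c by auto
  obtain q where q: "q \<in> \<rat>" "t < q" "q < t + e" using Rats_dense_in_real[of t "t + e"] e by auto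
  have "dist (r q) (r t) < c / 8" by (rule e(2)) (use q t0 in \<open>auto simp: dist_real_def\<close>)
  then have "r q < m - 3 * c / 8" "m - 5 * c / 8 < r q" unfolding t(2) dist_real_def by linarith+
  then show False using rin[of q] rout[of q] q t(1) q1 t1 c by (cases "P (p q)") auto
qed

end

section \<open>Almost sure statements for the process on the 3-ary tree\<close>

locale tree_vrjp = rooted_vrjp M "tree_vertices 3" "tree_adj 3" X "[]"
  for M :: "'a measure" and X
begin

lemma ratio_supermartingale:
  "y \<in> tree_vertices 3 \<Longrightarrow> y \<noteq> [] \<Longrightarrow> supermartingale (at_time (ratio_fn y))"
  by (rule supersolution_imp_supermartingale[OF supersolution_ratio_fn])

lemma escape_supermartingale: "supermartingale (at_time (escape_fn v))"
  by (rule supersolution_imp_supermartingale[OF supersolution_escape_fn])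

lemma space_in_history: "space M \<in> sets (history M X t)"
  using sets.top[of "history M X t"] by (simp add: space_history)

text \<open>At time 0 all local times are 1, so the process starts at 2 or less. The bound is
  uniform in \<open>y\<close>, so it applies equally to vertices arbitrarily deep in the
  tree.\<close>

lemma ratio_large:
  assumes "y \<in> tree_vertices 3" "y \<noteq> []" "0 < H"
  shows "{\<omega> \<in> space M. \<exists>t\<in>\<rat>. 0 \<le> t \<and> H \<le> at_time (ratio_fn y) t \<omega>} \<in> sets M"
    and "measure M {\<omega> \<in> space M. \<exists>t\<in>\<rat>. 0 \<le> t \<and> H \<le> at_time (ratio_fn y) t \<omega>} \<le> 2 / H"
proof -
  note max = supermartingale_maximal[OF ratio_supermartingale[OF assms(1,2)] assms(3) order_refl space_in_history]
  show "{\<omega> \<in> space M. \<exists>t\<in>\<rat>. 0 \<le> t \<and> H \<le> at_time (ratio_fn y) t \<omega>} \<in> sets M" by (rule max(1))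
  have "(\<integral>\<omega>. indicator (space M) \<omega> * at_time (ratio_fn y) 0 \<omega> \<partial>M) \<le> (\<integral>\<omega>. 2 \<partial>M)"
  proof (rule integral_mono')
    fix \<omega> assume "\<omega> \<in> space M"
    then interpret p: jump_path "tree_adj 3" "\<lambda>u. X u \<omega>" by (rule jump_path)
    show "indicator (space M) \<omega> * at_time (ratio_fn y) 0 \<omega> \<le> 2"
      by (simp add: ratio_fn_def p.local_time_0 indicator_def)
  qed auto
  then have "(\<integral>\<omega>. indicator (space M) \<omega> * at_time (ratio_fn y) 0 \<omega> \<partial>M) / H \<le> 2 / H"
    using assms(3) by (intro divide_right_mono) (auto simp: prob_space)
  then show "measure M {\<omega> \<in> space M. \<exists>t\<in>\<rat>. 0 \<le> t \<and> H \<le> at_time (ratio_fn y) t \<omega>} \<le> 2 / H"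
    using max(2) by linarith
qed

lemma AE_ratio_bounded:
  "AE \<omega> in M. \<forall>y\<in>tree_vertices 3. y \<noteq> [] \<longrightarrow> (\<exists>K. \<forall>t\<in>\<rat>. 0 \<le> t \<longrightarrow> at_time (ratio_fn y) t \<omega> \<le> K)"
proof -
  have "AE \<omega> in M. \<exists>K. \<forall>t\<in>\<rat>. 0 \<le> t \<longrightarrow> at_time (ratio_fn y) t \<omega> \<le> K"
    if y: "y \<in> tree_vertices 3" "y \<noteq> []" for y
  proof -
    have "AE \<omega> in M. \<exists>n. \<omega> \<notin> {\<omega> \<in> space M. \<exists>t\<in>\<rat>. 0 \<le> t \<and> real (Suc n) \<le> at_time (ratio_fn y) t \<omega>}"
    proof (rule AE_not_in_all_small)
      show "(\<lambda>n. 2 / real (Suc n)) \<longlonglongrightarrow> 0" by real_asymp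
    qed (use ratio_large[OF y] in auto)
    then show ?thesis using AE_space
    proof eventually_elim
      case (elim \<omega>)
      then obtain n where "\<omega> \<notin> {\<omega> \<in> space M. \<exists>t\<in>\<rat>. 0 \<le> t \<and> real (Suc n) \<le> at_time (ratio_fn y) t \<omega>}" by blast
      then have "\<forall>t\<in>\<rat>. 0 \<le> t \<longrightarrow> at_time (ratio_fn y) t \<omega> \<le> real (Suc n)"
        using elim(2) by (metis (mono_tags, lifting) mem_Collect_eq nle_le)
      then show ?case by blast
    qed
  qed
  then have "AE \<omega> in M. \<forall>y. y \<in> tree_vertices 3 \<and> y \<noteq> [] \<longrightarrow>
    (\<exists>K. \<forall>t\<in>\<rat>. 0 \<le> t \<longrightarrow> at_time (ratio_fn y) t \<omega> \<le> K)"
    by (subst AE_all_countable) auto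
  then show ?thesis by (rule eventually_mono) blast
qed

lemma AE_ratio_not_oscillating:
  "AE \<omega> in M. \<forall>y\<in>tree_vertices 3. y \<noteq> [] \<longrightarrow> (\<forall>a\<in>\<rat>. \<forall>b\<in>\<rat>. 0 \<le> a \<longrightarrow> a < b \<longrightarrow>
    \<not> oscillates a b (\<lambda>t. at_time (ratio_fn y) t \<omega>))"
proof -
  have "AE \<omega> in M. \<forall>a\<in>\<rat>. \<forall>b\<in>\<rat>. 0 \<le> a \<longrightarrow> a < b \<longrightarrow>
    \<not> oscillates a b (\<lambda>t. at_time (ratio_fn y) t \<omega>)"
    if y: "y \<in> tree_vertices 3" "y \<noteq> []" for y
    unfolding AE_ball_countable[OF countable_rat]
  proof (intro ballI)
    fix a b :: real
    show "AE \<omega> in M. 0 \<le> a \<longrightarrow> a < b \<longrightarrow>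
    \<not> oscillates a b (\<lambda>t. at_time (ratio_fn y) t \<omega>)"
    proof (cases "0 \<le> a \<and> a < b")
      case True
      then have "0 \<le> a" "a < b" by auto
      from supermartingale_not_oscillating[OF ratio_supermartingale[OF y] this]
      show ?thesis by (rule eventually_mono) blast
    qed auto
  qed
  then have "AE \<omega> in M. \<forall>y. y \<in> tree_vertices 3 \<and> y \<noteq> [] \<longrightarrow> (\<forall>a\<in>\<rat>. \<forall>b\<in>\<rat>. 0 \<le> a \<longrightarrow> a < b \<longrightarrow>
    \<not> oscillates a b (\<lambda>t. at_time (ratio_fn y) t \<omega>))"
    by (subst AE_all_countable) auto
  then show ?thesis by (rule eventually_mono) blast
qed

text \<open>Each jump changes the depth by 1; hence a vertex deeper than the number of jumps so far
  has not been visited yet.\<close>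

lemma length_le_count:
  assumes "\<omega> \<in> space M" "X 0 \<omega> = []" "0 \<le> s" "s \<le> t"
  shows "length (X s \<omega>) \<le> count t \<omega>"
proof -
  interpret p: jump_path "tree_adj 3" "\<lambda>u. X u \<omega>" by (rule jump_path[OF assms(1)])
  have "length x \<le> n" if "x \<in> reachable (tree_adj 3) [] n" for x n
    using that by (induction n arbitrary: x) (fastforce simp: tree_adj_def)+
  then have "length (X s \<omega>) \<le> count s \<omega>" using p.path_reachable[OF assms(3)] assms(2) by simp
  also have "\<dots> \<le> count t \<omega>" by (rule p.jump_count_mono[OF assms(4)])
  finally show ?thesis .
qed

text \<open>Entering the subtree of \<open>z\<close> is only possible through \<open>z\<close>, so
  at \<tau> the whole subtree is unexplored. Just afterwards \<open>z\<close> has three fresh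
  children and local time \<open>1 + (q - \<tau>)\<close>, which makes its factor explicit and
  bounds the escape function at every strict ancestor \<open>v\<close>.\<close>

lemma first_visit:
  assumes \<omega>: "\<omega> \<in> space M" and start: "X 0 \<omega> = []" and z: "z \<noteq> []" and visit: "0 \<le> t" "suffix z (X t \<omega>)"
  obtains \<tau> d where "0 < \<tau>" "X \<tau> \<omega> = z" "\<And>s. 0 \<le> s \<Longrightarrow> s < \<tau> \<Longrightarrow> \<not> suffix z (X s \<omega>)"
    "0 < d" "d \<le> \<tau>" "\<And>s. \<tau> - d < s \<Longrightarrow> s < \<tau> \<Longrightarrow> X s \<omega> = tl z"
    "\<And>s. \<tau> \<le> s \<Longrightarrow> s < \<tau> + d \<Longrightarrow> X s \<omega> = z"
    "\<And>q v. \<tau> < q \<Longrightarrow> q < \<tau> + d \<Longrightarrow> strict_suffix v z \<Longrightarrow> at_time (escape_fn v) q \<omega>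
      \<le> 1 - 3 * (exp (- (1 + (q - \<tau>)) / 2) / (3 * local_times \<tau> \<omega> (tl z) + 9 / 2))"
proof -
  interpret p: jump_path "tree_adj 3" "\<lambda>u. X u \<omega>" by (rule jump_path[OF \<omega>])
  have n0: "\<not> suffix z (X 0 \<omega>)" using start z by simp
  obtain \<tau> x d1 where \<tau>: "0 < \<tau>" "suffix z (X \<tau> \<omega>)" "\<And>s. 0 \<le> s \<Longrightarrow> s < \<tau> \<Longrightarrow> \<not> suffix z (X s \<omega>)"
    and x: "tree_adj 3 x (X \<tau> \<omega>)" "\<not> suffix z x"
    and d1: "0 < d1" "d1 \<le> \<tau>" "\<And>s. \<tau> - d1 < s \<Longrightarrow> s < \<tau> \<Longrightarrow> X s \<omega> = x"
    by (rule p.first_entrance[of t "suffix z", OF visit n0]) (rule that; assumption)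
  have Xz: "X \<tau> \<omega> = z" and xz: "x = tl z" using suffix_tree_step[OF x(1) \<tau>(2) x(2)] by auto
  obtain d2 where d2: "d2 > 0" "\<And>s. \<tau> \<le> s \<Longrightarrow> s < \<tau> + d2 \<Longrightarrow> X s \<omega> = X \<tau> \<omega>"
    using p.right_nbhd[OF less_imp_le[OF \<tau>(1)]] by blast
  have L1: "1 \<le> local_times q \<omega> v" for q v by (rule p.local_time_ge_1)
  show ?thesis
  proof (rule that[of \<tau> "min d1 d2"])
    fix q v assume q: "\<tau> < q" "q < \<tau> + min d1 d2" and v: "strict_suffix v z"
    have Xq: "X q \<omega> = z" using d2(2)[of q] q Xz by simp
    have Lq: "local_times q \<omega> v = local_times \<tau> \<omega> v + of_bool (v = z) * (q - \<tau>)" for v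
    proof (rule p.local_time_const)
      fix s assume "\<tau> \<le> s" "s < q"
      then show "X s \<omega> = z" using d2(2)[of s] Xz q by simp
    qed (use \<tau>(1) q in simp_all)
    have unv: "local_times \<tau> \<omega> v = 1" if "suffix z v" for v
    proof (rule p.local_time_unvisited)
      fix s assume "0 \<le> s" "s < \<tau>"
      then show "X s \<omega> \<noteq> v" using \<tau>(3)[of s] that by auto
    qed (use \<tau>(1) in simp)
    have "fresh (i # z) z (local_times q \<omega>)" for i
      unfolding fresh_def
    proof (intro conjI allI impI)
      show "\<not> suffix (i # z) z" using suffix_length_le[of "i # z" z] by auto
      fix w assume w: "suffix (i # z) w"
      have "suffix z w" using w by (rule suffix_ConsD)
      moreover have "w \<noteq> z" using suffix_length_le[OF w] by auto
      ultimately show "local_times q \<omega> w = 1" using Lq[of w] unv[of w] by simp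
    qed
    then have k: "fresh_children z z (local_times q \<omega>) = 3" by (simp add: fresh_children_def)
    have Lz: "local_times q \<omega> z = 1 + (q - \<tau>)" using Lq[of z] unv[of z] by simp
    have "tl z \<noteq> z" using z by (cases z) auto
    then have Lp: "local_times q \<omega> (tl z) = local_times \<tau> \<omega> (tl z)" using Lq[of "tl z"] by simp
    have "at_time (escape_fn v) q \<omega> \<le> return_bound z z (local_times q \<omega>)"
      unfolding Xq by (rule escape_fn_le_return_bound[OF L1 v])
    then show "at_time (escape_fn v) q \<omega> \<le> 1 - 3 * (exp (- (1 + (q - \<tau>)) / 2) / (3 * local_times \<tau> \<omega> (tl z) + 9 / 2))"
      unfolding return_bound_def k Lz Lp .
  next
    fix s assume "\<tau> - min d1 d2 < s" "s < \<tau>"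
    then show "X s \<omega> = tl z" using d1(3)[of s] xz by simp
  next
    fix s assume "\<tau> \<le> s" "s < \<tau> + min d1 d2"
    then show "X s \<omega> = z" using d2(2)[of s] Xz by simp
  next
    fix s assume "0 \<le> s" "s < \<tau>"
    then show "\<not> suffix z (X s \<omega>)" by (rule \<tau>(3))
  qed (use \<tau>(1) Xz d1(1,2) d2(1) in simp_all)
qed

text \<open>The lower level bounds the escape function within time 1 after a first visit if the
  local time at the parent is then at most \<open>n + 1\<close>: the exponent is at least -1. It is
  nonnegative, as the non-oscillation theorem requires.\<close>

lemma AE_escape_not_oscillating:
  "AE \<omega> in M. \<forall>y. \<forall>n::nat.
    \<not> oscillates (1 - 3 * (exp (- 1) / (3 * (real n + 1) + 9 / 2))) 1 (\<lambda>t. at_time (escape_fn y) t \<omega>)"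
  unfolding AE_all_countable
proof (intro allI)
  fix y and n :: nat
  have "exp (- 1) / (3 * (real n + 1) + 9 / 2) \<le> 1 / 3"
    using frac_le[of 1 "exp (- 1)" 3 "3 * (real n + 1) + 9 / 2"] by simp
  moreover have "0 < exp (- 1 :: real) / (3 * (real n + 1) + 9 / 2)" by (intro divide_pos_pos) auto
  ultimately show "AE \<omega> in M.
    \<not> oscillates (1 - 3 * (exp (- 1) / (3 * (real n + 1) + 9 / 2))) 1 (\<lambda>t. at_time (escape_fn y) t \<omega>)"
    by (intro supermartingale_not_oscillating escape_supermartingale) linarith+
qed

text \<open>Along one ray of descendants, large values for all deep vertices form a limit inferior
  of events of probability at most \<open>2 / (n + 1)\<close>. One ray suffices for the
  contradiction.\<close>

lemma AE_deep_ratios_not_large: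
  assumes y: "y \<in> tree_vertices 3" "y \<noteq> []"
  shows "AE \<omega> in M. \<exists>n::nat. \<forall>k. \<exists>d\<ge>k.
    \<not> (\<exists>t\<in>\<rat>. 0 \<le> t \<and> real (Suc n) \<le> at_time (ratio_fn (replicate (Suc d) 0 @ y)) t \<omega>)"
proof -
  define S where "S n d = {\<omega> \<in> space M. \<exists>t\<in>\<rat>. 0 \<le> t \<and>
    real (Suc n) \<le> at_time (ratio_fn (replicate (Suc d) 0 @ y)) t \<omega>}" for n d
  have v: "replicate (Suc d) 0 @ y \<in> tree_vertices 3" "replicate (Suc d) 0 @ y \<noteq> []" for d
    using y by (auto simp: tree_vertices_def)
  have S: "S n d \<in> sets M" "measure M (S n d) \<le> 2 / real (Suc n)" for n d
    unfolding S_def by (rule ratio_large[OF v]; simp)+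
  have "AE \<omega> in M. \<exists>n. \<omega> \<notin> (\<Union>k. \<Inter>d\<in>{k..}. S n d)"
  proof (rule AE_not_in_all_small)
    show "(\<lambda>n. 2 / real (Suc n)) \<longlonglongrightarrow> 0" by real_asymp
    show "(\<Union>k. \<Inter>d\<in>{k..}. S n d) \<in> sets M" for n by (rule measure_liminf_le(2)[OF S])
    show "measure M (\<Union>k. \<Inter>d\<in>{k..}. S n d) \<le> 2 / real (Suc n)" for n by (rule measure_liminf_le(1)[OF S])
  qed
  then show ?thesis using AE_space
  proof eventually_elim
    case (elim \<omega>)
    then obtain n where n: "\<omega> \<notin> (\<Union>k. \<Inter>d\<in>{k..}. S n d)" by blast
    have "\<exists>d\<ge>k. \<not> (\<exists>t\<in>\<rat>. 0 \<le> t \<and> real (Suc n) \<le> at_time (ratio_fn (replicate (Suc d) 0 @ y)) t \<omega>)" for k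
    proof -
      obtain d where d: "d \<ge> k" "\<omega> \<notin> S n d" using n by auto
      show ?thesis by (rule exI[of _ d]) (use d elim(2) in \<open>simp add: S_def\<close>)
    qed
    then show ?case by blast
  qed
qed

text \<open>The escape function returns to 1 with each exit from the subtree of \<open>y\<close>, so
  without oscillation it finally exceeds the level for \<open>n\<close>. The first visit to a deep
  vertex comes that late, and there the escape function can exceed the level only if the local time
  at the parent is large.\<close>

lemma deep_ratio_large:
  assumes \<omega>: "\<omega> \<in> space M" and start: "X 0 \<omega> = []" and y: "y \<in> tree_vertices 3"
    and out: "\<And>s. \<exists>t>s. \<not> suffix y (X t \<omega>)"
    and unb: "\<And>z B. z \<in> tree_vertices 3 \<Longrightarrow> suffix y z \<Longrightarrow> \<exists>t\<ge>0. B < local_times t \<omega> z"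
    and osc: "\<not> oscillates (1 - 3 * (exp (- 1) / (3 * (real n + 1) + 9 / 2))) 1 (\<lambda>t. at_time (escape_fn y) t \<omega>)"
  shows "\<exists>k. \<forall>d\<ge>k. \<exists>t\<in>\<rat>. 0 \<le> t \<and> real (Suc n) \<le> at_time (ratio_fn (replicate (Suc d) 0 @ y)) t \<omega>"
proof -
  interpret p: jump_path "tree_adj 3" "\<lambda>u. X u \<omega>" by (rule jump_path[OF \<omega>])
  define a where "a = 1 - 3 * (exp (- 1) / (3 * (real n + 1) + 9 / 2))"
  have one: "\<exists>t\<in>\<rat>. s < t \<and> 1 \<le> at_time (escape_fn y) t \<omega>" for s
  proof -
    obtain t where t: "t > max 0 s" "\<not> suffix y (X t \<omega>)" using out by blast
    have t0: "0 \<le> t" using t(1) by simp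
    obtain q where q: "q \<in> \<rat>" "t < q" "X q \<omega> = X t \<omega>"
      by (rule p.rational_time_after[OF t0, of "t + 1"]) simp_all
    have "\<not> strict_suffix y (X q \<omega>)" using q(3) t(2) by (simp add: strict_suffix_def)
    then have "at_time (escape_fn y) q \<omega> = 1" by (rule escape_fn_not_strict)
    then show ?thesis using q t(1) by (intro bexI[of _ q]) auto
  qed
  obtain s0 where s0: "\<And>t. t \<in> \<rat> \<Longrightarrow> s0 < t \<Longrightarrow> a < at_time (escape_fn y) t \<omega>"
    using osc one unfolding a_def[symmetric] by (meson not_le)
  define s1 where "s1 = max 0 s0"
  have s1: "0 \<le> s1" by (simp add: s1_def)
  show ?thesis
  proof (intro exI[of _ "count s1 \<omega>"] allI impI)
    fix d assume d: "count s1 \<omega> \<le> d"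
    define z where "z = replicate (Suc d) 0 @ y"
    have z: "z \<in> tree_vertices 3" "z \<noteq> []" "suffix y z" "strict_suffix y z" "length z = Suc d + length y"
      using y by (auto simp: z_def tree_vertices_def strict_suffix_def suffix_def)
    obtain t1 where t1: "0 \<le> t1" "1 < local_times t1 \<omega> z" using unb[OF z(1,3)] by blast
    have "\<exists>t\<ge>0. X t \<omega> = z"
    proof (rule ccontr)
      assume "\<not> ?thesis"
      then have "local_times t1 \<omega> z = 1" by (intro p.local_time_unvisited[OF t1(1)]) blast
      then show False using t1(2) by simp
    qed
    then obtain t where t: "0 \<le> t" "suffix z (X t \<omega>)" by auto
    obtain \<tau> e where \<tau>: "0 < \<tau>" "X \<tau> \<omega> = z" "\<And>s. 0 \<le> s \<Longrightarrow> s < \<tau> \<Longrightarrow> \<not> suffix z (X s \<omega>)"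
      "0 < e" "e \<le> \<tau>" "\<And>s. \<tau> - e < s \<Longrightarrow> s < \<tau> \<Longrightarrow> X s \<omega> = tl z"
      and esc: "\<And>q v. \<tau> < q \<Longrightarrow> q < \<tau> + e \<Longrightarrow> strict_suffix v z \<Longrightarrow> at_time (escape_fn v) q \<omega>
      \<le> 1 - 3 * (exp (- (1 + (q - \<tau>)) / 2) / (3 * local_times \<tau> \<omega> (tl z) + 9 / 2))"
      by (rule first_visit[OF \<omega> start z(2) t]) (rule that; assumption)
    \<comment> \<open>The depth of \<open>z\<close> exceeds the number of jumps up to
      \<open>s1\<close>.\<close>
    have "s1 < \<tau>"
    proof (rule ccontr)
      assume "\<not> s1 < \<tau>"
      then have "length (X \<tau> \<omega>) \<le> count s1 \<omega>" by (intro length_le_count[OF \<omega> start]) (use \<tau>(1) in auto)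
      then show False using \<tau>(2) z(5) d by simp
    qed
    define l where "l = local_times \<tau> \<omega> (tl z)"
    have l: "1 \<le> l" unfolding l_def by (rule p.local_time_ge_1)
    obtain q where q: "q \<in> \<rat>" "\<tau> < q" "q < \<tau> + min e 1" using Rats_dense_in_real[of \<tau> "\<tau> + min e 1"] \<tau>(4) by auto
    have "a < at_time (escape_fn y) q \<omega>" by (rule s0[OF q(1)]) (use q(2) \<open>s1 < \<tau>\<close> in \<open>simp add: s1_def\<close>)
    also have "\<dots> \<le> 1 - 3 * (exp (- (1 + (q - \<tau>)) / 2) / (3 * l + 9 / 2))"
      unfolding l_def by (rule esc[OF q(2) _ z(4)]) (use q(3) in simp)
    finally have "exp (- (1 + (q - \<tau>)) / 2) / (3 * l + 9 / 2) < exp (- 1) / (3 * (real n + 1) + 9 / 2)"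
      by (simp add: a_def)
    moreover have "exp (- 1) \<le> exp (- (1 + (q - \<tau>)) / 2)" using q(3) by simp
    ultimately have "\<not> l \<le> real n + 1"
      using frac_le[of "exp (- (1 + (q - \<tau>)) / 2)" "exp (- 1)" "3 * l + 9 / 2" "3 * (real n + 1) + 9 / 2"] l by force
    then have ln: "real n + 1 < l" by simp
    \<comment> \<open>Just before the first visit the local time at \<open>z\<close> is still 1, so
      the ratio is the local time at the parent. Going back by less than 1 loses less than 1 of it,
      and the crossing term \<open>1 / (L z)\<^sup>2 = 1\<close> makes up for that.\<close>
    obtain r where r: "r \<in> \<rat>" "\<tau> - min e 1 < r" "r < \<tau>" using Rats_dense_in_real[of "\<tau> - min e 1" \<tau>] \<tau>(4) by auto
    have r0: "0 \<le> r" using r(2) \<tau>(5) by simp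
    have "X r \<omega> = tl z" by (rule \<tau>(6)) (use r in auto)
    then have ns: "\<not> suffix z (X r \<omega>)" using not_suffix_tl[OF z(2)] by simp
    have Lz: "local_times r \<omega> z = 1"
      by (rule p.local_time_unvisited[OF r0]) (use \<tau>(3) r(3) in fastforce)
    have "l \<le> local_times r \<omega> (tl z) + (\<tau> - r)"
      unfolding l_def by (rule p.local_time_lipschitz) (use r0 r(3) in auto)
    then have "real (Suc n) \<le> at_time (ratio_fn z) r \<omega>"
      using ns ln r(2) unfolding ratio_fn_def Lz by simp
    then show "\<exists>t\<in>\<rat>. 0 \<le> t \<and> real (Suc n) \<le> at_time (ratio_fn (replicate (Suc d) 0 @ y)) t \<omega>"
      unfolding z_def[symmetric] using r(1) r0 by blast
  qed
qed

text \<open>The vertex \<open>y\<close> is \<open>v\<close> or a child of \<open>v\<close>.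
  Otherwise the process would finally stay in the subtree of \<open>v\<close> and outside those of
  its children, that is at \<open>v\<close>, and a jump to \<open>v\<close> would have nowhere to
  come from.\<close>

lemma infinite_visits_crossing:
  assumes \<omega>: "\<omega> \<in> space M" and v: "v \<in> tree_vertices 3"
    and inf: "infinite {s. 0 < s \<and> jumps_to (\<lambda>t. X t \<omega>) s v}"
  obtains y where "y \<in> tree_vertices 3" "y \<noteq> []"
    "\<And>s. \<exists>t>s. suffix y (X t \<omega>)" "\<And>s. \<exists>t>s. \<not> suffix y (X t \<omega>)"
proof -
  interpret p: jump_path "tree_adj 3" "\<lambda>u. X u \<omega>" by (rule jump_path[OF \<omega>])
  define S where "S = {s. 0 < s \<and> jumps_to (\<lambda>t. X t \<omega>) s v}"
  have unb: "\<exists>s>T. s \<in> S" for T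
  proof (rule ccontr)
    assume "\<not> ?thesis"
    then have "S \<subseteq> jump_times (\<lambda>u. X u \<omega>) \<inter> {..T}"
      by (auto simp: S_def jump_times_def jumps_to_def not_less)
    then show False using inf finite_subset p.finite_jump_times unfolding S_def by blast
  qed
  have Xv: "X s \<omega> = v" if "s \<in> S" for s using that by (simp add: S_def jumps_to_def)
  have "\<exists>y. y \<in> tree_vertices 3 \<and> y \<noteq> [] \<and> (\<forall>s. \<exists>t>s. suffix y (X t \<omega>)) \<and> (\<forall>s. \<exists>t>s. \<not> suffix y (X t \<omega>))"
  proof (rule ccontr)
    assume neg: "\<not> ?thesis"
    have child: "\<forall>\<^sub>F t in at_top. \<not> suffix (j # v) (X t \<omega>)" if j: "j < 3" for j
    proof -
      have "j # v \<in> tree_vertices 3" using v j by (auto simp: tree_vertices_def)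
      moreover have "\<exists>t>s. \<not> suffix (j # v) (X t \<omega>)" for s
      proof -
        obtain t where t: "t > s" "t \<in> S" using unb by blast
        have "\<not> suffix (j # v) (X t \<omega>)" using Xv[OF t(2)] suffix_length_le[of "j # v" v] by auto
        then show ?thesis using t(1) by blast
      qed
      ultimately obtain s where "\<forall>t>s. \<not> suffix (j # v) (X t \<omega>)" using neg by blast
      then show ?thesis by (intro eventually_mono[OF eventually_gt_at_top[of s]]) blast
    qed
    have below: "\<forall>\<^sub>F t in at_top. v \<noteq> [] \<longrightarrow> suffix v (X t \<omega>)"
    proof (cases "v = []")
      case False
      have "\<exists>t>s. suffix v (X t \<omega>)" for s
      proof -
        obtain t where t: "t > s" "t \<in> S" using unb by blast
        have "suffix v (X t \<omega>)" using Xv[OF t(2)] by simp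
        then show ?thesis using t(1) by blast
      qed
      then obtain s where "\<forall>t>s. suffix v (X t \<omega>)" using neg v False by blast
      then show ?thesis by (intro eventually_mono[OF eventually_gt_at_top[of s]]) blast
    qed simp
    have "\<forall>\<^sub>F t in at_top. \<forall>j\<in>{..<3::nat}. \<not> suffix (j # v) (X t \<omega>)"
      by (rule eventually_ball_finite) (use child in auto)
    with below have "\<forall>\<^sub>F t in at_top. (v \<noteq> [] \<longrightarrow> suffix v (X t \<omega>)) \<and> (\<forall>j\<in>{..<3::nat}. \<not> suffix (j # v) (X t \<omega>))"
      by (rule eventually_conj)
    then obtain T where T: "\<And>t. t \<ge> T \<Longrightarrow> (v \<noteq> [] \<longrightarrow> suffix v (X t \<omega>)) \<and> (\<forall>j\<in>{..<3::nat}. \<not> suffix (j # v) (X t \<omega>))"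
      unfolding eventually_at_top_linorder by blast
    obtain s where s: "s > T" "s \<in> S" using unb by blast
    obtain d x where d: "d > 0" "tree_adj 3 x v" "\<And>r. s - d < r \<Longrightarrow> r < s \<Longrightarrow> X r \<omega> = x"
      using p.jumps_toE[of s v] s(2) unfolding S_def by blast
    obtain r where r: "max T (s - d) < r" "r < s" using dense[of "max T (s - d)" s] s(1) d(1) by auto
    have Xr: "X r \<omega> = x" by (rule d(3)) (use r in auto)
    have Tr: "(v \<noteq> [] \<longrightarrow> suffix v x) \<and> (\<forall>j\<in>{..<3::nat}. \<not> suffix (j # v) x)"
      using T[of r] r(1) Xr by simp
    obtain i where i: "v = i # x \<or> x = i # v" using d(2) by (auto simp: tree_adj_def)
    then show False
    proof
      assume "v = i # x"
      then show False using Tr suffix_length_le[of v x] by auto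
    next
      assume x: "x = i # v"
      then have "i < 3" using d(2) by (auto simp: tree_adj_def tree_vertices_def)
      then show False using Tr x by auto
    qed
  qed
  then show ?thesis using that by blast
qed

lemma drift: "drifts_to_infinity M (tree_vertices 3) X"
proof -
  have "AE \<omega> in M. \<forall>y. y \<in> tree_vertices 3 \<and> y \<noteq> [] \<longrightarrow> (\<exists>n::nat. \<forall>k. \<exists>d\<ge>k.
    \<not> (\<exists>t\<in>\<rat>. 0 \<le> t \<and> real (Suc n) \<le> at_time (ratio_fn (replicate (Suc d) 0 @ y)) t \<omega>))"
    unfolding AE_all_countable using AE_deep_ratios_not_large by auto
  then show ?thesis
    unfolding drifts_to_infinity_def
    using AE_ratio_bounded AE_ratio_not_oscillating AE_escape_not_oscillating start AE_space
  proof eventually_elim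
    case (elim \<omega>)
    note deep = elim(1) and bounded = elim(2) and osc = elim(3) and esc = elim(4) and start = elim(5) and \<omega> = elim(6)
    interpret p: jump_path "tree_adj 3" "\<lambda>u. X u \<omega>" by (rule jump_path[OF \<omega>])
    show ?case
    proof (rule ballI, rule ccontr)
      fix v assume v: "v \<in> tree_vertices 3" and inf: "infinite {s. 0 < s \<and> jumps_to (\<lambda>t. X t \<omega>) s v}"
      obtain y where y: "y \<in> tree_vertices 3" "y \<noteq> []"
        and cross: "\<And>s. \<exists>t>s. suffix y (X t \<omega>)" "\<And>s. \<exists>t>s. \<not> suffix y (X t \<omega>)"
        by (rule infinite_visits_crossing[OF \<omega> v inf]) (rule that; assumption)
      obtain K where K: "\<And>t. t \<in> \<rat> \<Longrightarrow> 0 \<le> t \<Longrightarrow> at_time (ratio_fn y) t \<omega> \<le> K"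
        using bounded y by blast
      have base: "\<exists>t\<ge>0. B < local_times t \<omega> y" for B
      proof (rule p.local_time_unbounded[where P = "suffix y" and x = "tl y" and R = "\<lambda>t. at_time (ratio_fn y) t \<omega>"])
        show "at_time (ratio_fn y) t \<omega> = (if suffix y (X t \<omega>) then 0 else 1 / (local_times t \<omega> y)\<^sup>2)
          + local_times t \<omega> (tl y) / local_times t \<omega> y" for t
          by (simp only: ratio_fn_def)
        show "\<not> oscillates a b (\<lambda>t. at_time (ratio_fn y) t \<omega>)"
          if "a \<in> \<rat>" "b \<in> \<rat>" "0 \<le> a" "a < b" for a b
          using osc y that by blast
      qed (rule cross K; assumption?)+
      \<comment> \<open>Unbounded local times spread downwards: a bounded ratio function for the
        edge to the child gives \<open>L ?z \<le> \<bar>K\<bar> * L ?w\<close>. The absolute values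
        avoid a distinction of signs.\<close>
      have unb: "\<exists>t\<ge>0. B < local_times t \<omega> (zs @ y)" if "zs @ y \<in> tree_vertices 3" for zs B
        using that
      proof (induction zs arbitrary: B)
        case Nil
        then show ?case using base by simp
      next
        case (Cons i zs)
        let ?z = "zs @ y" and ?w = "i # zs @ y"
        have z: "?z \<in> tree_vertices 3" "?w \<in> tree_vertices 3" using Cons.prems by (auto simp: tree_vertices_def)
        obtain K where K: "\<And>t. t \<in> \<rat> \<Longrightarrow> 0 \<le> t \<Longrightarrow> at_time (ratio_fn ?w) t \<omega> \<le> K"
          using bounded z(2) by blast
        obtain t where t: "0 \<le> t" "\<bar>K\<bar> * \<bar>B\<bar> < local_times t \<omega> ?z" using Cons.IH[OF z(1)] by blast
        obtain q where q: "q \<in> \<rat>" "t < q" using Rats_dense_in_real[of t "t + 1"] by auto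
        have Lw: "1 \<le> local_times q \<omega> ?w" by (rule p.local_time_ge_1)
        have "local_times q \<omega> ?z / local_times q \<omega> ?w \<le> at_time (ratio_fn ?w) q \<omega>"
          by (simp add: ratio_fn_def)
        also have "\<dots> \<le> \<bar>K\<bar>" using K[of q] q t(1) by simp
        finally have "local_times q \<omega> ?z \<le> \<bar>K\<bar> * local_times q \<omega> ?w" using Lw by (simp add: divide_le_eq)
        moreover have "local_times t \<omega> ?z \<le> local_times q \<omega> ?z" by (rule p.local_time_mono) (use t q in auto)
        ultimately have "\<bar>K\<bar> * \<bar>B\<bar> < \<bar>K\<bar> * local_times q \<omega> ?w" using t(2) by linarith
        then have "\<bar>B\<bar> < local_times q \<omega> ?w" by (simp add: mult_less_cancel_left)
        then show ?case using q t(1) by (intro exI[of _ q]) auto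
      qed
      obtain n where n: "\<And>k. \<exists>d\<ge>k. \<not> (\<exists>t\<in>\<rat>. 0 \<le> t \<and> real (Suc n) \<le> at_time (ratio_fn (replicate (Suc d) 0 @ y)) t \<omega>)"
        using deep y by blast
      have "\<exists>k. \<forall>d\<ge>k. \<exists>t\<in>\<rat>. 0 \<le> t \<and> real (Suc n) \<le> at_time (ratio_fn (replicate (Suc d) 0 @ y)) t \<omega>"
      proof (rule deep_ratio_large[OF \<omega> start y(1) cross(2)])
        show "\<exists>t\<ge>0. B < local_times t \<omega> z" if "z \<in> tree_vertices 3" "suffix y z" for z B
          using unb that by (auto simp: suffix_def)
      qed (use esc in blast)
      then show False using n by blast
    qed
  qed
qed

section \<open>Transience\<close>

lemma sets_same_place: "0 \<le> q \<Longrightarrow> {\<omega> \<in> space M. X q \<omega> = X 0 \<omega>} \<in> sets M"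
proof -
  assume q: "0 \<le> q"
  have "(\<lambda>\<omega>. X q \<omega> = X 0 \<omega>) \<in> M \<rightarrow>\<^sub>M count_space UNIV"
    by (rule measurable_compose_countable[where f = "\<lambda>y \<omega>. X q \<omega> = y", OF _ random_vertex_UNIV])
      (rule measurable_compose[OF random_vertex_UNIV[OF q]], simp_all)
  then show ?thesis by (simp add: pred_def)
qed

text \<open>The countable form makes the event measurable, so that its probability can be compared
  with that of an excursion.\<close>

lemma never_returns_iff:
  assumes "\<omega> \<in> space M"
  shows "never_returns (\<lambda>t. X t \<omega>) \<longleftrightarrow> (\<exists>q\<in>\<rat>. 0 < q \<and> X q \<omega> \<noteq> X 0 \<omega>) \<and>
    (\<forall>q\<in>\<rat>. \<forall>r\<in>\<rat>. 0 < q \<longrightarrow> q < r \<longrightarrow> X q \<omega> \<noteq> X 0 \<omega> \<longrightarrow> X r \<omega> \<noteq> X 0 \<omega>)"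
proof -
  interpret p: jump_path "tree_adj 3" "\<lambda>u. X u \<omega>" by (rule jump_path[OF assms])
  have "(\<exists>s>0. X s \<omega> \<noteq> X 0 \<omega>) \<longleftrightarrow> (\<exists>q\<in>\<rat>. 0 < q \<and> X q \<omega> \<noteq> X 0 \<omega>)"
  proof
    assume "\<exists>s>0. X s \<omega> \<noteq> X 0 \<omega>"
    then obtain s where s: "0 < s" "X s \<omega> \<noteq> X 0 \<omega>" by blast
    obtain q where "q \<in> \<rat>" "s < q" "X q \<omega> = X s \<omega>"
      by (rule p.rational_time_after[of s "s + 1"]) (use s(1) in simp_all)
    then show "\<exists>q\<in>\<rat>. 0 < q \<and> X q \<omega> \<noteq> X 0 \<omega>" using s by (intro bexI[of _ q]) auto
  qed blast
  moreover have "(\<exists>s>0. jumps_to (\<lambda>t. X t \<omega>) s (X 0 \<omega>)) \<longleftrightarrow>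
    (\<exists>q\<in>\<rat>. \<exists>r\<in>\<rat>. 0 < q \<and> q < r \<and> X q \<omega> \<noteq> X 0 \<omega> \<and> X r \<omega> = X 0 \<omega>)"
  proof
    assume "\<exists>s>0. jumps_to (\<lambda>t. X t \<omega>) s (X 0 \<omega>)"
    then obtain s where "0 < s" "jumps_to (\<lambda>t. X t \<omega>) s (X 0 \<omega>)" by blast
    then have "\<exists>s\<in>{0<..<s + 1}. jumps_to (\<lambda>t. X t \<omega>) s (X 0 \<omega>)" by (intro bexI[of _ s]) auto
    then show "\<exists>q\<in>\<rat>. \<exists>r\<in>\<rat>. 0 < q \<and> q < r \<and> X q \<omega> \<noteq> X 0 \<omega> \<and> X r \<omega> = X 0 \<omega>"
      unfolding p.jumps_in_interval_iff[OF order_refl] by blast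
  next
    assume "\<exists>q\<in>\<rat>. \<exists>r\<in>\<rat>. 0 < q \<and> q < r \<and> X q \<omega> \<noteq> X 0 \<omega> \<and> X r \<omega> = X 0 \<omega>"
    then obtain q r where qr: "q \<in> \<rat>" "r \<in> \<rat>" "0 < q" "q < r" "X q \<omega> \<noteq> X 0 \<omega>" "X r \<omega> = X 0 \<omega>" by blast
    have "r < r + 1" by simp
    then have "\<exists>s\<in>{0<..<r + 1}. jumps_to (\<lambda>t. X t \<omega>) s (X 0 \<omega>)"
      unfolding p.jumps_in_interval_iff[OF order_refl] using qr by blast
    then show "\<exists>s>0. jumps_to (\<lambda>t. X t \<omega>) s (X 0 \<omega>)" by auto
  qed
  ultimately show ?thesis unfolding never_returns_def by blast
qed

lemma sets_never_returns: "{\<omega> \<in> space M. never_returns (\<lambda>t. X t \<omega>)} \<in> sets M"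
proof -
  let ?S = "\<lambda>q. {\<omega> \<in> space M. X q \<omega> = X 0 \<omega>}"
  have "{\<omega> \<in> space M. never_returns (\<lambda>t. X t \<omega>)} =
    (\<Union>q\<in>\<rat> \<inter> {0<..}. space M - ?S q) - (\<Union>q\<in>\<rat> \<inter> {0<..}. \<Union>r\<in>\<rat> \<inter> {q<..}. (space M - ?S q) \<inter> ?S r)"
    (is "?A = ?B")
  proof (rule set_eqI)
    fix \<omega>
    show "\<omega> \<in> ?A \<longleftrightarrow> \<omega> \<in> ?B"
    proof (cases "\<omega> \<in> space M")
      case True
      show ?thesis unfolding mem_Collect_eq never_returns_iff[OF True] using True by (simp add: Bex_def Ball_def) blast
    qed auto
  qed
  also have "\<dots> \<in> sets M"
  proof (intro sets.Diff)
    show "(\<Union>q\<in>\<rat> \<inter> {0<..}. space M - ?S q) \<in> sets M"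
      by (rule sets.countable_UN'') (auto intro!: sets.Diff sets_same_place intro: countable_Int1 countable_rat)
    show "(\<Union>q\<in>\<rat> \<inter> {0<..}. \<Union>r\<in>\<rat> \<inter> {q<..}. (space M - ?S q) \<inter> ?S r) \<in> sets M"
    proof (rule sets.countable_UN'')
      fix q :: real assume "q \<in> \<rat> \<inter> {0<..}"
      then show "(\<Union>r\<in>\<rat> \<inter> {q<..}. (space M - ?S q) \<inter> ?S r) \<in> sets M"
        by (intro sets.countable_UN'') (auto intro!: sets.Int sets.Diff sets_same_place intro: countable_Int1 countable_rat)
    qed (intro countable_Int1 countable_rat)
  qed
  finally show ?thesis .
qed

text \<open>The fixed-time substitute for stopping during the first visit to a child of the root: by
  time \<open>s\<close> the process has left the root and has not come back. That it is away at time
  \<open>s\<close> is implied by the escape function being below 1.\<close>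

definition excursion :: "real \<Rightarrow> 'a set" where
  "excursion s = {\<omega> \<in> space M. X 0 \<omega> = [] \<and> at_time (escape_fn []) s \<omega> < 1 \<and>
    (\<forall>q\<in>\<rat> \<inter> {0..s}. \<forall>r\<in>\<rat> \<inter> {q..s}. X q \<omega> \<noteq> [] \<longrightarrow> X r \<omega> \<noteq> [])}"

lemma sets_excursion:
  assumes s: "0 \<le> s"
  shows "excursion s \<in> sets (history M X s)"
proof -
  let ?F = "history M X s"
  let ?A = "\<lambda>q. X q -` {[]} \<inter> space ?F"
  have A: "?A q \<in> sets ?F" if "0 \<le> q" "q \<le> s" for q
    by (rule measurable_sets[OF adapted[OF that]]) simp
  have "excursion s = (?A 0 \<inter> (at_time (escape_fn []) s -` {..<1} \<inter> space ?F)) -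
    (\<Union>q\<in>\<rat> \<inter> {0..s}. \<Union>r\<in>\<rat> \<inter> {q..s}. (space ?F - ?A q) \<inter> ?A r)" (is "_ = ?B")
  proof (rule set_eqI)
    fix \<omega>
    show "\<omega> \<in> excursion s \<longleftrightarrow> \<omega> \<in> ?B"
      unfolding excursion_def by (cases "\<omega> \<in> space M") (simp_all add: space_history, blast)
  qed
  also have "\<dots> \<in> sets ?F"
  proof (rule sets.Diff, rule sets.Int)
    show "?A 0 \<in> sets ?F" by (rule A) (use s in auto)
    show "at_time (escape_fn []) s -` {..<1} \<inter> space ?F \<in> sets ?F"
      by (rule measurable_sets) (use escape_supermartingale[of "[]"] s in \<open>auto simp: supermartingale_def\<close>)
    show "(\<Union>q\<in>\<rat> \<inter> {0..s}. \<Union>r\<in>\<rat> \<inter> {q..s}. (space ?F - ?A q) \<inter> ?A r) \<in> sets ?F"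
    proof (rule sets.countable_UN'')
      fix q assume q: "q \<in> \<rat> \<inter> {0..s}"
      show "(\<Union>r\<in>\<rat> \<inter> {q..s}. (space ?F - ?A q) \<inter> ?A r) \<in> sets ?F"
      proof (rule sets.countable_UN'')
        fix r assume r: "r \<in> \<rat> \<inter> {q..s}"
        show "(space ?F - ?A q) \<inter> ?A r \<in> sets ?F"
          by (intro sets.Int sets.Diff sets.top A) (use q r in auto)
      qed (intro countable_Int1 countable_rat)
    qed (intro countable_Int1 countable_rat)
  qed
  finally show ?thesis .
qed

lemma excursion_if_left:
  assumes \<omega>: "\<omega> \<in> space M" and start: "X 0 \<omega> = []" and left: "0 \<le> t" "X t \<omega> \<noteq> []"
  shows "\<exists>s\<in>\<rat> \<inter> {0<..}. \<omega> \<in> excursion s"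
proof -
  interpret p: jump_path "tree_adj 3" "\<lambda>u. X u \<omega>" by (rule jump_path[OF \<omega>])
  have "\<not> (X 0 \<omega> \<noteq> [])" using start by simp
  then obtain \<tau>' x where \<tau>': "0 < \<tau>'" "X \<tau>' \<omega> \<noteq> []" "\<And>s. 0 \<le> s \<Longrightarrow> s < \<tau>' \<Longrightarrow> \<not> (X s \<omega> \<noteq> [])"
    and x: "tree_adj 3 x (X \<tau>' \<omega>)" "\<not> (x \<noteq> [])"
    by (rule p.first_entrance[of t "\<lambda>x. x \<noteq> []", OF left]) (rule that; assumption)
  define z where "z = X \<tau>' \<omega>"
  have z: "z \<noteq> []" "tl z = []" using x \<tau>'(2) by (auto simp: z_def tree_adj_def)
  have suf: "suffix z (X \<tau>' \<omega>)" by (simp add: z_def)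
  obtain \<tau> d where \<tau>: "0 < \<tau>" "X \<tau> \<omega> = z" "\<And>s. 0 \<le> s \<Longrightarrow> s < \<tau> \<Longrightarrow> \<not> suffix z (X s \<omega>)"
    "0 < d" "\<And>s. \<tau> \<le> s \<Longrightarrow> s < \<tau> + d \<Longrightarrow> X s \<omega> = z"
    and esc: "\<And>q v. \<tau> < q \<Longrightarrow> q < \<tau> + d \<Longrightarrow> strict_suffix v z \<Longrightarrow> at_time (escape_fn v) q \<omega>
      \<le> 1 - 3 * (exp (- (1 + (q - \<tau>)) / 2) / (3 * local_times \<tau> \<omega> (tl z) + 9 / 2))"
    by (rule first_visit[OF \<omega> start z(1) less_imp_le[OF \<tau>'(1)] suf]) (rule that; assumption)
  \<comment> \<open>Hence the process sits at the root before \<tau>, and between \<tau> and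
    \<open>s\<close> it sits at \<open>z\<close>.\<close>
  have le: "\<tau> \<le> \<tau>'" using \<tau>(3)[of \<tau>'] \<tau>'(1) suf by force
  obtain s where s: "s \<in> \<rat>" "\<tau> < s" "s < \<tau> + d" using Rats_dense_in_real[of \<tau> "\<tau> + d"] \<tau>(4) by auto
  have "1 \<le> local_times \<tau> \<omega> (tl z)" by (rule p.local_time_ge_1)
  then have "0 < 3 * (exp (- (1 + (s - \<tau>)) / 2) / (3 * local_times \<tau> \<omega> (tl z) + 9 / 2))" by simp
  moreover have "strict_suffix [] z" using z by (simp add: strict_suffix_def)
  ultimately have "at_time (escape_fn []) s \<omega> < 1" using esc[OF s(2,3), of "[]"] by simp
  moreover have "X r \<omega> \<noteq> []" if "q \<in> \<rat> \<inter> {0..s}" "r \<in> \<rat> \<inter> {q..s}" "X q \<omega> \<noteq> []" for q r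
  proof -
    have "\<not> q < \<tau>" using \<tau>'(3)[of q] le that by auto
    then have "X r \<omega> = z" using \<tau>(5)[of r] that s by auto
    then show ?thesis using z by simp
  qed
  ultimately have "\<omega> \<in> excursion s" using \<omega> start by (auto simp: excursion_def)
  then show ?thesis using s \<tau>(1) by (intro bexI[of _ s]) auto
qed

lemma never_returns_if_excursion:
  assumes "\<omega> \<in> excursion s" "\<not> (\<exists>t\<in>\<rat>. s \<le> t \<and> 1 \<le> at_time (escape_fn []) t \<omega>)" "s \<in> \<rat>" "0 < s"
  shows "never_returns (\<lambda>t. X t \<omega>)"
proof -
  have \<omega>: "\<omega> \<in> space M" and start: "X 0 \<omega> = []"
    and before: "\<And>q r. q \<in> \<rat> \<Longrightarrow> 0 \<le> q \<Longrightarrow> q \<le> s \<Longrightarrow> r \<in> \<rat> \<Longrightarrow> q \<le> r \<Longrightarrow> r \<le> s \<Longrightarrow> X q \<omega> \<noteq> [] \<Longrightarrow> X r \<omega> \<noteq> []"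
    using assms(1) by (auto simp: excursion_def)
  have after: "X t \<omega> \<noteq> []" if "t \<in> \<rat>" "s \<le> t" for t
  proof
    assume "X t \<omega> = []"
    then have "\<not> strict_suffix [] (X t \<omega>)" by (simp add: strict_suffix_def)
    then have "at_time (escape_fn []) t \<omega> = 1" by (rule escape_fn_not_strict)
    then show False using assms(2) that by auto
  qed
  show ?thesis
    unfolding never_returns_iff[OF \<omega>] start
  proof (intro conjI ballI impI)
    show "\<exists>q\<in>\<rat>. 0 < q \<and> X q \<omega> \<noteq> []" using after[of s] assms(3,4) by blast
    fix q r :: real assume qr: "q \<in> \<rat>" "r \<in> \<rat>" "0 < q" "q < r" "X q \<omega> \<noteq> []"
    show "X r \<omega> \<noteq> []"
    proof (cases "r \<le> s")
      case True
      then show ?thesis using before[of q r] qr by simp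
    next
      case False
      then show ?thesis using after[of r] qr by simp
    qed
  qed
qed

text \<open>At time 0 the rate is 1, and an error of \<open>1 / 2\<close> leaves a jump probability
  of at least \<open>h / 2\<close>.\<close>

lemma leaves_root: "\<exists>h. 0 < measure M ((X 0 -` {[]} \<inter> space M) \<inter> jump_event 0 h [0])"
proof -
  have "tree_adj 3 [] [0]" by (auto simp: tree_adj_def tree_vertices_def)
  from jump_rate_integral[OF this, of "1 / 2" 0] obtain \<delta> where \<delta>: "\<delta> > 0"
    "\<forall>t\<in>{0..0}. \<forall>h\<in>{0<..<\<delta>}. rate_close [] [0] (1 / 2) t h" by auto
  define h where "h = \<delta> / 2"
  have h: "0 < h" "h < \<delta>" using \<delta>(1) by (auto simp: h_def)
  let ?A = "X 0 -` {[]} \<inter> space M"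
  have AF: "?A \<in> sets (history M X 0)"
    using measurable_sets[OF adapted[of 0 0], of "{[]}"] by (simp add: space_history)
  then have AM: "?A \<in> sets M" using subalgebra_history unfolding subalgebra_def by blast
  have BM: "?A \<inter> jump_event 0 h [0] \<in> sets M" by (intro sets.Int AM sets_jump_event order_refl)
  have W: "(indicator ?A :: 'a \<Rightarrow> real) \<in> borel_measurable (history M X 0)"
    by (rule borel_measurable_indicator[OF AF])
  have a: "\<bar>(\<integral>\<omega>. indicator ?A \<omega> * indicator (jump_event 0 h [0]) \<omega> \<partial>M)
        - h * (\<integral>\<omega>. indicator ?A \<omega> * local_time (\<lambda>u. X u \<omega>) [0] 0 \<partial>M)\<bar> \<le> 1 * (1 / 2) * h"
    by (rule \<delta>(2)[rule_format, OF _ _ W]) (use h in \<open>auto simp: indicator_def\<close>)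
  have b: "(\<integral>\<omega>. indicator ?A \<omega> * local_time (\<lambda>u. X u \<omega>) [0] 0 \<partial>M) = 1"
  proof -
    have "(\<integral>\<omega>. indicator ?A \<omega> * local_time (\<lambda>u. X u \<omega>) [0] 0 \<partial>M) = (\<integral>\<omega>. indicator ?A \<omega> \<partial>M)"
      by (intro Bochner_Integration.integral_cong refl) (simp add: jump_path.local_time_0[OF jump_path])
    also have "\<dots> = measure M ?A" by simp
    also have "\<dots> = 1" by (rule prob_eq_1[OF AM, THEN iffD2]) (use start AE_space in eventually_elim, auto)
    finally show ?thesis .
  qed
  have c: "(\<integral>\<omega>. indicator ?A \<omega> * indicator (jump_event 0 h [0]) \<omega> \<partial>M) = measure M (?A \<inter> jump_event 0 h [0])"
    using sets.sets_into_space[OF BM] by (simp add: indicator_inter_arith[symmetric] Int_absorb2)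
  have "0 < measure M (?A \<inter> jump_event 0 h [0])" using a h(1) unfolding b c by linarith
  then show ?thesis by blast
qed

text \<open>There are countably many candidates \<open>s\<close>. If all their events were null, the
  process would almost surely never leave the root.\<close>

lemma excursion_possible: "\<exists>s\<in>\<rat> \<inter> {0<..}. 0 < measure M (excursion s)"
proof (rule ccontr)
  assume neg: "\<not> ?thesis"
  have eM: "excursion s \<in> sets M" if "0 \<le> s" for s
    using sets_excursion[OF that] subalgebra_history unfolding subalgebra_def by blast
  have "AE \<omega> in M. \<omega> \<notin> excursion s" if s: "s \<in> \<rat> \<inter> {0<..}" for s
  proof -
    have "measure M (excursion s) = 0" using neg s measure_nonneg[of M "excursion s"] by (metis less_eq_real_def)
    then show ?thesis using eM[of s] s by (intro AE_not_in null_setsI) (auto simp: emeasure_eq_measure)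
  qed
  then have "AE \<omega> in M. \<forall>s\<in>\<rat> \<inter> {0<..}. \<omega> \<notin> excursion s"
    by (subst AE_ball_countable) (auto intro: countable_Int1 countable_rat)
  then have stay: "AE \<omega> in M. \<omega> \<notin> (X 0 -` {[]} \<inter> space M) \<inter> jump_event 0 h [0]" for h
    using AE_space
  proof eventually_elim
    case (elim \<omega>)
    show ?case
    proof
      assume "\<omega> \<in> (X 0 -` {[]} \<inter> space M) \<inter> jump_event 0 h [0]"
      then obtain t where "X 0 \<omega> = []" "0 < t" "X t \<omega> = [0]" unfolding jump_event_def jumps_to_def by auto
      then have "X 0 \<omega> = []" "0 \<le> t" "X t \<omega> \<noteq> []" by simp_all
      then show False using excursion_if_left[OF elim(2), of t] elim(1) by blast
    qed
  qed
  obtain h where h: "0 < measure M ((X 0 -` {[]} \<inter> space M) \<inter> jump_event 0 h [0])" using leaves_root by blast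
  have "(X 0 -` {[]} \<inter> space M) \<inter> jump_event 0 h [0] \<in> sets M"
    by (intro sets.Int sets_jump_event measurable_sets[OF random_vertex_UNIV] order_refl) simp
  then have "emeasure M ((X 0 -` {[]} \<inter> space M) \<inter> jump_event 0 h [0]) = 0"
    using stay[of h] by (simp only: AE_iff_null_sets[symmetric] null_setsD1)
  then show False using h by (simp add: emeasure_eq_measure)
qed

lemma transience: "transient M X"
proof -
  obtain s where s: "s \<in> \<rat>" "0 < s" "0 < measure M (excursion s)" using excursion_possible by auto
  let ?A = "excursion s" and ?E = "at_time (escape_fn []) s"
  define B where "B = {\<omega> \<in> ?A. \<exists>t\<in>\<rat>. s \<le> t \<and> 1 \<le> at_time (escape_fn []) t \<omega>}"
  have s0: "0 \<le> s" using s by simp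
  have AF: "?A \<in> sets (history M X s)" by (rule sets_excursion[OF s0])
  then have AM: "?A \<in> sets M" using subalgebra_history unfolding subalgebra_def by blast
  note max = supermartingale_maximal[OF escape_supermartingale zero_less_one s0 AF, of "[]", folded B_def]
  have Ei: "integrable M ?E" using escape_supermartingale[of "[]"] s0 unfolding supermartingale_def by blast
  have iE: "integrable M (\<lambda>\<omega>. indicator ?A \<omega> * ?E \<omega>)"
    using integrable_real_mult_indicator[OF AM Ei] by (simp add: mult.commute)
  have iA: "integrable M (indicator ?A :: 'a \<Rightarrow> real)" using AM by (simp add: less_top[symmetric])
  \<comment> \<open>The escape function is strictly below 1 on an event of positive probability, so
    its integral is strictly below the measure. By the maximal inequality at level 1, a part of
    positive measure never sees the value 1 again, which it would take at the root.\<close>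
  have lt: "(\<integral>\<omega>. indicator ?A \<omega> * ?E \<omega> \<partial>M) < measure M ?A"
  proof -
    have iD: "integrable M (\<lambda>\<omega>. indicator ?A \<omega> - indicator ?A \<omega> * ?E \<omega>)"
      by (rule Bochner_Integration.integrable_diff[OF iA iE])
    have nn: "AE \<omega> in M. 0 \<le> indicator ?A \<omega> - indicator ?A \<omega> * ?E \<omega>"
      by (rule AE_I2) (simp add: excursion_def indicator_def)
    have "(\<integral>\<omega>. indicator ?A \<omega> - indicator ?A \<omega> * ?E \<omega> \<partial>M) \<noteq> 0"
    proof
      assume "(\<integral>\<omega>. indicator ?A \<omega> - indicator ?A \<omega> * ?E \<omega> \<partial>M) = 0"
      then have "AE \<omega> in M. indicator ?A \<omega> - indicator ?A \<omega> * ?E \<omega> = 0"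
        using integral_nonneg_eq_0_iff_AE[OF iD nn] by blast
      then have "AE \<omega> in M. \<omega> \<notin> ?A"
        by (rule eventually_mono) (auto simp: excursion_def indicator_def split: if_splits)
      then have "emeasure M ?A = 0" using AM by (simp only: AE_iff_null_sets[symmetric] null_setsD1)
      then show False using s(3) by (simp add: emeasure_eq_measure)
    qed
    moreover have "0 \<le> (\<integral>\<omega>. indicator ?A \<omega> - indicator ?A \<omega> * ?E \<omega> \<partial>M)"
      by (rule integral_nonneg_AE[OF nn])
    moreover have "(\<integral>\<omega>. indicator ?A \<omega> - indicator ?A \<omega> * ?E \<omega> \<partial>M)
      = (\<integral>\<omega>. indicator ?A \<omega> \<partial>M) - (\<integral>\<omega>. indicator ?A \<omega> * ?E \<omega> \<partial>M)"
      by (rule Bochner_Integration.integral_diff[OF iA iE])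
    moreover have "(\<integral>\<omega>. indicator ?A \<omega> \<partial>M) = measure M ?A"
      using sets.Int_space_eq2[OF AM] by simp
    ultimately show ?thesis by linarith
  qed
  have "measure M B < measure M ?A" using max(2) lt by simp
  moreover have "measure M (?A - B) = measure M ?A - measure M B"
    by (rule finite_measure_Diff[OF AM max(1)]) (auto simp: B_def)
  ultimately have "0 < measure M (?A - B)" by simp
  also have "\<dots> \<le> measure M {\<omega> \<in> space M. never_returns (\<lambda>t. X t \<omega>)}"
  proof (rule finite_measure_mono)
    show "?A - B \<subseteq> {\<omega> \<in> space M. never_returns (\<lambda>t. X t \<omega>)}"
    proof
      fix \<omega> assume \<omega>: "\<omega> \<in> ?A - B"
      then have "never_returns (\<lambda>t. X t \<omega>)"
        by (intro never_returns_if_excursion[OF _ _ s(1,2)]) (auto simp: B_def)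
      then show "\<omega> \<in> {\<omega> \<in> space M. never_returns (\<lambda>t. X t \<omega>)}" using \<omega> by (simp add: excursion_def)
    qed
  qed (rule sets_never_returns)
  finally show ?thesis by (simp add: transient_def)
qed

end

theorem mainTheorem4:
  fixes M :: "'a measure" and X :: "real \<Rightarrow> 'a \<Rightarrow> nat list"
  assumes "vrjp M (tree_vertices 3) (tree_adj 3) X"
    and "AE \<omega> in M. X 0 \<omega> = []"
  shows "transient M X \<and> drifts_to_infinity M (tree_vertices 3) X"
proof -
  interpret vrjp M "tree_vertices 3" "tree_adj 3" X by (rule assms(1))
  interpret tree_vrjp M X by unfold_locales (rule assms(2))
  show ?thesis using transience drift by blast
qed

end
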